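(* Let $N\geq 2$, let $\Omega\subset\mathbb{R}^N$ be a smooth bounded domain, let $p,q\in(N,\infty)$ with $p\neq q$, and let $\lambda>\lambda_\infty(p)$. Let $(r_n)$ be a sequence in $[1,\infty)$ with $r_n\to\infty$. For each $n$ (large enough that $\lambda_{r_n}(p)<\lambda$, in which case such a solution exists) let $u_n$ be a nonnegative least energy solution of $$-(\Delta_p+\Delta_q)u=\lambda\|u\|_{r_n}^{p-r_n}|u|^{r_n-2}u\ \text{ in }\Omega,\qquad u=0\ \text{ on }\partial\Omega .$$ Then there exists a subsequence of $(u_n)$ converging strongly in $X_{p,q}$ to a nonnegative least energy solution $u$ of $$-(\Delta_p+\Delta_q)u=\lambda|u(x_u)|^{p-2}u(x_u)\delta_{x_u}\ \text{ in }\Omega,\qquad u=0\ \text{ on }\partial\Omega .$$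
   Context: $\|\cdot\|_s$ is the norm of $L^s(\Omega)$, $1\le s\le\infty$. $X_{p,q}:=W_0^{1,\max\{p,q\}}(\Omega)$; since $\max\{p,q\}>N$, $X_{p,q}\hookrightarrow C(\overline\Omega)$. $(\Delta_p+\Delta_q)u:=\operatorname{div}[(|\nabla u|^{p-2}+|\nabla u|^{q-2})\nabla u]$. In the second problem, $x_u$ is a maximum point of $|u|$ and $\delta_{x_u}$ is the Dirac delta supported at $x_u$. For $m>N$ and $1\le r<\infty$: $\lambda_r(m):=\min\{\|\nabla v\|_m^m/\|v\|_r^m: v\in W_0^{1,m}(\Omega)\setminus\{0\}\}$ and $\lambda_\infty(m):=\min\{\|\nabla v\|_m^m/\|v\|_\infty^m: v\in W_0^{1,m}(\Omega)\setminus\{0\}\}$. It is known that $\lambda_r(m)\to\lambda_\infty(m)$ as $r\to\infty$. Least energy solutions of the first problem (exponent $r$ in place of $r_n$): put $I_{\lambda,r}(u):=\frac1p\|\nabla u\|_p^p+\frac1q\|\nabla u\|_q^q-\frac{\lambda}{p}\|u\|_r^p$ on $X_{p,q}$ and $\mathcal N_{\lambda,r}:=\{u\in X_{p,q}\setminus\{0\}:\|\nabla u\|_p^p+\|\nabla u\|_q^q=\lambda\|u\|_r^p\}$. A least energy solution is a function $u\in X_{p,q}$ minimizing $I_{\lambda,r}$ over $X_{p,q}\setminus\{0\}$ (with $u$ in this set) if $p<q$, or over $\mathcal N_{\lambda,r}$ (with $u\in\mathcal N_{\lambda,r}$) if $q<p$. Least energy solutions of the second problem: put $J_\lambda(u):=\frac1p\|\nabla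 u\|_p^p+\frac1q\|\nabla u\|_q^q-\frac{\lambda}{p}\|u\|_\infty^p$ on $X_{p,q}$ and $\mathcal N_{\lambda,\infty}:=\{u\in X_{p,q}\setminus\{0\}:\|\nabla u\|_p^p+\|\nabla u\|_q^q=\lambda\|u\|_\infty^p\}$. A least energy solution is a function $u\in X_{p,q}$ minimizing $J_\lambda$ over $X_{p,q}$ if $N<p<q$, or over $\mathcal N_{\lambda,\infty}$ (with $u\in\mathcal N_{\lambda,\infty}$) if $N<q<p$. *)

theory Defs
  imports "HOL-Analysis.Analysis" "HOL-Probability.Essential_Supremum"
begin

section \<open>Smooth functions and smooth bounded domains\<close>

text \<open>Meaningful for open \<open>S\<close> only, since derivatives are taken in the full neighbourhood.\<close>
primrec Ck_on ::
  "nat \<Rightarrow> 'a::euclidean_space set \<Rightarrow> ('a \<Rightarrow> 'b::real_normed_vector) \<Rightarrow> bool" where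
  "Ck_on 0 S f \<longleftrightarrow> continuous_on S f"
| "Ck_on (Suc k) S f \<longleftrightarrow>
     (\<forall>x\<in>S. f differentiable (at x)) \<and> (\<forall>v. Ck_on k S (\<lambda>x. frechet_derivative f (at x) v))"

definition smooth_on :: "'a::euclidean_space set \<Rightarrow> ('a \<Rightarrow> 'b::real_normed_vector) \<Rightarrow> bool" where
  "smooth_on S f \<longleftrightarrow> (\<forall>k. Ck_on k S f)"

text \<open>Near each boundary point, after relabelling and reorienting the coordinate axes, \<open>\<Omega>\<close> is
  the region strictly above a smooth graph.  The direction \<open>b\<close> is plus or minus a coordinate
  vector.  A smooth function of the other coordinates is represented by a smooth
  \<open>\<gamma>\<close> on the whole space that is only evaluated on the hyperplane orthogonal to \<open>b\<close>.\<close>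
definition smooth_boundary :: "'a::euclidean_space set \<Rightarrow> bool" where
  "smooth_boundary \<Omega> \<longleftrightarrow>
     (\<forall>x0 \<in> frontier \<Omega>. \<exists>\<delta>>0. \<exists>b. \<exists>\<gamma>::'a \<Rightarrow> real.
        (b \<in> Basis \<or> - b \<in> Basis) \<and> smooth_on UNIV \<gamma> \<and>
        \<Omega> \<inter> ball x0 \<delta> = {x \<in> ball x0 \<delta>. \<gamma> (x - (x \<bullet> b) *\<^sub>R b) < x \<bullet> b})"

definition smooth_bounded_domain :: "'a::euclidean_space set \<Rightarrow> bool" where
  "smooth_bounded_domain \<Omega> \<longleftrightarrow>
     open \<Omega> \<and> connected \<Omega> \<and> \<Omega> \<noteq> {} \<and> bounded \<Omega> \<and> smooth_boundary \<Omega>"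


section \<open>Lebesgue norms\<close>

text \<open>The real-valued norm is the intended one only on functions in \<open>L\<^sup>s(\<Omega>)\<close>; elsewhere the
  totalised integral and \<^const>\<open>real_of_ereal\<close> may return 0.\<close>
definition Lnorm :: "'a::euclidean_space set \<Rightarrow> ereal \<Rightarrow> ('a \<Rightarrow> 'b::euclidean_space) \<Rightarrow> real" where
  "Lnorm \<Omega> s f =
     (if s = \<infinity> then real_of_ereal (esssup (lebesgue_on \<Omega>) (\<lambda>x. ereal (norm (f x))))
      else (\<integral>x. norm (f x) powr real_of_ereal s \<partial>lebesgue_on \<Omega>) powr (1 / real_of_ereal s))"

definition Lspace :: "'a::euclidean_space set \<Rightarrow> real \<Rightarrow> ('a \<Rightarrow> 'b::euclidean_space) set" where
  "Lspace \<Omega> m = {f. f \<in> borel_measurable (lebesgue_on \<Omega>) \<and>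
                     integrable (lebesgue_on \<Omega>) (\<lambda>x. norm (f x) powr m)}"


section \<open>Sobolev spaces\<close>

text \<open>Elements are functions on the whole space, of which only the almost-everywhere class on
  \<open>\<Omega>\<close> matters.\<close>

definition test_functions :: "'a::euclidean_space set \<Rightarrow> ('a \<Rightarrow> real) set" where
  "test_functions \<Omega> =
     {\<phi>. smooth_on UNIV \<phi> \<and> compact (closure {x. \<phi> x \<noteq> 0}) \<and> closure {x. \<phi> x \<noteq> 0} \<subseteq> \<Omega>}"

definition classical_gradient :: "('a::euclidean_space \<Rightarrow> real) \<Rightarrow> 'a \<Rightarrow> 'a" where
  "classical_gradient \<phi> x = (\<Sum>b\<in>Basis. frechet_derivative \<phi> (at x) b *\<^sub>R b)"

definition locally_integrable ::
  "'a::euclidean_space set \<Rightarrow> ('a \<Rightarrow> 'b::euclidean_space) \<Rightarrow> bool" where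
  "locally_integrable \<Omega> f \<longleftrightarrow>
     (\<forall>K. compact K \<and> K \<subseteq> \<Omega> \<longrightarrow> integrable (lebesgue_on K) f)"

definition is_weak_gradient ::
  "'a::euclidean_space set \<Rightarrow> ('a \<Rightarrow> real) \<Rightarrow> ('a \<Rightarrow> 'a) \<Rightarrow> bool" where
  "is_weak_gradient \<Omega> u g \<longleftrightarrow>
     locally_integrable \<Omega> u \<and> locally_integrable \<Omega> g \<and>
     (\<forall>\<phi>\<in>test_functions \<Omega>.
        (\<integral>x. u x *\<^sub>R classical_gradient \<phi> x \<partial>lebesgue_on \<Omega>) =
        - (\<integral>x. \<phi> x *\<^sub>R g x \<partial>lebesgue_on \<Omega>))"

text \<open>Unique up to null sets whenever a weak gradient exists.\<close>
definition weak_gradient :: "'a::euclidean_space set \<Rightarrow> ('a \<Rightarrow> real) \<Rightarrow> 'a \<Rightarrow> 'a" where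
  "weak_gradient \<Omega> u = (SOME g. is_weak_gradient \<Omega> u g)"

definition W1 :: "'a::euclidean_space set \<Rightarrow> real \<Rightarrow> ('a \<Rightarrow> real) set" where
  "W1 \<Omega> m = {u \<in> Lspace \<Omega> m. \<exists>g \<in> Lspace \<Omega> m. is_weak_gradient \<Omega> u g}"

definition W1_norm :: "'a::euclidean_space set \<Rightarrow> real \<Rightarrow> ('a \<Rightarrow> real) \<Rightarrow> real" where
  "W1_norm \<Omega> m u =
     (Lnorm \<Omega> (ereal m) u powr m + Lnorm \<Omega> (ereal m) (weak_gradient \<Omega> u) powr m) powr (1 / m)"

definition W10 :: "'a::euclidean_space set \<Rightarrow> real \<Rightarrow> ('a \<Rightarrow> real) set" where
  "W10 \<Omega> m = {u \<in> W1 \<Omega> m. \<exists>\<phi>. (\<forall>k. \<phi> k \<in> test_functions \<Omega>) \<and>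
                 (\<lambda>k. W1_norm \<Omega> m (\<lambda>x. \<phi> k x - u x)) \<longlonglongrightarrow> 0}"

definition nonzero_on :: "'a::euclidean_space set \<Rightarrow> ('a \<Rightarrow> real) \<Rightarrow> bool" where
  "nonzero_on \<Omega> u \<longleftrightarrow> \<not> (AE x in lebesgue_on \<Omega>. u x = 0)"

definition nonneg_on :: "'a::euclidean_space set \<Rightarrow> ('a \<Rightarrow> real) \<Rightarrow> bool" where
  "nonneg_on \<Omega> u \<longleftrightarrow> (AE x in lebesgue_on \<Omega>. 0 \<le> u x)"


section \<open>Energies and least energy solutions\<close>

text \<open>\<open>\<lambda>\<^sub>s(m)\<close> for \<open>1 \<le> s \<le> \<infinity>\<close>.  For \<open>m\<close> above the space dimension the infimum is attained.\<close>
definition sobolev_eigenvalue :: "'a::euclidean_space set \<Rightarrow> ereal \<Rightarrow> real \<Rightarrow> real" where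
  "sobolev_eigenvalue \<Omega> s m =
     Inf {Lnorm \<Omega> (ereal m) (weak_gradient \<Omega> v) powr m / Lnorm \<Omega> s v powr m | v.
            v \<in> W10 \<Omega> m \<and> nonzero_on \<Omega> v}"

definition X_space :: "'a::euclidean_space set \<Rightarrow> real \<Rightarrow> real \<Rightarrow> ('a \<Rightarrow> real) set" where
  "X_space \<Omega> p q = W10 \<Omega> (max p q)"

text \<open>\<open>I\<^bsub>\<lambda>,s\<^esub>\<close> for finite \<open>s\<close> and \<open>J\<^sub>\<lambda>\<close> for \<open>s = \<infinity>\<close>.\<close>
definition energy ::
  "'a::euclidean_space set \<Rightarrow> real \<Rightarrow> real \<Rightarrow> real \<Rightarrow> ereal \<Rightarrow> ('a \<Rightarrow> real) \<Rightarrow> real" where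
  "energy \<Omega> p q lam s u =
     1 / p * Lnorm \<Omega> (ereal p) (weak_gradient \<Omega> u) powr p
     + 1 / q * Lnorm \<Omega> (ereal q) (weak_gradient \<Omega> u) powr q
     - lam / p * Lnorm \<Omega> s u powr p"

definition nehari ::
  "'a::euclidean_space set \<Rightarrow> real \<Rightarrow> real \<Rightarrow> real \<Rightarrow> ereal \<Rightarrow> ('a \<Rightarrow> real) set" where
  "nehari \<Omega> p q lam s =
     {u \<in> X_space \<Omega> p q. nonzero_on \<Omega> u \<and>
        Lnorm \<Omega> (ereal p) (weak_gradient \<Omega> u) powr p
        + Lnorm \<Omega> (ereal q) (weak_gradient \<Omega> u) powr q
        = lam * Lnorm \<Omega> s u powr p}"

text \<open>Least energy solutions of
  \<open>-(\<Delta>\<^sub>p + \<Delta>\<^sub>q) u = \<lambda> \<parallel>u\<parallel>\<^sub>r\<^bsup>p-r\<^esup> \<bar>u\<bar>\<^bsup>r-2\<^esup> u\<close> with zero boundary values.\<close>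
definition least_energy_solution ::
  "'a::euclidean_space set \<Rightarrow> real \<Rightarrow> real \<Rightarrow> real \<Rightarrow> real \<Rightarrow> ('a \<Rightarrow> real) \<Rightarrow> bool" where
  "least_energy_solution \<Omega> p q lam r u \<longleftrightarrow>
     (if p < q
      then is_arg_min (energy \<Omega> p q lam (ereal r)) (\<lambda>v. v \<in> X_space \<Omega> p q \<and> nonzero_on \<Omega> v) u
      else is_arg_min (energy \<Omega> p q lam (ereal r)) (\<lambda>v. v \<in> nehari \<Omega> p q lam (ereal r)) u)"

text \<open>Least energy solutions of
  \<open>-(\<Delta>\<^sub>p + \<Delta>\<^sub>q) u = \<lambda> \<bar>u(x\<^sub>u)\<bar>\<^bsup>p-2\<^esup> u(x\<^sub>u) \<delta>\<close> with zero boundary values, where \<open>\<delta>\<close> is the Dirac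
  delta at a maximum point \<open>x\<^sub>u\<close> of \<open>\<bar>u\<bar>\<close>.  For \<open>p < q\<close> the zero function is a competitor here.\<close>
definition least_energy_solution_infinity ::
  "'a::euclidean_space set \<Rightarrow> real \<Rightarrow> real \<Rightarrow> real \<Rightarrow> ('a \<Rightarrow> real) \<Rightarrow> bool" where
  "least_energy_solution_infinity \<Omega> p q lam u \<longleftrightarrow>
     (if p < q
      then is_arg_min (energy \<Omega> p q lam \<infinity>) (\<lambda>v. v \<in> X_space \<Omega> p q) u
      else is_arg_min (energy \<Omega> p q lam \<infinity>) (\<lambda>v. v \<in> nehari \<Omega> p q lam \<infinity>) u)"

end

theory Submission
  imports Defs "HOL-Complex_Analysis.Great_Picard"
begin

text \<open>In both cases the \<open>u\<^sub>n\<close> minimize functionals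
  \<open>a \<parallel>\<nabla>w\<parallel>\<^sub>m\<^bsup>m\<^esup> + \<kappa>\<^sub>n \<parallel>\<nabla>w\<parallel>\<^sub>s\<^bsup>p\<^esup> - b \<parallel>w\<parallel>\<^bsub>r\<^sub>n\<^esub>\<^bsup>p\<^esup>\<close> with \<open>m = max p q\<close> and \<open>s = min p q\<close>: for
  \<open>p < q\<close> these are the energies, and for \<open>q < p\<close> minimality on the Nehari set is equivalent, by
  scaling, to such a homogeneous problem with \<open>\<kappa>\<^sub>n = \<parallel>\<nabla>u\<^sub>n\<parallel>\<^sub>q\<^bsup>q-p\<^esup>\<close> and minimum \<open>0\<close>.
  By Morrey's inequality and the Arzela-Ascoli theorem a subsequence of a bounded sequence of
  minimizers converges uniformly.  Comparing two of its members with their midpoint, Clarkson's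
  inequality shows that the gradients form a Cauchy sequence in \<open>L\<^sup>m\<close>, so that no weak
  compactness is needed, and minimality passes to the limit.\<close>

section \<open>Smooth functions\<close>

text \<open>The obstacle for \<open>q < p\<close> is that the Nehari set is not convex, so two
  minimizers cannot be compared with their midpoint inside it. In the homogeneous form every nonzero
  function is a competitor, at the price of a coefficient that varies with \<open>n\<close>. It is
  bounded above because the L^r norms are controlled by the L^q norm of the gradient, and bounded
  away from 0 because \<lambda> > \<lambda>_\<infinity>(p) supplies one fixed competitor. The lower
  bound keeps the gradients bounded, the upper bound keeps the limit from vanishing. Uniform
  convergence makes the midpoint argument work across different exponents: the L^r norms of two
  members and of their midpoint, for either exponent, all approach the sup norm of the same limit.
  As 0 is not an admissible competitor, nonnegativity is what keeps the midpoint nonzero. A gradient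
  is picked by \<open>SOME\<close>, so uniqueness up to null sets must be available before any
  gradient norm can be computed. This rests on the fundamental lemma of the calculus of variations
  and hence on explicit smooth bumps.\<close>

lemma Ck_on_SucD: "Ck_on (Suc k) S f \<Longrightarrow> Ck_on k S f"
proof (induction k arbitrary: f)
  case 0
  then show ?case
    by (metis Ck_on.simps(1,2) differentiable_at_imp_differentiable_on differentiable_imp_continuous_on)
next
  case (Suc k)
  then show ?case by (metis Ck_on.simps(2))
qed

lemma Ck_on_has_derivative:
  "Ck_on (Suc k) UNIV f \<Longrightarrow> (f has_derivative frechet_derivative f (at x)) (at x)"
  by (simp add: frechet_derivative_works)

lemma Ck_on_SucI:
  assumes "\<And>x. (f has_derivative f' x) (at x)" "\<And>v. Ck_on k UNIV (\<lambda>x. f' x v)"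
  shows "Ck_on (Suc k) UNIV f"
proof -
  have "frechet_derivative f (at x) = f' x" for x
    using assms(1) frechet_derivative_at by metis
  then show ?thesis
    using assms by (auto simp: differentiable_def)
qed

lemma Ck_on_const: "Ck_on k UNIV (\<lambda>x. c)"
proof (induction k arbitrary: c)
  case (Suc k)
  show ?case
    by (rule Ck_on_SucI[where f' = "\<lambda>x v. 0"]) (auto simp: Suc)
qed simp

lemma Ck_on_add:
  assumes "Ck_on k UNIV f" "Ck_on k UNIV g"
  shows "Ck_on k UNIV (\<lambda>x. f x + g x)"
  using assms
proof (induction k arbitrary: f g)
  case (Suc k)
  show ?case
    by (rule Ck_on_SucI[OF has_derivative_add[OF Ck_on_has_derivative[OF Suc.prems(1)]
            Ck_on_has_derivative[OF Suc.prems(2)]]])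
      (use Suc in auto)
qed (auto intro: continuous_intros)

lemma Ck_on_mult:
  fixes f g :: "'a::euclidean_space \<Rightarrow> real"
  assumes "Ck_on k UNIV f" "Ck_on k UNIV g"
  shows "Ck_on k UNIV (\<lambda>x. f x * g x)"
  using assms
proof (induction k arbitrary: f g)
  case (Suc k)
  note sub = Suc.prems[THEN Ck_on_SucD]
  show ?case
    by (rule Ck_on_SucI[OF has_derivative_mult[OF Ck_on_has_derivative[OF Suc.prems(1)]
            Ck_on_has_derivative[OF Suc.prems(2)]]])
      (use Suc sub in \<open>auto intro!: Ck_on_add\<close>)
qed (auto intro: continuous_intros)

lemma smooth_on_prod:
  fixes f :: "'i \<Rightarrow> 'a::euclidean_space \<Rightarrow> real"
  assumes "finite I" "\<And>i. i \<in> I \<Longrightarrow> smooth_on UNIV (f i)"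
  shows "smooth_on UNIV (\<lambda>x. \<Prod>i\<in>I. f i x)"
  using assms by (induction I) (auto simp: smooth_on_def Ck_on_const intro!: Ck_on_mult)

text \<open>The derivative of \<open>P(1/t) exp(-1/t)\<close> has the same form, with \<open>P\<close> replaced by
  \<open>X\<^sup>2 (P - P')\<close>; this makes \<open>exp(-1/t)\<close> smooth across \<open>0\<close>.\<close>

definition flat_exp :: "real poly \<Rightarrow> real \<Rightarrow> real" where
  "flat_exp P t = (if 0 < t then poly P (inverse t) * exp (- inverse t) else 0)"

text \<open>With s = 1/t this says that exp(-1/t) beats every power of 1/t as t decreases to
  0.\<close>

lemma poly_exp_tendsto_0: "((\<lambda>s. poly P s * exp (- s)) \<longlongrightarrow> (0::real)) at_top"
proof -
  have "((\<lambda>s. \<Sum>i\<le>degree P. coeff P i * (s ^ i / exp s)) \<longlongrightarrow> (\<Sum>i\<le>degree P. coeff P i * 0)) at_top"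
    by (intro tendsto_intros tendsto_power_div_exp_0)
  moreover have "(\<Sum>i\<le>degree P. coeff P i * (s ^ i / exp s)) = poly P s * exp (- s)" for s
    by (simp add: poly_altdef sum_distrib_right exp_minus divide_inverse mult.assoc)
  ultimately show ?thesis by simp
qed

lemma flat_exp_has_derivative:
  "(flat_exp P has_real_derivative flat_exp ([:0, 0, 1:] * (P - pderiv P)) t) (at t)"
proof -
  consider "t > 0" | "t < 0" | "t = 0" by linarith
  then show ?thesis
  proof cases
    case 1
    have "((\<lambda>t. poly P (inverse t) * exp (- inverse t)) has_real_derivative
        flat_exp ([:0, 0, 1:] * (P - pderiv P)) t) (at t)"
      using 1 by (auto intro!: derivative_eq_intros simp: flat_exp_def field_simps power2_eq_square)
    then show ?thesis
      by (rule has_field_derivative_transform_within_open[where S = "{0<..}"])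
        (use 1 in \<open>auto simp: flat_exp_def\<close>)
  next
    case 2
    have "((\<lambda>t. 0) has_real_derivative 0) (at t)" by simp
    then have "(flat_exp P has_real_derivative 0) (at t)"
      by (rule has_field_derivative_transform_within_open[where S = "{..<0}"])
        (use 2 in \<open>auto simp: flat_exp_def\<close>)
    then show ?thesis using 2 by (simp add: flat_exp_def)
  next
    case 3
    have r: "((\<lambda>h. flat_exp P h / h) \<longlongrightarrow> 0) (at_right 0)"
    proof -
      \<comment> \<open>Dividing by h = 1/s multiplies by s, whence the extra factor
        \<open>[:0,1:]\<close>.\<close>
      have "((\<lambda>s. poly ([:0,1:] * P) s * exp (- s)) \<longlongrightarrow> 0) at_top"
        by (rule poly_exp_tendsto_0)
      moreover have "eventually (\<lambda>s. poly ([:0,1:] * P) s * exp (- s) =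
          flat_exp P (inverse s) / inverse s) at_top"
        using eventually_gt_at_top[of 0]
        by eventually_elim (auto simp: flat_exp_def field_simps)
      ultimately have "((\<lambda>s. flat_exp P (inverse s) / inverse s) \<longlongrightarrow> 0) at_top"
        by (rule Lim_transform_eventually)
      then show ?thesis by (simp only: filterlim_at_right_to_top)
    qed
    have l: "((\<lambda>h. flat_exp P h / h) \<longlongrightarrow> 0) (at_left 0)"
      by (rule tendsto_eventually) (auto simp: flat_exp_def eventually_at_filter)
    have "((\<lambda>h. flat_exp P h / h) \<longlongrightarrow> 0) (at 0)"
      using l r by (simp add: filterlim_split_at)
    then show ?thesis
      using 3 by (simp add: has_field_derivative_iff) (simp add: flat_exp_def)
  qed
qed

text \<open>The induction must range over all \<open>P\<close>, since differentiating replaces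
  \<open>P\<close>. An affine argument keeps the shape, because its derivative contributes only the
  constant factor \<open>v \<bullet> b\<close>.\<close>

lemma smooth_flat_exp_affine:
  "smooth_on UNIV (\<lambda>x::'a::euclidean_space. flat_exp P (c + x \<bullet> b))"
proof -
  have "Ck_on k UNIV (\<lambda>x::'a. flat_exp P (c + x \<bullet> b))" for k
  proof (induction k arbitrary: P)
    case 0
    have "continuous_on UNIV (flat_exp P)"
      by (meson DERIV_continuous_on flat_exp_has_derivative has_field_derivative_at_within)
    then show ?case
      by (auto intro!: continuous_on_compose2[of UNIV "flat_exp P"] continuous_intros)
  next
    case (Suc k)
    have d: "((\<lambda>x::'a. flat_exp P (c + x \<bullet> b)) has_derivative
       (\<lambda>v. flat_exp ([:0, 0, 1:] * (P - pderiv P)) (c + x \<bullet> b) * (v \<bullet> b))) (at x)" for x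
      by (rule has_derivative_eq_rhs[OF DERIV_compose_FDERIV[OF flat_exp_has_derivative]])
        (auto intro!: derivative_eq_intros simp: fun_eq_iff)
    show ?case
      by (rule Ck_on_SucI[OF d]) (intro Ck_on_mult Ck_on_const Suc)
  qed
  then show ?thesis by (simp add: smooth_on_def)
qed

text \<open>The parameter \<open>k\<close> sharpens the bump without moving its support: exp(-1/(k
  t)) tends to 1 for t > 0, so the bumps tend to the indicator of the open box. The arguments are
  spelled to match \<open>smooth_flat_exp_affine\<close>.\<close>

definition box_bump :: "'a::euclidean_space \<Rightarrow> 'a \<Rightarrow> real \<Rightarrow> 'a \<Rightarrow> real" where
  "box_bump a b k x =
     (\<Prod>i\<in>Basis. flat_exp 1 (- k * (a \<bullet> i) + x \<bullet> (k *\<^sub>R i)) * flat_exp 1 (k * (b \<bullet> i) + x \<bullet> (- k *\<^sub>R i)))"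

lemma box_bump_eq_0_iff: "k > 0 \<Longrightarrow> box_bump a b k x = 0 \<longleftrightarrow> x \<notin> box a b"
proof -
  assume k: "k > 0"
  have "0 < - k * (a \<bullet> i) + x \<bullet> (k *\<^sub>R i) \<longleftrightarrow> a \<bullet> i < x \<bullet> i"
    "0 < k * (b \<bullet> i) + x \<bullet> (- k *\<^sub>R i) \<longleftrightarrow> x \<bullet> i < b \<bullet> i" for i
    using k by auto
  then show ?thesis
    unfolding box_bump_def by (auto simp: flat_exp_def mem_box)
qed

lemma box_bump_range: "0 \<le> box_bump a b k x" "box_bump a b k x \<le> 1"
proof -
  have f: "0 \<le> flat_exp 1 t" "flat_exp 1 t \<le> 1" for t by (auto simp: flat_exp_def)
  show "0 \<le> box_bump a b k x" "box_bump a b k x \<le> 1"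
    unfolding box_bump_def by (auto intro!: prod_nonneg prod_le_1 mult_nonneg_nonneg mult_le_one f)
qed

lemma smooth_box_bump: "smooth_on UNIV (box_bump a b k)"
proof -
  have "smooth_on UNIV (\<lambda>x. \<Prod>i\<in>Basis. flat_exp 1 (- k * (a \<bullet> i) + x \<bullet> (k *\<^sub>R i))
      * flat_exp 1 (k * (b \<bullet> i) + x \<bullet> (- k *\<^sub>R i)))"
    by (intro smooth_on_prod finite_Basis)
      (use smooth_flat_exp_affine in \<open>auto simp only: smooth_on_def intro!: Ck_on_mult\<close>)
  then show ?thesis by (simp only: box_bump_def[abs_def])
qed

lemma box_bump_test_function:
  assumes "k > 0" "cbox a b \<subseteq> \<Omega>"
  shows "box_bump a b k \<in> test_functions \<Omega>"
proof -
  have "closure {x. box_bump a b k x \<noteq> 0} \<subseteq> cbox a b"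
    using assms box_subset_cbox[of a b] by (intro closure_minimal) (auto simp: box_bump_eq_0_iff)
  moreover from this have "compact (closure {x. box_bump a b k x \<noteq> 0})"
    by (meson bounded_cbox bounded_subset closed_closure compact_eq_bounded_closed)
  ultimately show ?thesis using assms smooth_box_bump by (auto simp: test_functions_def)
qed

lemma box_bump_tendsto_indicator:
  "(\<lambda>k. box_bump a b (real (Suc k)) x) \<longlonglongrightarrow> indicator (box a b) x"
proof (cases "x \<in> box a b")
  case True
  have lim: "(\<lambda>k. flat_exp 1 (real (Suc k) * t)) \<longlonglongrightarrow> 1" if "t > 0" for t :: real
  proof -
    have "(\<lambda>k. exp (- inverse (real (Suc k)) * inverse t)) \<longlonglongrightarrow> exp (- 0 * inverse t)"
      by (intro tendsto_intros LIMSEQ_inverse_real_of_nat)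
    then show ?thesis using that by (simp add: flat_exp_def)
  qed
  have "(\<lambda>k. \<Prod>i\<in>Basis. flat_exp 1 (real (Suc k) * (x \<bullet> i - a \<bullet> i)) * flat_exp 1 (real (Suc k) * (b \<bullet> i - x \<bullet> i)))
     \<longlonglongrightarrow> (\<Prod>i\<in>(Basis::'a set). 1 * 1)"
    by (intro tendsto_prod tendsto_mult lim) (use True in \<open>auto simp: mem_box\<close>)
  then show ?thesis
    using True by (simp add: box_bump_def algebra_simps)
next
  case False
  then have "box_bump a b (real (Suc k)) x = 0" for k
    by (simp only: box_bump_eq_0_iff) simp
  then show ?thesis using False by simp
qed

section \<open>Weak gradients\<close>

lemma compact_lebesgue: "compact K \<Longrightarrow> K \<in> sets lebesgue"
  by (simp add: fmeasurableD lmeasurable_compact)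

lemma lebesgue_on_support:
  fixes f :: "'a::euclidean_space \<Rightarrow> 'b::euclidean_space"
  assumes "K \<subseteq> S" "K \<in> sets lebesgue" "S \<in> sets lebesgue" "\<And>x. x \<in> S \<Longrightarrow> x \<notin> K \<Longrightarrow> f x = 0"
  shows "integrable (lebesgue_on S) f \<longleftrightarrow> integrable (lebesgue_on K) f"
    "integral\<^sup>L (lebesgue_on S) f = integral\<^sup>L (lebesgue_on K) f"
proof -
  have "(\<lambda>x. indicator S x *\<^sub>R f x) = (\<lambda>x. indicator K x *\<^sub>R f x)"
    using assms(1,4) by (auto simp: fun_eq_iff indicator_def)
  then show "integrable (lebesgue_on S) f \<longleftrightarrow> integrable (lebesgue_on K) f"
    "integral\<^sup>L (lebesgue_on S) f = integral\<^sup>L (lebesgue_on K) f"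
    using assms(2,3) by (simp_all add: integrable_restrict_space integral_restrict_space)
qed

lemma integrable_lebesgue_on_subset:
  fixes f :: "'a::euclidean_space \<Rightarrow> 'b::euclidean_space"
  assumes "integrable (lebesgue_on S) f" "K \<subseteq> S" "K \<in> sets lebesgue" "S \<in> sets lebesgue"
  shows "integrable (lebesgue_on K) f"
proof -
  have "set_integrable lebesgue S f"
    using assms by (simp add: set_integrable_def integrable_restrict_space)
  then have "set_integrable lebesgue K f"
    by (rule set_integrable_subset) (use assms in auto)
  then show ?thesis
    using assms by (simp add: set_integrable_def integrable_restrict_space)
qed

lemma integrable_lebesgue_on_compact:
  fixes f :: "'a::euclidean_space \<Rightarrow> 'b::euclidean_space"
  assumes "compact K" "continuous_on UNIV f"
  shows "integrable (lebesgue_on K) f"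
proof -
  obtain c where "K \<subseteq> cbox (-c) c"
    using bounded_subset_cbox_symmetric[OF compact_imp_bounded[OF assms(1)]] .
  moreover have "integrable (lebesgue_on (cbox (-c) c)) f"
    using assms(2) by (intro continuous_imp_integrable) (auto intro: continuous_on_subset)
  ultimately show ?thesis
    by (intro integrable_lebesgue_on_subset[of "cbox (-c) c" f K])
      (simp_all add: compact_lebesgue[OF assms(1)])
qed

lemma test_function_derivative:
  assumes "\<phi> \<in> test_functions \<Omega>"
  shows "(\<phi> has_derivative (\<lambda>v. classical_gradient \<phi> x \<bullet> v)) (at x)"
    and "continuous_on UNIV (classical_gradient \<phi>)"
    and "continuous_on UNIV \<phi>"
proof -
  have 1: "Ck_on (Suc 0) UNIV \<phi>" using assms by (auto simp: test_functions_def smooth_on_def)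
  have d: "(\<phi> has_derivative frechet_derivative \<phi> (at x)) (at x)" for x
    by (rule Ck_on_has_derivative[OF 1])
  have "frechet_derivative \<phi> (at x) v = classical_gradient \<phi> x \<bullet> v" for x v
  proof -
    interpret linear "frechet_derivative \<phi> (at x)" using d has_derivative_linear by blast
    have "frechet_derivative \<phi> (at x) v = frechet_derivative \<phi> (at x) (\<Sum>b\<in>Basis. (v \<bullet> b) *\<^sub>R b)"
      by (simp add: euclidean_representation)
    also have "\<dots> = (\<Sum>b\<in>Basis. (v \<bullet> b) * frechet_derivative \<phi> (at x) b)"
      by (simp add: sum scale)
    also have "\<dots> = classical_gradient \<phi> x \<bullet> v"
      unfolding classical_gradient_def inner_sum_left
      by (intro sum.cong) (auto simp: inner_commute)
    finally show ?thesis .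
  qed
  then have "frechet_derivative \<phi> (at x) = (\<lambda>v. classical_gradient \<phi> x \<bullet> v)" for x by auto
  then show "(\<phi> has_derivative (\<lambda>v. classical_gradient \<phi> x \<bullet> v)) (at x)" using d by metis
  show "continuous_on UNIV \<phi>" using Ck_on_SucD[OF 1] by simp
  show "continuous_on UNIV (classical_gradient \<phi>)"
    unfolding classical_gradient_def[abs_def]
    using 1 by (intro continuous_intros) auto
qed

lemma classical_gradient_unique:
  assumes "(\<phi> has_derivative (\<lambda>v. g \<bullet> v)) (at x)"
  shows "classical_gradient \<phi> x = g"
proof -
  have "frechet_derivative \<phi> (at x) = (\<lambda>v. g \<bullet> v)" using assms frechet_derivative_at by metis
  then show ?thesis by (simp add: classical_gradient_def euclidean_representation)
qed

lemma classical_gradient_outside_support: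
  assumes "x \<notin> closure {x. \<phi> x \<noteq> 0}"
  shows "classical_gradient \<phi> x = 0"
proof (rule classical_gradient_unique)
  have "((\<lambda>_. 0::real) has_derivative (\<lambda>v. 0 \<bullet> v)) (at x)" by simp
  then show "(\<phi> has_derivative (\<lambda>v. 0 \<bullet> v)) (at x)"
    by (rule has_derivative_transform_within_open[where s = "- closure {x. \<phi> x \<noteq> 0}"])
      (use assms closure_subset[of "{x. \<phi> x \<noteq> 0}"] in auto)
qed

text \<open>Differentiate the translation-invariant integral \<open>\<integral> F(x + t e) dx\<close> at \<open>t = 0\<close>.\<close>
lemma integral_partial_derivative_eq_0:
  fixes F :: "'a::euclidean_space \<Rightarrow> real"
  assumes d: "\<And>x. (F has_derivative (\<lambda>v. G x \<bullet> v)) (at x)" and G: "continuous_on UNIV G"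
    and supp: "\<And>x. F x \<noteq> 0 \<Longrightarrow> x \<in> cbox a b"
    and e: "e \<in> Basis" and c: "\<And>x t. \<bar>t\<bar> < 1 \<Longrightarrow> x \<in> cbox a b \<Longrightarrow> x - t *\<^sub>R e \<in> cbox c d"
  shows "integral (cbox c d) (\<lambda>x. G x \<bullet> e) = 0"
proof -
  have cF: "continuous_on S F" for S
    using d by (meson continuous_at_imp_continuous_on has_derivative_continuous)
  \<comment> \<open>For |t| < 1 the translated support stays inside \<open>cbox c d\<close>, so
    translation does not change the integral.\<close>
  have const: "integral (cbox c d) (\<lambda>x. F (x + t *\<^sub>R e)) = integral (cbox a b) F"
    if "\<bar>t\<bar> < 1" for t
  proof -
    have "integral (cbox c d) (\<lambda>x. F (x + t *\<^sub>R e)) = integral (cbox (c + t *\<^sub>R e) (d + t *\<^sub>R e)) F"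
      using integral_shift_cbox[of "c + t *\<^sub>R e" "t *\<^sub>R e" "d + t *\<^sub>R e" F] by simp
    also have "\<dots> = integral (cbox a b) F"
    proof (rule integral_unique[OF has_integral_on_superset])
      show "(F has_integral integral (cbox a b) F) (cbox a b)"
        using cF by (intro integrable_integral integrable_continuous)
      show "cbox a b \<subseteq> cbox (c + t *\<^sub>R e) (d + t *\<^sub>R e)"
      proof
        fix x assume "x \<in> cbox a b"
        then have "x - t *\<^sub>R e \<in> cbox c d" using c that by blast
        then show "x \<in> cbox (c + t *\<^sub>R e) (d + t *\<^sub>R e)"
          by (auto simp: mem_box inner_simps algebra_simps)
      qed
    qed (use supp in auto)
    finally show ?thesis .
  qed
  have "((\<lambda>t. integral (cbox c d) (\<lambda>x. F (x + t *\<^sub>R e))) has_field_derivative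
      integral (cbox c d) (\<lambda>x. G (x + 0 *\<^sub>R e) \<bullet> e)) (at 0 within {-1<..<1})"
  proof (rule leibniz_rule_field_derivative)
    fix t x
    have "((\<lambda>t. F (x + t *\<^sub>R e)) has_derivative (\<lambda>s. G (x + t *\<^sub>R e) \<bullet> (s *\<^sub>R e))) (at t within {-1<..<1})"
      by (rule has_derivative_compose[OF _ d, of "\<lambda>t. x + t *\<^sub>R e" "\<lambda>s. s *\<^sub>R e"])
        (auto intro!: derivative_eq_intros)
    then show "((\<lambda>t. F (x + t *\<^sub>R e)) has_real_derivative G (x + t *\<^sub>R e) \<bullet> e) (at t within {-1<..<1})"
      by (simp add: has_field_derivative_def mult_commute_abs)
    show "(\<lambda>x. F (x + t *\<^sub>R e)) integrable_on cbox c d"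
      by (intro integrable_continuous continuous_on_compose2[OF cF[of UNIV]] continuous_intros) auto
  next
    show "continuous_on ({-1<..<1} \<times> cbox c d) (\<lambda>(t, x). G (x + t *\<^sub>R e) \<bullet> e)"
      unfolding case_prod_beta
      by (intro continuous_intros continuous_on_compose2[OF G]) auto
  qed auto
  then have "((\<lambda>t. integral (cbox c d) (\<lambda>x. F (x + t *\<^sub>R e))) has_field_derivative
      integral (cbox c d) (\<lambda>x. G x \<bullet> e)) (at 0)"
    by (simp add: at_within_open[of 0 "{-1<..<1}"])
  moreover have "((\<lambda>t. integral (cbox c d) (\<lambda>x. F (x + t *\<^sub>R e))) has_field_derivative 0) (at 0)"
  proof -
    have "((\<lambda>t. integral (cbox a b) F) has_field_derivative 0) (at (0::real))" by simp
    then show ?thesis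
      by (rule has_field_derivative_transform_within_open[where S = "{-1<..<1}"])
        (use const in auto)
  qed
  ultimately show ?thesis by (rule DERIV_unique)
qed

lemma integral_gradient_eq_0:
  fixes F :: "'a::euclidean_space \<Rightarrow> real"
  assumes d: "\<And>x. (F has_derivative (\<lambda>v. G x \<bullet> v)) (at x)" and G: "continuous_on UNIV G"
    and K: "compact K" "\<And>x. x \<notin> K \<Longrightarrow> F x = 0" "\<And>x. x \<notin> K \<Longrightarrow> G x = 0"
  shows "integral\<^sup>L (lebesgue_on K) G = 0"
proof (rule euclidean_eqI)
  fix e :: 'a assume e: "e \<in> Basis"
  obtain b where b: "K \<subseteq> cbox (-b) b"
    using bounded_subset_cbox_symmetric[OF compact_imp_bounded[OF K(1)]] .
  \<comment> \<open>A margin of 1 in every coordinate leaves room for the translations with |t| <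
    1.\<close>
  define c where "c = b + One"
  have sub: "x - t *\<^sub>R e \<in> cbox (-c) c" if "\<bar>t\<bar> < 1" "x \<in> cbox (-b) b" for x t
    using that e by (auto simp: c_def mem_box inner_simps inner_Basis)
  have Kc: "K \<subseteq> cbox (-c) c" using sub[of 0] b by auto
  have "integral\<^sup>L (lebesgue_on K) G \<bullet> e = integral\<^sup>L (lebesgue_on K) (\<lambda>x. G x \<bullet> e)"
    using integrable_lebesgue_on_compact[OF K(1) G] by (simp add: integral_inner_left)
  also have "\<dots> = integral\<^sup>L (lebesgue_on (cbox (-c) c)) (\<lambda>x. G x \<bullet> e)"
    using Kc K compact_lebesgue by (intro lebesgue_on_support(2)[symmetric]) auto
  also have "\<dots> = integral (cbox (-c) c) (\<lambda>x. G x \<bullet> e)"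
    using G by (intro lebesgue_integral_eq_integral integrable_lebesgue_on_compact
        continuous_intros) auto
  also have "\<dots> = 0"
    by (rule integral_partial_derivative_eq_0[OF d G _ e, of "-b" b]) (use b K(2) sub in auto)
  finally show "integral\<^sup>L (lebesgue_on K) G \<bullet> e = 0 \<bullet> e" by simp
qed

text \<open>A continuous factor with compact support is bounded and sees \<open>f\<close> only on
  \<open>K\<close>. Hence local integrability suffices for the integrals in the definition of a weak
  gradient.\<close>

lemma locally_integrable_mult_test:
  fixes f :: "'a::euclidean_space \<Rightarrow> 'b::euclidean_space" and \<psi> :: "'a \<Rightarrow> real"
  assumes "locally_integrable \<Omega> f" "\<Omega> \<in> sets lebesgue" "compact K" "K \<subseteq> \<Omega>"
    "continuous_on UNIV \<psi>" "\<And>x. x \<notin> K \<Longrightarrow> \<psi> x = 0"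
  shows "integrable (lebesgue_on \<Omega>) (\<lambda>x. \<psi> x *\<^sub>R f x)"
proof -
  have "compact (\<psi> ` K)"
    using assms by (intro compact_continuous_image) (auto intro: continuous_on_subset)
  then obtain B where B: "\<And>x. x \<in> K \<Longrightarrow> norm (\<psi> x) \<le> B"
    by (meson bounded_iff compact_imp_bounded image_eqI)
  have f: "integrable (lebesgue_on K) f"
    using assms by (auto simp: locally_integrable_def)
  have "integrable (lebesgue_on K) (\<lambda>x. \<psi> x *\<^sub>R f x)"
  proof (rule Bochner_Integration.integrable_bound)
    show "integrable (lebesgue_on K) (\<lambda>x. B * norm (f x))" using f by auto
    show "(\<lambda>x. \<psi> x *\<^sub>R f x) \<in> borel_measurable (lebesgue_on K)"
      using assms(3,5) compact_lebesgue continuous_on_subset[of UNIV \<psi> K]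
      by (intro borel_measurable_scaleR continuous_imp_measurable_on_sets_lebesgue
          borel_measurable_integrable[OF f]) auto
    show "AE x in lebesgue_on K. norm (\<psi> x *\<^sub>R f x) \<le> norm (B * norm (f x))"
    proof (rule AE_I2)
      fix x assume "x \<in> space (lebesgue_on K)"
      then have "norm (\<psi> x) \<le> B" using B by simp
      then have "norm (\<psi> x) * norm (f x) \<le> B * norm (f x)" by (rule mult_right_mono) simp
      then show "norm (\<psi> x *\<^sub>R f x) \<le> norm (B * norm (f x))" by simp
    qed
  qed
  then show ?thesis
    using assms compact_lebesgue by (subst lebesgue_on_support(1)[of K]) auto
qed

lemma locally_integrable_mult_test_vec:
  fixes f :: "'a::euclidean_space \<Rightarrow> real" and \<psi> :: "'a \<Rightarrow> 'a"
  assumes "locally_integrable \<Omega> f" "\<Omega> \<in> sets lebesgue" "compact K" "K \<subseteq> \<Omega>"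
    "continuous_on UNIV \<psi>" "\<And>x. x \<notin> K \<Longrightarrow> \<psi> x = 0"
  shows "integrable (lebesgue_on \<Omega>) (\<lambda>x. f x *\<^sub>R \<psi> x)"
proof -
  have "integrable (lebesgue_on \<Omega>) (\<lambda>x. (\<psi> x \<bullet> e) *\<^sub>R f x)" if "e \<in> Basis" for e
    using assms by (intro locally_integrable_mult_test[of \<Omega> f K] continuous_intros) auto
  then have "integrable (lebesgue_on \<Omega>) (\<lambda>x. \<Sum>e\<in>Basis. ((\<psi> x \<bullet> e) *\<^sub>R f x) *\<^sub>R e)"
    by (intro Bochner_Integration.integrable_sum integrable_scaleR_left) auto
  moreover have "(\<lambda>x. \<Sum>e\<in>Basis. ((\<psi> x \<bullet> e) *\<^sub>R f x) *\<^sub>R e) = (\<lambda>x. f x *\<^sub>R \<psi> x)"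
  proof
    fix x
    have "(\<Sum>e\<in>Basis. ((\<psi> x \<bullet> e) *\<^sub>R f x) *\<^sub>R e) = f x *\<^sub>R (\<Sum>e\<in>Basis. (\<psi> x \<bullet> e) *\<^sub>R e)"
      by (simp add: scaleR_sum_right mult.commute)
    then show "(\<Sum>e\<in>Basis. ((\<psi> x \<bullet> e) *\<^sub>R f x) *\<^sub>R e) = f x *\<^sub>R \<psi> x"
      by (simp add: euclidean_representation)
  qed
  ultimately show ?thesis by simp
qed

lemma test_function_integrable:
  assumes "\<phi> \<in> test_functions \<Omega>" "\<Omega> \<in> sets lebesgue"
  shows "locally_integrable \<Omega> f \<Longrightarrow> integrable (lebesgue_on \<Omega>) (\<lambda>x. \<phi> x *\<^sub>R (f x :: 'b::euclidean_space))"
    and "locally_integrable \<Omega> h \<Longrightarrow> integrable (lebesgue_on \<Omega>) (\<lambda>x. h x *\<^sub>R classical_gradient \<phi> x)"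
proof -
  let ?K = "closure {x. \<phi> x \<noteq> 0}"
  have K: "compact ?K" "?K \<subseteq> \<Omega>" using assms by (auto simp: test_functions_def)
  have 0: "\<phi> x = 0" if "x \<notin> ?K" for x using that closure_subset[of "{x. \<phi> x \<noteq> 0}"] by auto
  show "locally_integrable \<Omega> f \<Longrightarrow> integrable (lebesgue_on \<Omega>) (\<lambda>x. \<phi> x *\<^sub>R f x)"
    using K assms 0 test_function_derivative(3)[OF assms(1)]
    by (intro locally_integrable_mult_test[of \<Omega> f ?K])
  show "locally_integrable \<Omega> h \<Longrightarrow> integrable (lebesgue_on \<Omega>) (\<lambda>x. h x *\<^sub>R classical_gradient \<phi> x)"
    using K assms test_function_derivative(2)[OF assms(1)] classical_gradient_outside_support
    by (intro locally_integrable_mult_test_vec[of \<Omega> h ?K])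
qed

lemma locally_integrable_continuous: "continuous_on UNIV f \<Longrightarrow> locally_integrable \<Omega> f"
  by (simp add: locally_integrable_def integrable_lebesgue_on_compact)

text \<open>Integration by parts: the gradient of the product \<psi> \<phi> integrates to 0, and the
  product rule splits it into the two integrands.\<close>

lemma test_function_is_weak_gradient:
  assumes \<psi>: "\<psi> \<in> test_functions \<Omega>" and \<Omega>: "\<Omega> \<in> sets lebesgue"
  shows "is_weak_gradient \<Omega> \<psi> (classical_gradient \<psi>)"
  unfolding is_weak_gradient_def
proof (intro conjI ballI)
  show l: "locally_integrable \<Omega> \<psi>" "locally_integrable \<Omega> (classical_gradient \<psi>)"
    using test_function_derivative[OF \<psi>] by (auto intro: locally_integrable_continuous)
  fix \<phi> assume \<phi>: "\<phi> \<in> test_functions \<Omega>"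
  let ?K = "closure {x. \<phi> x \<noteq> 0}"
  let ?G = "\<lambda>x. \<psi> x *\<^sub>R classical_gradient \<phi> x + \<phi> x *\<^sub>R classical_gradient \<psi> x"
  have K: "compact ?K" "?K \<subseteq> \<Omega>" using \<phi> by (auto simp: test_functions_def)
  have 0: "\<phi> x = 0" if "x \<notin> ?K" for x using that closure_subset[of "{x. \<phi> x \<noteq> 0}"] by auto
  note d\<phi> = test_function_derivative[OF \<phi>] and d\<psi> = test_function_derivative[OF \<psi>]
  have "integral\<^sup>L (lebesgue_on ?K) ?G = 0"
  proof (rule integral_gradient_eq_0[where F = "\<lambda>x. \<psi> x * \<phi> x"])
    show "((\<lambda>x. \<psi> x * \<phi> x) has_derivative (\<bullet>) (?G x)) (at x)" for x
      by (rule has_derivative_eq_rhs[OF has_derivative_mult[OF d\<psi>(1) d\<phi>(1)]])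
        (auto simp: fun_eq_iff inner_simps)
    show "continuous_on UNIV ?G" using d\<phi> d\<psi> by (intro continuous_intros)
    show "?G x = 0" if "x \<notin> ?K" for x
      using 0[OF that] classical_gradient_outside_support[OF that] by simp
  next
    show "compact ?K" by (rule K(1))
    show "\<psi> x * \<phi> x = 0" if "x \<notin> ?K" for x using 0[OF that] by simp
  qed
  moreover have "integral\<^sup>L (lebesgue_on \<Omega>) ?G = integral\<^sup>L (lebesgue_on ?K) ?G"
  proof (rule lebesgue_on_support(2)[OF K(2) compact_lebesgue[OF K(1)] \<Omega>])
    fix x assume "x \<notin> ?K"
    then show "?G x = 0"
      using 0[of x] classical_gradient_outside_support[of x \<phi>] by simp
  qed
  ultimately have "integral\<^sup>L (lebesgue_on \<Omega>) ?G = 0" by (simp only:)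
  then show "(\<integral>x. \<psi> x *\<^sub>R classical_gradient \<phi> x \<partial>lebesgue_on \<Omega>) =
        - (\<integral>x. \<phi> x *\<^sub>R classical_gradient \<psi> x \<partial>lebesgue_on \<Omega>)"
    using test_function_integrable(1)[OF \<phi> \<Omega> l(2)] test_function_integrable(2)[OF \<phi> \<Omega> l(1)]
    by (simp add: eq_neg_iff_add_eq_0)
qed

text \<open>Boxes generate the Borel sets, so an integrable function with vanishing box integrals
  has vanishing integral over every Borel set.\<close>
lemma AE_0_if_box_integrals_0:
  fixes g :: "'a::euclidean_space \<Rightarrow> real"
  assumes g: "integrable lborel g" and tot: "integral\<^sup>L lborel g = 0"
    and boxes: "\<And>c d. set_lebesgue_integral lborel (box c d) g = 0"
  shows "AE x in lborel. g x = 0"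
proof (rule sigma_finite_measure.density_zero[OF lborel.sigma_finite_measure_axioms g])
  fix A :: "'a set" assume "A \<in> sets lborel"
  then have A: "A \<in> sigma_sets UNIV (range (\<lambda>(a, b). box a b))"
    by (simp add: borel_eq_box)
  have S: "sigma_sets UNIV (range (\<lambda>(a, b). box a b)) = sets (lborel :: 'a measure)"
    by (simp add: borel_eq_box)
  have si: "set_integrable lborel B g" if "B \<in> sets lborel" for B
    unfolding set_integrable_def using g that by (rule integrable_mult_indicator[rotated])
  show "set_lebesgue_integral lborel A g = 0"
  proof (rule sigma_sets_induct_disjoint[OF _ _ A])
    show "Int_stable (range (\<lambda>(a, b). box a b :: 'a set))"
      by (auto simp: Int_stable_def box_Int_box)
    fix B :: "'a set" assume B: "B \<in> sigma_sets UNIV (range (\<lambda>(a, b). box a b))"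
      and 0: "set_lebesgue_integral lborel B g = 0"
    have "set_lebesgue_integral lborel ((UNIV - B) \<union> B) g
        = set_lebesgue_integral lborel (UNIV - B) g + set_lebesgue_integral lborel B g"
      using B unfolding S by (intro set_integral_Un si) auto
    then show "set_lebesgue_integral lborel (UNIV - B) g = 0"
      using 0 tot by (simp add: set_lebesgue_integral_def)
  next
    fix B :: "nat \<Rightarrow> 'a set" assume d: "disjoint_family B"
      and B: "range B \<subseteq> sigma_sets UNIV (range (\<lambda>(a, b). box a b))"
      and 0: "\<And>i. set_lebesgue_integral lborel (B i) g = 0"
    have "set_lebesgue_integral lborel (\<Union>i. B i) g = (\<Sum>i. set_lebesgue_integral lborel (B i) g)"
      using B d unfolding S disjoint_family_on_def
      by (intro lebesgue_integral_countable_add si) auto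
    then show "set_lebesgue_integral lborel (\<Union>i. B i) g = 0" using 0 by simp
  next
    show "set_lebesgue_integral lborel {} g = 0" by (simp add: set_lebesgue_integral_def)
  qed (use boxes in auto)
qed

text \<open>An open set is a countable union of closed boxes, and each closed box differs from its
  interior by a null set.\<close>

lemma AE_lebesgue_on_countable_cover:
  fixes \<Omega> :: "'a::euclidean_space set"
  assumes "open \<Omega>" "\<And>a b. cbox a b \<subseteq> \<Omega> \<Longrightarrow> AE x in lebesgue_on (box a b). P x"
  shows "AE x in lebesgue_on \<Omega>. P x"
proof -
  obtain D where D: "countable D" "D \<subseteq> Pow \<Omega>" "\<And>X. X \<in> D \<Longrightarrow> \<exists>a b. X = cbox a b" "\<Union>D = \<Omega>"
    using open_countable_Union_open_cbox[OF assms(1)] by metis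
  have "AE x in lebesgue. \<forall>X\<in>D. x \<in> X \<longrightarrow> P x"
  proof (subst AE_ball_countable[OF D(1)], intro ballI)
    fix X assume X: "X \<in> D"
    then obtain a b where ab: "X = cbox a b" using D(3) by blast
    have "AE x in lebesgue. x \<in> box a b \<longrightarrow> P x"
      using assms(2)[of a b] X D(2) ab by (auto simp: AE_restrict_space_iff)
    moreover have "AE x in lebesgue. x \<notin> cbox a b - box a b"
      using negligible_frontier_interval[of a b] by (intro AE_not_in) (simp add: negligible_iff_null_sets)
    ultimately show "AE x in lebesgue. x \<in> X \<longrightarrow> P x"
      by eventually_elim (auto simp: ab)
  qed
  moreover have "\<Omega> \<in> sets lebesgue" using assms(1) by auto
  ultimately show ?thesis
    using D(4) by (auto simp: AE_restrict_space_iff elim!: eventually_mono)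
qed

text \<open>Smooth bumps tend boundedly to the indicator of a box, so all box integrals of
  \<open>h\<close> vanish by dominated convergence. The countable cover localises to boxes on which
  \<open>h\<close> is integrable.\<close>

lemma fundamental_lemma_variations:
  fixes h :: "'a::euclidean_space \<Rightarrow> real"
  assumes \<Omega>: "open \<Omega>" and h: "locally_integrable \<Omega> h"
    and orth: "\<And>\<phi>. \<phi> \<in> test_functions \<Omega> \<Longrightarrow> (\<integral>x. \<phi> x * h x \<partial>lebesgue_on \<Omega>) = 0"
  shows "AE x in lebesgue_on \<Omega>. h x = 0"
proof (rule AE_lebesgue_on_countable_cover[OF \<Omega>])
  fix A B assume AB: "cbox A B \<subseteq> \<Omega>"
  have \<Omega>l: "\<Omega> \<in> sets lebesgue" using \<Omega> by auto
  have hi: "integrable (lebesgue_on (box A B)) h"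
  proof (rule integrable_lebesgue_on_subset)
    show "integrable (lebesgue_on (cbox A B)) h"
      using h AB by (simp add: locally_integrable_def)
  qed (simp_all add: box_subset_cbox)
  \<comment> \<open>Extension by zero off the box turns local integrability into integrability over
    the whole space.\<close>
  define H where "H = (\<lambda>x. indicator (box A B) x * h x)"
  have H: "integrable lebesgue H"
    using hi by (simp add: integrable_restrict_space H_def)
  have box0: "set_lebesgue_integral lebesgue (box c d) H = 0" for c d
  proof -
    \<comment> \<open>The intersection of two boxes is a box inside \<open>cbox A B\<close>, so its
      bumps are test functions of \<Omega>.\<close>
    obtain c' d' where cd: "box c d \<inter> box A B = box c' d'" "cbox c' d' \<subseteq> cbox A B"
      by (rule that[OF box_Int_box]) (auto simp: mem_box)
    define M where "M = lebesgue_on (box A B)"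
    have "(\<lambda>k. \<integral>x. box_bump c' d' (real (Suc k)) x * h x \<partial>M) \<longlonglongrightarrow> (\<integral>x. indicator (box c' d') x * h x \<partial>M)"
    proof (rule integral_dominated_convergence[where w = "\<lambda>x. \<bar>h x\<bar>"])
      have "box c' d' \<in> sets lebesgue" by simp
      then show "(\<lambda>x. indicator (box c' d') x * h x) \<in> borel_measurable M"
        unfolding M_def using hi by (auto intro!: borel_measurable_times borel_measurable_indicator
            simp: sets_restrict_space_iff borel_measurable_integrable) (use cd in blast)
      show "(\<lambda>x. box_bump c' d' (real (Suc k)) x * h x) \<in> borel_measurable M" for k
        unfolding M_def
      proof (rule borel_measurable_times[OF continuous_imp_measurable_on_sets_lebesgue
            borel_measurable_integrable[OF hi]])
        have "continuous_on UNIV (box_bump c' d' (real (Suc k)))"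
          using smooth_box_bump[of c' d' "real (Suc k)"] Ck_on.simps(1)
          unfolding smooth_on_def by blast
        then show "continuous_on (box A B) (box_bump c' d' (real (Suc k)))"
          by (rule continuous_on_subset) simp
      qed simp
      show "AE x in M. (\<lambda>k. box_bump c' d' (real (Suc k)) x * h x) \<longlonglongrightarrow> indicator (box c' d') x * h x"
        by (intro AE_I2 tendsto_intros box_bump_tendsto_indicator)
      show "AE x in M. norm (box_bump c' d' (real (Suc k)) x * h x) \<le> \<bar>h x\<bar>" for k
        using box_bump_range[of c' d' "real (Suc k)"]
        by (intro AE_I2) (auto simp: abs_mult intro!: mult_left_le_one_le)
    qed (use hi in \<open>auto simp: M_def\<close>)
    moreover have "(\<integral>x. box_bump c' d' (real (Suc k)) x * h x \<partial>M) = 0" for k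
    proof -
      have "(\<integral>x. box_bump c' d' (real (Suc k)) x * h x \<partial>M) =
        (\<integral>x. box_bump c' d' (real (Suc k)) x * h x \<partial>lebesgue_on \<Omega>)"
        unfolding M_def
      proof (rule lebesgue_on_support(2)[symmetric])
        show "box A B \<subseteq> \<Omega>" using AB box_subset_cbox by blast
        fix x assume "x \<notin> box A B"
        then have "x \<notin> box c' d'" using cd(1) by blast
        then have "box_bump c' d' (real (Suc k)) x = 0" by (subst box_bump_eq_0_iff) auto
        then show "box_bump c' d' (real (Suc k)) x * h x = 0" by simp
      qed (use \<Omega>l in auto)
      also have "\<dots> = 0"
        using cd(2) AB by (intro orth box_bump_test_function) auto
      finally show ?thesis .
    qed
    ultimately have "(\<integral>x. indicator (box c' d') x * h x \<partial>M) = 0"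
      by (simp add: LIMSEQ_const_iff)
    moreover have "set_lebesgue_integral lebesgue (box c d) H
        = (\<integral>x. indicator (box A B) x *\<^sub>R (indicator (box c' d') x * h x) \<partial>lebesgue)"
      unfolding H_def set_lebesgue_integral_def cd(1)[symmetric]
      by (intro Bochner_Integration.integral_cong) (auto simp: indicator_def)
    ultimately show ?thesis
      unfolding M_def by (simp only: integral_restrict_space sets.Int_space_eq2 sets_completionI_sets
          sets_lborel borel_open open_box)
  qed
  \<comment> \<open>\<open>AE_0_if_box_integrals_0\<close> is about Borel functions, so
    \<open>H\<close> is replaced by a Borel representative.\<close>
  obtain g where g: "g \<in> borel_measurable lborel" "AE x in lborel. H x = g x"
    using completion_ex_borel_measurable_real[of H lborel] H by auto
  have gH: "AE x in lebesgue. g x = H x" using AE_completion[OF g(2)] by (auto elim: eventually_mono)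
  have gl: "g \<in> borel_measurable lebesgue" using g(1) by (rule measurable_completion)
  have ig: "integrable lebesgue g"
    using H gl gH by (subst integrable_cong_AE[of g _ H]) auto
  have "AE x in lborel. g x = 0"
  proof (rule AE_0_if_box_integrals_0)
    show "integrable lborel g" using ig g(1) by (simp add: integrable_completion)
    have set0: "set_lebesgue_integral lborel (box c d) g = 0" for c d
    proof -
      have "set_lebesgue_integral lborel (box c d) g = set_lebesgue_integral lebesgue (box c d) g"
        unfolding set_lebesgue_integral_def using g(1)
        by (intro integral_completion[symmetric] borel_measurable_scaleR) auto
      also have "\<dots> = set_lebesgue_integral lebesgue (box c d) H"
        using gH H gl unfolding set_lebesgue_integral_def
        by (intro integral_cong_AE borel_measurable_scaleR borel_measurable_indicator) auto
      finally show ?thesis using box0 by simp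
    qed
    show "set_lebesgue_integral lborel (box c d) g = 0" for c d by (rule set0)
    have "integral\<^sup>L lborel g = integral\<^sup>L lebesgue g" using g(1) by (simp add: integral_completion)
    also have "\<dots> = integral\<^sup>L lebesgue H" using gH H gl by (intro integral_cong_AE) auto
    also have "\<dots> = set_lebesgue_integral lebesgue (box A B) H"
      unfolding set_lebesgue_integral_def H_def
      by (intro Bochner_Integration.integral_cong) (auto simp: indicator_def)
    finally show "integral\<^sup>L lborel g = 0" using box0 by simp
  qed
  then have "AE x in lebesgue. g x = 0" by (rule AE_completion)
  with gH have "AE x in lebesgue. H x = 0" by eventually_elim simp
  then show "AE x in lebesgue_on (box A B). h x = 0"
    by (simp add: AE_restrict_space_iff H_def) (auto elim!: eventually_mono simp: indicator_def)
qed

section \<open>Linearity and uniqueness of weak gradients\<close>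

lemma locally_integrable_comb:
  fixes f g :: "'a::euclidean_space \<Rightarrow> 'b::euclidean_space"
  assumes "locally_integrable \<Omega> f" "locally_integrable \<Omega> g"
  shows "locally_integrable \<Omega> (\<lambda>x. a *\<^sub>R f x + b *\<^sub>R g x)"
  using assms by (auto simp: locally_integrable_def)

text \<open>The left side of the defining identity sees only the a.e. class of the function, so each
  component of \<open>g - g'\<close> is orthogonal to all test functions.\<close>

lemma weak_gradient_unique:
  fixes \<Omega> :: "'a::euclidean_space set"
  assumes \<Omega>: "open \<Omega>" and g: "is_weak_gradient \<Omega> u g" and g': "is_weak_gradient \<Omega> u' g'"
    and ae: "AE x in lebesgue_on \<Omega>. u x = u' x"
  shows "AE x in lebesgue_on \<Omega>. g x = g' x"
proof -
  have \<Omega>l: "\<Omega> \<in> sets lebesgue" using \<Omega> by auto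
  have "AE x in lebesgue_on \<Omega>. g x \<bullet> e - g' x \<bullet> e = 0" if "e \<in> Basis" for e
  proof (rule fundamental_lemma_variations[OF \<Omega>])
    have "locally_integrable \<Omega> (\<lambda>x. 1 *\<^sub>R g x + (-1) *\<^sub>R g' x)"
      using g g' by (intro locally_integrable_comb) (auto simp: is_weak_gradient_def)
    then show "locally_integrable \<Omega> (\<lambda>x. g x \<bullet> e - g' x \<bullet> e)"
      unfolding locally_integrable_def
      by (auto simp: inner_diff_left[symmetric])
    fix \<phi> assume \<phi>: "\<phi> \<in> test_functions \<Omega>"
    have i: "integrable (lebesgue_on \<Omega>) (\<lambda>x. \<phi> x *\<^sub>R g x)" "integrable (lebesgue_on \<Omega>) (\<lambda>x. \<phi> x *\<^sub>R g' x)"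
      "integrable (lebesgue_on \<Omega>) (\<lambda>x. u x *\<^sub>R classical_gradient \<phi> x)"
      "integrable (lebesgue_on \<Omega>) (\<lambda>x. u' x *\<^sub>R classical_gradient \<phi> x)"
      using test_function_integrable[OF \<phi> \<Omega>l] g g' by (auto simp: is_weak_gradient_def)
    have "(\<integral>x. u x *\<^sub>R classical_gradient \<phi> x \<partial>lebesgue_on \<Omega>) =
        (\<integral>x. u' x *\<^sub>R classical_gradient \<phi> x \<partial>lebesgue_on \<Omega>)"
      using i ae by (intro integral_cong_AE) auto
    then have "(\<integral>x. \<phi> x *\<^sub>R g x \<partial>lebesgue_on \<Omega>) = (\<integral>x. \<phi> x *\<^sub>R g' x \<partial>lebesgue_on \<Omega>)"
      using g g' \<phi> by (simp add: is_weak_gradient_def)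
    then have "(\<integral>x. (\<phi> x *\<^sub>R g x) \<bullet> e \<partial>lebesgue_on \<Omega>) = (\<integral>x. (\<phi> x *\<^sub>R g' x) \<bullet> e \<partial>lebesgue_on \<Omega>)"
      using i by (simp add: integral_inner_left del: inner_scaleR_left)
    moreover have "integrable (lebesgue_on \<Omega>) (\<lambda>x. (\<phi> x *\<^sub>R g x) \<bullet> e)"
       "integrable (lebesgue_on \<Omega>) (\<lambda>x. (\<phi> x *\<^sub>R g' x) \<bullet> e)"
      using i by (auto simp del: inner_scaleR_left)
    ultimately show "(\<integral>x. \<phi> x * (g x \<bullet> e - g' x \<bullet> e) \<partial>lebesgue_on \<Omega>) = 0"
      by (simp add: right_diff_distrib)
  qed
  then have "AE x in lebesgue_on \<Omega>. \<forall>e\<in>Basis. g x \<bullet> e - g' x \<bullet> e = 0"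
    by (intro AE_finite_allI) simp_all
  then show ?thesis
    by eventually_elim (rule euclidean_eqI, simp)
qed

lemma weak_gradient_AE_eq:
  assumes "open \<Omega>" "is_weak_gradient \<Omega> u g"
  shows "AE x in lebesgue_on \<Omega>. weak_gradient \<Omega> u x = g x"
proof -
  have "is_weak_gradient \<Omega> u (weak_gradient \<Omega> u)"
    unfolding weak_gradient_def using someI[of "is_weak_gradient \<Omega> u", OF assms(2)] .
  then show ?thesis using weak_gradient_unique[OF assms(1) _ assms(2)] by simp
qed

lemma is_weak_gradient_comb:
  assumes "\<Omega> \<in> sets lebesgue" "is_weak_gradient \<Omega> u g" "is_weak_gradient \<Omega> v h"
  shows "is_weak_gradient \<Omega> (\<lambda>x. a * u x + b * v x) (\<lambda>x. a *\<^sub>R g x + b *\<^sub>R h x)"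
  unfolding is_weak_gradient_def
proof (intro conjI ballI)
  show "locally_integrable \<Omega> (\<lambda>x. a * u x + b * v x)"
    using locally_integrable_comb[of \<Omega> u v a b] assms by (simp add: is_weak_gradient_def)
  show "locally_integrable \<Omega> (\<lambda>x. a *\<^sub>R g x + b *\<^sub>R h x)"
    using locally_integrable_comb[of \<Omega> g h a b] assms by (simp add: is_weak_gradient_def)
  fix \<phi> assume \<phi>: "\<phi> \<in> test_functions \<Omega>"
  have i: "integrable (lebesgue_on \<Omega>) (\<lambda>x. \<phi> x *\<^sub>R g x)" "integrable (lebesgue_on \<Omega>) (\<lambda>x. \<phi> x *\<^sub>R h x)"
      "integrable (lebesgue_on \<Omega>) (\<lambda>x. u x *\<^sub>R classical_gradient \<phi> x)"
      "integrable (lebesgue_on \<Omega>) (\<lambda>x. v x *\<^sub>R classical_gradient \<phi> x)"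
    using test_function_integrable[OF \<phi> assms(1)] assms by (auto simp: is_weak_gradient_def)
  have "(\<integral>x. (a * u x + b * v x) *\<^sub>R classical_gradient \<phi> x \<partial>lebesgue_on \<Omega>) =
     (\<integral>x. a *\<^sub>R (u x *\<^sub>R classical_gradient \<phi> x) + b *\<^sub>R (v x *\<^sub>R classical_gradient \<phi> x) \<partial>lebesgue_on \<Omega>)"
    by (intro Bochner_Integration.integral_cong) (auto simp: algebra_simps)
  also have "\<dots> = a *\<^sub>R (\<integral>x. u x *\<^sub>R classical_gradient \<phi> x \<partial>lebesgue_on \<Omega>)
       + b *\<^sub>R (\<integral>x. v x *\<^sub>R classical_gradient \<phi> x \<partial>lebesgue_on \<Omega>)"
    using i by (simp del: scaleR_scaleR)
  also have "\<dots> = - (a *\<^sub>R (\<integral>x. \<phi> x *\<^sub>R g x \<partial>lebesgue_on \<Omega>) + b *\<^sub>R (\<integral>x. \<phi> x *\<^sub>R h x \<partial>lebesgue_on \<Omega>))"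
    using assms \<phi> by (simp add: is_weak_gradient_def)
  also have "a *\<^sub>R (\<integral>x. \<phi> x *\<^sub>R g x \<partial>lebesgue_on \<Omega>) + b *\<^sub>R (\<integral>x. \<phi> x *\<^sub>R h x \<partial>lebesgue_on \<Omega>) =
      (\<integral>x. a *\<^sub>R (\<phi> x *\<^sub>R g x) + b *\<^sub>R (\<phi> x *\<^sub>R h x) \<partial>lebesgue_on \<Omega>)"
    using i by (simp del: scaleR_scaleR)
  also have "\<dots> = (\<integral>x. \<phi> x *\<^sub>R (a *\<^sub>R g x + b *\<^sub>R h x) \<partial>lebesgue_on \<Omega>)"
    by (intro Bochner_Integration.integral_cong) (auto simp: algebra_simps)
  finally show "(\<integral>x. (a * u x + b * v x) *\<^sub>R classical_gradient \<phi> x \<partial>lebesgue_on \<Omega>) =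
      - (\<integral>x. \<phi> x *\<^sub>R (a *\<^sub>R g x + b *\<^sub>R h x) \<partial>lebesgue_on \<Omega>)" .
qed

section \<open>Lebesgue spaces\<close>

lemma powr_convex_comb:
  fixes x y t m :: real
  assumes "m \<ge> 1" "0 \<le> x" "0 \<le> y" "0 < t" "t < 1"
  shows "(t * x + (1 - t) * y) powr m \<le> t * x powr m + (1 - t) * y powr m"
proof -
  \<comment> \<open>\<open>powr_convex\<close> covers positive arguments only; with x = 0 or y = 0
    the claim reduces to this inequality.\<close>
  have le: "s powr m \<le> s" if "0 < s" "s < 1" for s :: real
    using powr_mono'[of 1 m s] that assms(1) by simp
  consider "x = 0" | "y = 0" | "x > 0" "y > 0" using assms by linarith
  then show ?thesis
  proof cases
    case 3
    have "convex_on {0<..} (\<lambda>x::real. x powr m)" using powr_convex assms(1) .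
    from convex_onD[OF this, of "1 - t" x y] show ?thesis using 3 assms by simp
  qed (use assms le[of t] le[of "1 - t"] in \<open>auto simp: powr_mult intro!: mult_right_mono\<close>)
qed

lemma powr_midpoint_le:
  fixes x y m :: real
  assumes "m \<ge> 1" "0 \<le> x" "0 \<le> y"
  shows "((x + y) / 2) powr m \<le> (x powr m + y powr m) / 2"
  using powr_convex_comb[OF assms, of "1/2"] by (simp add: field_simps)

text \<open>Normalise by x + y: a share s in [0,1] satisfies s^m <= s, and the two shares add up to
  1.\<close>

lemma powr_add_ge:
  fixes x y m :: real
  assumes "m \<ge> 1" "0 \<le> x" "0 \<le> y"
  shows "x powr m + y powr m \<le> (x + y) powr m"
proof (cases "x + y = 0")
  case False
  then have pos: "x + y > 0" using assms by simp
  have *: "z powr m \<le> z / (x + y) * (x + y) powr m" if "0 \<le> z" "z \<le> x + y" for z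
  proof -
    have "z powr m = (z / (x + y)) powr m * (x + y) powr m"
      using that pos by (simp add: powr_divide)
    also have "(z / (x + y)) powr m \<le> z / (x + y)"
    proof (cases "z = 0")
      case False
      then show ?thesis using powr_mono'[of 1 m "z / (x + y)"] that pos assms(1) by simp
    qed simp
    finally show ?thesis by (simp add: mult_right_mono)
  qed
  have "x powr m + y powr m \<le> x / (x + y) * (x + y) powr m + y / (x + y) * (x + y) powr m"
    using assms by (intro add_mono *) auto
  also have "\<dots> = (x / (x + y) + y / (x + y)) * (x + y) powr m" by (simp only: distrib_right)
  also have "x / (x + y) + y / (x + y) = 1" using False by (simp add: add_divide_distrib[symmetric])
  finally show ?thesis by simp
next
  case True
  then have "x = 0" "y = 0" using assms by auto
  then show ?thesis by simp
qed

text \<open>The case \<open>m = 2\<close> is the parallelogram law; the general case follows by convexity.\<close>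
lemma clarkson_pointwise:
  fixes a b :: "'a::real_inner"
  assumes "m \<ge> 2"
  shows "norm ((1/2) *\<^sub>R (a + b)) powr m + norm ((1/2) *\<^sub>R (a - b)) powr m
    \<le> (norm a powr m + norm b powr m) / 2"
proof -
  have sq: "norm c powr m = ((norm c)\<^sup>2) powr (m / 2)" for c :: 'a
  proof (cases "c = 0")
    case False
    then have "(norm c)\<^sup>2 = norm c powr 2" by simp
    then show ?thesis by (simp only: powr_powr) simp
  qed simp
  have "norm ((1/2) *\<^sub>R (a + b)) powr m + norm ((1/2) *\<^sub>R (a - b)) powr m
     \<le> ((norm ((1/2) *\<^sub>R (a + b)))\<^sup>2 + (norm ((1/2) *\<^sub>R (a - b)))\<^sup>2) powr (m / 2)"
    unfolding sq using assms by (intro powr_add_ge) auto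
  also have "(norm ((1/2) *\<^sub>R (a + b)))\<^sup>2 + (norm ((1/2) *\<^sub>R (a - b)))\<^sup>2 = ((norm a)\<^sup>2 + (norm b)\<^sup>2) / 2"
    by (simp add: power2_norm_eq_inner inner_simps algebra_simps inner_commute)
  also have "\<dots> powr (m / 2) \<le> (norm a powr m + norm b powr m) / 2"
    unfolding sq using assms by (intro powr_midpoint_le) auto
  finally show ?thesis .
qed

section \<open>Lebesgue norms and Minkowski's inequality\<close>

lemma Lnorm_finite:
  "Lnorm \<Omega> (ereal m) f = (\<integral>x. norm (f x) powr m \<partial>lebesgue_on \<Omega>) powr (1 / m)"
  by (simp add: Lnorm_def)

lemma Lnorm_nonneg: "0 \<le> Lnorm \<Omega> (ereal m) f"
  by (simp add: Lnorm_finite)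

lemma Lnorm_powr:
  "m > 0 \<Longrightarrow> Lnorm \<Omega> (ereal m) f powr m = (\<integral>x. norm (f x) powr m \<partial>lebesgue_on \<Omega>)"
  by (simp add: Lnorm_finite powr_powr powr_one' integral_nonneg_AE)

lemma Lnorm_leI:
  assumes "m > 0" "(\<integral>x. norm (f x) powr m \<partial>lebesgue_on \<Omega>) \<le> c powr m" "0 \<le> c"
  shows "Lnorm \<Omega> (ereal m) f \<le> c"
proof -
  have "Lnorm \<Omega> (ereal m) f \<le> (c powr m) powr (1 / m)"
    unfolding Lnorm_finite using assms
    by (intro powr_mono2) (auto simp: integral_nonneg_AE)
  then show ?thesis using assms by (simp add: powr_powr powr_one')
qed

lemma Lspace_measurable: "f \<in> Lspace \<Omega> m \<Longrightarrow> f \<in> borel_measurable (lebesgue_on \<Omega>)"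
  by (simp add: Lspace_def)

lemma Lspace_integrable: "f \<in> Lspace \<Omega> m \<Longrightarrow> integrable (lebesgue_on \<Omega>) (\<lambda>x. norm (f x) powr m)"
  by (simp add: Lspace_def)

lemma Lnorm_cong_AE:
  assumes "f \<in> borel_measurable (lebesgue_on \<Omega>)" "g \<in> borel_measurable (lebesgue_on \<Omega>)"
    "AE x in lebesgue_on \<Omega>. f x = g x"
  shows "Lnorm \<Omega> (ereal m) f = Lnorm \<Omega> (ereal m) g"
proof -
  have "(\<integral>x. norm (f x) powr m \<partial>lebesgue_on \<Omega>) = (\<integral>x. norm (g x) powr m \<partial>lebesgue_on \<Omega>)"
    using assms by (intro integral_cong_AE) auto
  then show ?thesis by (simp add: Lnorm_finite)
qed

lemma Lspace_bound:
  assumes "f \<in> borel_measurable (lebesgue_on \<Omega>)" "integrable (lebesgue_on \<Omega>) h"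
    "AE x in lebesgue_on \<Omega>. norm (f x) powr m \<le> h x"
  shows "f \<in> Lspace \<Omega> m"
proof -
  have "integrable (lebesgue_on \<Omega>) (\<lambda>x. norm (f x) powr m)"
    by (rule Bochner_Integration.integrable_bound[OF assms(2)]) (use assms in auto)
  then show ?thesis using assms(1) by (simp add: Lspace_def)
qed

lemma Lspace_cong_AE:
  assumes "f \<in> Lspace \<Omega> m" "g \<in> borel_measurable (lebesgue_on \<Omega>)" "AE x in lebesgue_on \<Omega>. f x = g x"
  shows "g \<in> Lspace \<Omega> m"
proof (rule Lspace_bound[OF assms(2) Lspace_integrable[OF assms(1)]])
  show "AE x in lebesgue_on \<Omega>. norm (g x) powr m \<le> norm (f x) powr m"
    using assms(3) by eventually_elim simp
qed

lemma Lnorm_scaleR: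
  assumes "m > 0"
  shows "Lnorm \<Omega> (ereal m) (\<lambda>x. c *\<^sub>R f x) = \<bar>c\<bar> * Lnorm \<Omega> (ereal m) f"
  using assms by (simp add: Lnorm_finite powr_mult powr_powr powr_one' integral_nonneg_AE)

lemma Lnorm_mult: "m > 0 \<Longrightarrow> Lnorm \<Omega> (ereal m) (\<lambda>x. c * f x) = \<bar>c\<bar> * Lnorm \<Omega> (ereal m) f"
  using Lnorm_scaleR[of m \<Omega> c f] by simp

lemma Lspace_scaleR: "f \<in> Lspace \<Omega> m \<Longrightarrow> (\<lambda>x. c *\<^sub>R f x) \<in> Lspace \<Omega> m"
  by (auto simp: Lspace_def powr_mult)

lemma Lspace_add:
  assumes "m \<ge> 1" "f \<in> Lspace \<Omega> m" "g \<in> Lspace \<Omega> m"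
  shows "(\<lambda>x. f x + g x) \<in> Lspace \<Omega> m"
proof (rule Lspace_bound)
  show "(\<lambda>x. f x + g x) \<in> borel_measurable (lebesgue_on \<Omega>)"
    using assms by (auto simp: Lspace_def)
  show "integrable (lebesgue_on \<Omega>) (\<lambda>x. 2 powr m * ((norm (f x) powr m + norm (g x) powr m) / 2))"
    using assms by (auto simp: Lspace_def)
  show "AE x in lebesgue_on \<Omega>. norm (f x + g x) powr m \<le> 2 powr m * ((norm (f x) powr m + norm (g x) powr m) / 2)"
  proof (rule AE_I2)
    fix x
    have "norm (f x + g x) powr m \<le> (2 * ((norm (f x) + norm (g x)) / 2)) powr m"
      using assms(1) norm_triangle_ineq[of "f x" "g x"] by (intro powr_mono2) auto
    also have "\<dots> = 2 powr m * ((norm (f x) + norm (g x)) / 2) powr m" by (rule powr_mult)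
    also have "\<dots> \<le> 2 powr m * ((norm (f x) powr m + norm (g x) powr m) / 2)"
      using assms(1) by (intro mult_left_mono powr_midpoint_le) auto
    finally show "norm (f x + g x) powr m \<le> 2 powr m * ((norm (f x) powr m + norm (g x) powr m) / 2)" .
  qed
qed

lemma Lspace_comb:
  assumes "m \<ge> 1" "f \<in> Lspace \<Omega> m" "g \<in> Lspace \<Omega> m"
  shows "(\<lambda>x. a *\<^sub>R f x + b *\<^sub>R g x) \<in> Lspace \<Omega> m"
  using assms by (intro Lspace_add Lspace_scaleR)

lemma Lspace_diff:
  assumes "m \<ge> 1" "f \<in> Lspace \<Omega> m" "g \<in> Lspace \<Omega> m"
  shows "(\<lambda>x. f x - g x) \<in> Lspace \<Omega> m"
  using Lspace_comb[OF assms, of 1 "-1"] by simp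

text \<open>Minkowski's inequality from convexity: \<open>f + g\<close> is \<open>A + B\<close>
  times a convex combination of \<open>f / A\<close> and \<open>g / B\<close>. Taking
  \<open>A\<close> and \<open>B\<close> slightly above the norms avoids division by zero.\<close>

theorem Lnorm_triangle:
  assumes m: "m \<ge> 1" and f: "f \<in> Lspace \<Omega> m" and g: "g \<in> Lspace \<Omega> m"
  shows "Lnorm \<Omega> (ereal m) (\<lambda>x. f x + g x) \<le> Lnorm \<Omega> (ereal m) f + Lnorm \<Omega> (ereal m) g"
proof (rule field_le_epsilon)
  fix e :: real assume e: "e > 0"
  define A where "A = Lnorm \<Omega> (ereal m) f + e / 2"
  define B where "B = Lnorm \<Omega> (ereal m) g + e / 2"
  have AB: "A > 0" "B > 0" using e Lnorm_nonneg[of \<Omega> m] by (auto simp: A_def B_def intro!: add_nonneg_pos)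
  define t where "t = A / (A + B)"
  have t: "0 < t" "t < 1" "1 - t = B / (A + B)" using AB by (auto simp: t_def field_simps)
  have fA: "(\<integral>x. norm (f x) powr m \<partial>lebesgue_on \<Omega>) \<le> A powr m"
    using e m Lnorm_nonneg[of \<Omega> m f] Lnorm_powr[of m \<Omega> f, symmetric] by (auto simp: A_def intro!: powr_mono2)
  have gB: "(\<integral>x. norm (g x) powr m \<partial>lebesgue_on \<Omega>) \<le> B powr m"
    using e m Lnorm_nonneg[of \<Omega> m g] Lnorm_powr[of m \<Omega> g, symmetric] by (auto simp: B_def intro!: powr_mono2)
  have pt: "norm (f x + g x) powr m \<le>
      (A + B) powr m * (t / A powr m * norm (f x) powr m + (1 - t) / B powr m * norm (g x) powr m)" for x
  proof -
    have "norm (f x + g x) powr m \<le> ((A + B) * (t * (norm (f x) / A) + (1 - t) * (norm (g x) / B))) powr m"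
    proof (rule powr_mono2)
      have "(A + B) * t = A" "(A + B) * (1 - t) = B"
        unfolding t(3) unfolding t_def using AB by auto
      moreover have "(A + B) * (t * (norm (f x) / A) + (1 - t) * (norm (g x) / B))
          = ((A + B) * t) * (norm (f x) / A) + ((A + B) * (1 - t)) * (norm (g x) / B)"
        by (simp only: distrib_left mult.assoc)
      ultimately have "(A + B) * (t * (norm (f x) / A) + (1 - t) * (norm (g x) / B)) = norm (f x) + norm (g x)"
        using AB by simp
      then show "norm (f x + g x) \<le> (A + B) * (t * (norm (f x) / A) + (1 - t) * (norm (g x) / B))"
        by (simp add: norm_triangle_ineq)
    qed (use m in auto)
    also have "\<dots> = (A + B) powr m * (t * (norm (f x) / A) + (1 - t) * (norm (g x) / B)) powr m"
      by (rule powr_mult)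
    also have "\<dots> \<le> (A + B) powr m * (t * (norm (f x) / A) powr m + (1 - t) * (norm (g x) / B) powr m)"
      using AB t m by (intro mult_left_mono powr_convex_comb) auto
    finally show ?thesis using AB by (simp add: powr_divide)
  qed
  have "(\<integral>x. norm (f x + g x) powr m \<partial>lebesgue_on \<Omega>) \<le>
     (\<integral>x. (A + B) powr m * (t / A powr m * norm (f x) powr m + (1 - t) / B powr m * norm (g x) powr m) \<partial>lebesgue_on \<Omega>)"
    using pt Lspace_integrable[OF Lspace_add[OF m f g]] Lspace_integrable[OF f] Lspace_integrable[OF g]
    by (intro integral_mono) auto
  also have "\<dots> = (A + B) powr m * (t / A powr m * (\<integral>x. norm (f x) powr m \<partial>lebesgue_on \<Omega>)
      + (1 - t) / B powr m * (\<integral>x. norm (g x) powr m \<partial>lebesgue_on \<Omega>))"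
    using Lspace_integrable[OF f] Lspace_integrable[OF g] by simp
  also have "\<dots> \<le> (A + B) powr m * (t / A powr m * A powr m + (1 - t) / B powr m * B powr m)"
    using fA gB AB t by (intro mult_left_mono add_mono) auto
  also have "\<dots> = (A + B) powr m" using AB by simp
  finally have "Lnorm \<Omega> (ereal m) (\<lambda>x. f x + g x) \<le> A + B"
    using m AB by (intro Lnorm_leI) auto
  then show "Lnorm \<Omega> (ereal m) (\<lambda>x. f x + g x) \<le> Lnorm \<Omega> (ereal m) f + Lnorm \<Omega> (ereal m) g + e"
    by (simp add: A_def B_def)
qed

lemma Lnorm_minus_commute: "Lnorm \<Omega> (ereal m) (\<lambda>x. f x - g x) = Lnorm \<Omega> (ereal m) (\<lambda>x. g x - f x)"
  by (simp add: Lnorm_finite norm_minus_commute)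

lemma Lnorm_triangle_diff:
  assumes m: "m \<ge> 1" and f: "f \<in> Lspace \<Omega> m" and g: "g \<in> Lspace \<Omega> m"
  shows "Lnorm \<Omega> (ereal m) f \<le> Lnorm \<Omega> (ereal m) g + Lnorm \<Omega> (ereal m) (\<lambda>x. f x - g x)"
  using Lnorm_triangle[OF m g Lspace_diff[OF m f g]] by simp

lemma abs_Lnorm_diff_le:
  assumes m: "m \<ge> 1" and f: "f \<in> Lspace \<Omega> m" and g: "g \<in> Lspace \<Omega> m"
  shows "\<bar>Lnorm \<Omega> (ereal m) f - Lnorm \<Omega> (ereal m) g\<bar> \<le> Lnorm \<Omega> (ereal m) (\<lambda>x. f x - g x)"
  using Lnorm_triangle_diff[OF m f g] Lnorm_triangle_diff[OF m g f]
  by (simp add: Lnorm_minus_commute[of \<Omega> m g f])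

lemma Lnorm_triangle3:
  assumes m: "m \<ge> 1" and f: "f \<in> Lspace \<Omega> m" and g: "g \<in> Lspace \<Omega> m" and h: "h \<in> Lspace \<Omega> m"
  shows "Lnorm \<Omega> (ereal m) (\<lambda>x. f x - h x)
    \<le> Lnorm \<Omega> (ereal m) (\<lambda>x. f x - g x) + Lnorm \<Omega> (ereal m) (\<lambda>x. g x - h x)"
  using Lnorm_triangle[OF m Lspace_diff[OF m f g] Lspace_diff[OF m g h]] by simp

text \<open>The outer power \<open>p\<close> is independent of \<open>s\<close> because for
  \<open>q < p\<close> the functional contains the L^q norm of the gradient raised to the power
  \<open>p\<close>.\<close>

lemma Lnorm_midpoint_powr:
  assumes s: "s \<ge> 1" and f: "f \<in> Lspace \<Omega> s" and g: "g \<in> Lspace \<Omega> s" and p: "p \<ge> 1"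
  shows "Lnorm \<Omega> (ereal s) (\<lambda>x. (1/2) *\<^sub>R (f x + g x)) powr p
    \<le> (Lnorm \<Omega> (ereal s) f powr p + Lnorm \<Omega> (ereal s) g powr p) / 2"
proof -
  have "Lnorm \<Omega> (ereal s) (\<lambda>x. (1/2) *\<^sub>R (f x + g x)) \<le> (Lnorm \<Omega> (ereal s) f + Lnorm \<Omega> (ereal s) g) / 2"
    using Lnorm_triangle[OF s f g] Lnorm_scaleR[of s \<Omega> "1/2" "\<lambda>x. f x + g x"] s by simp
  then have "Lnorm \<Omega> (ereal s) (\<lambda>x. (1/2) *\<^sub>R (f x + g x)) powr p
      \<le> ((Lnorm \<Omega> (ereal s) f + Lnorm \<Omega> (ereal s) g) / 2) powr p"
    using p Lnorm_nonneg by (intro powr_mono2) auto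
  also have "\<dots> \<le> (Lnorm \<Omega> (ereal s) f powr p + Lnorm \<Omega> (ereal s) g powr p) / 2"
    using p Lnorm_nonneg by (intro powr_midpoint_le) auto
  finally show ?thesis .
qed

lemma Lnorm_clarkson:
  assumes m: "m \<ge> 2" and f: "f \<in> Lspace \<Omega> m" and g: "g \<in> Lspace \<Omega> m"
  shows "Lnorm \<Omega> (ereal m) (\<lambda>x. (1/2) *\<^sub>R (f x + g x)) powr m
      + Lnorm \<Omega> (ereal m) (\<lambda>x. (1/2) *\<^sub>R (f x - g x)) powr m
    \<le> (Lnorm \<Omega> (ereal m) f powr m + Lnorm \<Omega> (ereal m) g powr m) / 2"
proof -
  have m1: "m \<ge> 1" "m > 0" using m by auto
  note i = Lspace_integrable[OF f] Lspace_integrable[OF g]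
    Lspace_integrable[OF Lspace_scaleR[OF Lspace_add[OF m1(1) f g], of "1/2"]]
    Lspace_integrable[OF Lspace_scaleR[OF Lspace_diff[OF m1(1) f g], of "1/2"]]
  have "(\<integral>x. norm ((1/2) *\<^sub>R (f x + g x)) powr m + norm ((1/2) *\<^sub>R (f x - g x)) powr m \<partial>lebesgue_on \<Omega>)
      \<le> (\<integral>x. (norm (f x) powr m + norm (g x) powr m) / 2 \<partial>lebesgue_on \<Omega>)"
    using i clarkson_pointwise[OF m] by (intro integral_mono Bochner_Integration.integrable_add) auto
  then show ?thesis
    unfolding Lnorm_powr[OF m1(2)] using i
    by (subst (asm) Bochner_Integration.integral_add) (simp_all del: norm_scaleR)
qed

text \<open>A substitute for Hoelder's inequality: integrated with \<tau> near a mean value of x, it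
  gives the comparison of L^s with L^m up to a constant. It serves both the inclusion of Lebesgue
  spaces and Morrey's estimate.\<close>

lemma powr_le_threshold:
  fixes x \<tau> :: real
  assumes "0 \<le> x" "0 < \<tau>" "0 < s" "s \<le> m"
  shows "x powr s \<le> \<tau> powr s + \<tau> powr (s - m) * x powr m"
proof (cases "x \<le> \<tau>")
  case True
  then have "x powr s \<le> \<tau> powr s" using assms by (intro powr_mono2) auto
  then show ?thesis by (simp add: add_increasing2)
next
  case False
  then have "x powr s = x powr (s - m) * x powr m" by (simp add: powr_add[symmetric])
  also have "\<dots> \<le> \<tau> powr (s - m) * x powr m"
    using False assms by (intro mult_right_mono powr_mono2') auto
  finally show ?thesis by (simp add: add_increasing)
qed

lemma continuous_on_norm_powr:
  fixes f :: "'a::topological_space \<Rightarrow> 'b::real_normed_vector"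
  shows "continuous_on S f \<Longrightarrow> m > 0 \<Longrightarrow> continuous_on S (\<lambda>x. norm (f x) powr m)"
  by (rule continuous_on_powr') (auto intro: continuous_on_norm)

section \<open>Lebesgue spaces on sets of finite measure\<close>

context
  fixes \<Omega> :: "'a::euclidean_space set"
  assumes \<Omega>m: "\<Omega> \<in> lmeasurable"
begin

lemma integrable_const_lebesgue_on: "integrable (lebesgue_on \<Omega>) (\<lambda>x. c :: real)"
proof -
  interpret finite_measure "lebesgue_on \<Omega>" using \<Omega>m by (rule finite_measure_lebesgue_on)
  show ?thesis by simp
qed

lemma Lspace_mono:
  assumes "0 < s" "s \<le> m" and f: "f \<in> Lspace \<Omega> m"
  shows "f \<in> Lspace \<Omega> s"
proof (rule Lspace_bound)
  show "integrable (lebesgue_on \<Omega>) (\<lambda>x. 1 + norm (f x) powr m)"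
    using integrable_const_lebesgue_on Lspace_integrable[OF f]
    by (intro Bochner_Integration.integrable_add)
  show "AE x in lebesgue_on \<Omega>. norm (f x) powr s \<le> 1 + norm (f x) powr m"
    using powr_le_threshold[of "norm (f _)" 1 s m] assms by (intro AE_I2) simp
qed (use Lspace_measurable[OF f] in simp)

text \<open>Integrate the threshold inequality with \<tau> just above the L^m norm: the first term
  contributes the measure of \<Omega> to the constant, the second the summand 1.\<close>

lemma Lnorm_le_Lnorm:
  assumes s: "0 < s" "s \<le> m" and f: "f \<in> Lspace \<Omega> m"
  shows "Lnorm \<Omega> (ereal s) f \<le> (measure lebesgue \<Omega> + 1) powr (1 / s) * Lnorm \<Omega> (ereal m) f"
proof -
  let ?C = "measure lebesgue \<Omega> + 1"
  have C: "?C > 0" by (simp add: add_nonneg_pos)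
  have bound: "Lnorm \<Omega> (ereal s) f \<le> ?C powr (1 / s) * \<tau>"
    if \<tau>: "0 < \<tau>" "Lnorm \<Omega> (ereal m) f \<le> \<tau>" for \<tau>
  proof (rule Lnorm_leI)
    have "(\<integral>x. norm (f x) powr s \<partial>lebesgue_on \<Omega>) \<le>
        (\<integral>x. \<tau> powr s + \<tau> powr (s - m) * norm (f x) powr m \<partial>lebesgue_on \<Omega>)"
      using powr_le_threshold[OF _ \<tau>(1) s] integrable_const_lebesgue_on Lspace_integrable[OF f]
        Lspace_integrable[OF Lspace_mono[OF s f]]
      by (intro integral_mono Bochner_Integration.integrable_add) auto
    also have "\<dots> = measure lebesgue \<Omega> * \<tau> powr s
        + \<tau> powr (s - m) * (\<integral>x. norm (f x) powr m \<partial>lebesgue_on \<Omega>)"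
      using integrable_const_lebesgue_on Lspace_integrable[OF f] \<Omega>m
      by (subst Bochner_Integration.integral_add) (auto simp: measure_restrict_space fmeasurableD)
    also have "(\<integral>x. norm (f x) powr m \<partial>lebesgue_on \<Omega>) \<le> \<tau> powr m"
      using Lnorm_powr[of m \<Omega> f, symmetric] s \<tau> Lnorm_nonneg[of \<Omega> m f] by (auto intro: powr_mono2)
    also have "measure lebesgue \<Omega> * \<tau> powr s + \<tau> powr (s - m) * \<tau> powr m = ?C * \<tau> powr s"
      using \<tau> by (simp add: powr_add[symmetric] algebra_simps)
    also have "\<dots> = (?C powr (1 / s) * \<tau>) powr s"
      using s C by (simp add: powr_mult powr_powr)
    finally show "(\<integral>x. norm (f x) powr s \<partial>lebesgue_on \<Omega>) \<le> (?C powr (1 / s) * \<tau>) powr s"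
      by (simp add: mult_left_mono)
  qed (use s \<tau> in auto)
  show ?thesis
  proof (rule field_le_epsilon)
    fix e :: real assume e: "e > 0"
    define d where "d = e / ?C powr (1 / s)"
    have "d > 0" using e C by (simp add: d_def)
    then have "Lnorm \<Omega> (ereal s) f \<le> ?C powr (1 / s) * (Lnorm \<Omega> (ereal m) f + d)"
      using Lnorm_nonneg[of \<Omega> m f] by (intro bound) auto
    also have "\<dots> = ?C powr (1 / s) * Lnorm \<Omega> (ereal m) f + e"
      using C by (simp add: d_def distrib_left)
    finally show "Lnorm \<Omega> (ereal s) f \<le> ?C powr (1 / s) * Lnorm \<Omega> (ereal m) f + e" .
  qed
qed

lemma integral_norm_le_Lnorm:
  assumes "m \<ge> 1" "f \<in> Lspace \<Omega> m"
  shows "(\<integral>x. norm (f x) \<partial>lebesgue_on \<Omega>) \<le> (measure lebesgue \<Omega> + 1) * Lnorm \<Omega> (ereal m) f"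
  using Lnorm_le_Lnorm[of 1 m f] assms
  by (simp add: Lnorm_finite powr_one' integral_nonneg_AE)

lemma Lspace_imp_integrable:
  assumes "m \<ge> 1" "f \<in> Lspace \<Omega> m"
  shows "integrable (lebesgue_on \<Omega>) f"
proof -
  have f: "f \<in> Lspace \<Omega> 1" using Lspace_mono[of 1 m f] assms by simp
  show ?thesis
    using Lspace_integrable[OF f]
    by (intro integrable_norm_cancel[OF _ Lspace_measurable[OF f]]) simp
qed

text \<open>Riesz-Fischer: a fast subsequence has summable L^1 increments, hence converges almost
  everywhere, and Fatou's lemma bounds the distance of the whole sequence to that limit.\<close>

theorem Lspace_complete:
  fixes f :: "nat \<Rightarrow> 'a \<Rightarrow> 'b::euclidean_space"
  assumes m: "m \<ge> 1" and f: "\<And>n. f n \<in> Lspace \<Omega> m"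
    and cauchy: "\<And>e. e > 0 \<Longrightarrow> \<exists>N. \<forall>i\<ge>N. \<forall>j\<ge>N. Lnorm \<Omega> (ereal m) (\<lambda>x. f i x - f j x) \<le> e"
  obtains g where "g \<in> Lspace \<Omega> m" "(\<lambda>n. Lnorm \<Omega> (ereal m) (\<lambda>x. f n x - g x)) \<longlonglongrightarrow> 0"
proof -
  let ?M = "lebesgue_on \<Omega>"
  have [measurable]: "f n \<in> borel_measurable ?M" for n using f by (rule Lspace_measurable)
  define C where "C = measure lebesgue \<Omega> + 1"
  have C: "C > 0" by (simp add: C_def add_nonneg_pos)
  have "\<forall>n. \<exists>N. \<forall>i\<ge>N. \<forall>j\<ge>N. Lnorm \<Omega> (ereal m) (\<lambda>x. f i x - f j x) \<le> (1/2) ^ n"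
    by (intro allI cauchy) simp
  then obtain N where N: "\<And>n i j. i \<ge> N n \<Longrightarrow> j \<ge> N n \<Longrightarrow> Lnorm \<Omega> (ereal m) (\<lambda>x. f i x - f j x) \<le> (1/2) ^ n"
    by metis
  \<comment> \<open>The sum makes \<open>r\<close> monotone and at least \<open>N n\<close>; the
    summand \<open>n\<close> makes it unbounded.\<close>
  define r where "r n = (\<Sum>i\<le>n. N i) + n" for n
  have rN: "r n \<ge> N n" for n
    using member_le_sum[of n "{..n}" N] by (simp add: r_def)
  have rmono: "r n \<le> r (Suc n)" for n by (simp add: r_def)
  have rge: "r n \<ge> n" for n by (simp add: r_def)
  define d where "d n x = norm (f (r (Suc n)) x - f (r n) x)" for n x
  have [measurable]: "d n \<in> borel_measurable ?M" for n unfolding d_def by measurable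
  have dI: "(\<integral>\<^sup>+x. ennreal (d n x) \<partial>?M) \<le> ennreal (C * (1/2) ^ n)" for n
  proof -
    have L: "(\<lambda>x. f (r (Suc n)) x - f (r n) x) \<in> Lspace \<Omega> m" using m f by (intro Lspace_diff)
    have "(\<integral>\<^sup>+x. ennreal (d n x) \<partial>?M) = ennreal (\<integral>x. d n x \<partial>?M)"
      unfolding d_def using Lspace_imp_integrable[OF m L] by (intro nn_integral_eq_integral) auto
    also have "(\<integral>x. d n x \<partial>?M) \<le> C * Lnorm \<Omega> (ereal m) (\<lambda>x. f (r (Suc n)) x - f (r n) x)"
      unfolding d_def C_def by (rule integral_norm_le_Lnorm[OF m L])
    also have "\<dots> \<le> C * (1/2) ^ n"
      using C rN[of n] rmono[of n] by (intro mult_left_mono N) auto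
    finally show ?thesis by (simp add: ennreal_leI)
  qed
  have "(\<integral>\<^sup>+x. (\<Sum>n. ennreal (d n x)) \<partial>?M) = (\<Sum>n. \<integral>\<^sup>+x. ennreal (d n x) \<partial>?M)"
    by (intro nn_integral_suminf) auto
  also have "\<dots> \<le> (\<Sum>n. ennreal (C * (1/2) ^ n))" by (intro suminf_le dI) auto
  also have "\<dots> = ennreal (\<Sum>n. C * (1/2) ^ n)"
    using C by (intro suminf_ennreal2) (auto intro!: summable_mult summable_geometric)
  also have "\<dots> < \<infinity>" by simp
  finally have "AE x in ?M. (\<Sum>n. ennreal (d n x)) \<noteq> \<infinity>"
    by (intro nn_integral_PInf_AE) auto
  then have conv: "AE x in ?M. convergent (\<lambda>n. f (r n) x)"
  proof eventually_elim
    case (elim x)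
    then have "summable (\<lambda>n. d n x)"
      by (intro summable_suminf_not_top) (auto simp: d_def)
    then have "summable (\<lambda>n. f (r (Suc n)) x - f (r n) x)"
      unfolding d_def by (rule summable_norm_cancel)
    then have "convergent (\<lambda>n. \<Sum>k<n. f (r (Suc k)) x - f (r k) x)"
      by (simp add: summable_iff_convergent)
    then have "convergent (\<lambda>n. f (r n) x - f (r 0) x)" by (simp only: sum_lessThan_telescope[of "\<lambda>n. f (r n) x"])
    then show "convergent (\<lambda>n. f (r n) x)"
      using convergent_add[OF _ convergent_const[of "f (r 0) x"]] by fastforce
  qed
  define g where "g x = lim (\<lambda>n. f (r n) x)" for x
  have [measurable]: "g \<in> borel_measurable ?M" unfolding g_def by measurable
  have lim: "AE x in ?M. (\<lambda>n. f (r n) x) \<longlonglongrightarrow> g x"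
    using conv by eventually_elim (simp add: g_def convergent_LIMSEQ_iff)
  \<comment> \<open>The index \<open>k\<close> is fixed and only the second one runs along the
    subsequence, so the estimate holds for every large \<open>k\<close>.\<close>
  have fatou: "(\<integral>\<^sup>+x. ennreal (norm (f k x - g x) powr m) \<partial>?M) \<le> ennreal (e powr m)"
    if e: "0 < e" and K: "\<And>i j. i \<ge> K \<Longrightarrow> j \<ge> K \<Longrightarrow> Lnorm \<Omega> (ereal m) (\<lambda>x. f i x - f j x) \<le> e" and k: "k \<ge> K" for e K k
  proof -
    have "(\<integral>\<^sup>+x. ennreal (norm (f k x - g x) powr m) \<partial>?M)
        = (\<integral>\<^sup>+x. liminf (\<lambda>n. ennreal (norm (f k x - f (r n) x) powr m)) \<partial>?M)"
    proof (rule nn_integral_cong_AE)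
      show "AE x in ?M. ennreal (norm (f k x - g x) powr m) = liminf (\<lambda>n. ennreal (norm (f k x - f (r n) x) powr m))"
        using lim
      proof eventually_elim
        case (elim x)
        then have "(\<lambda>n. ennreal (norm (f k x - f (r n) x) powr m)) \<longlonglongrightarrow> ennreal (norm (f k x - g x) powr m)"
          using m by (intro tendsto_ennrealI tendsto_powr2 tendsto_intros) auto
        then show ?case by (rule lim_imp_Liminf[OF trivial_limit_sequentially, symmetric])
      qed
    qed
    also have "\<dots> \<le> liminf (\<lambda>n. \<integral>\<^sup>+x. ennreal (norm (f k x - f (r n) x) powr m) \<partial>?M)"
      by (rule nn_integral_liminf) auto
    also have "\<dots> \<le> ennreal (e powr m)"
    proof (rule Liminf_le)
      show "\<forall>\<^sub>F n in sequentially. (\<integral>\<^sup>+x. ennreal (norm (f k x - f (r n) x) powr m) \<partial>?M) \<le> ennreal (e powr m)"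
        using eventually_ge_at_top[of K]
      proof eventually_elim
        case (elim n)
        have L: "(\<lambda>x. f k x - f (r n) x) \<in> Lspace \<Omega> m" using m f by (intro Lspace_diff)
        have "(\<integral>\<^sup>+x. ennreal (norm (f k x - f (r n) x) powr m) \<partial>?M)
            = ennreal (\<integral>x. norm (f k x - f (r n) x) powr m \<partial>?M)"
          using Lspace_integrable[OF L] by (intro nn_integral_eq_integral) auto
        also have "\<dots> = ennreal (Lnorm \<Omega> (ereal m) (\<lambda>x. f k x - f (r n) x) powr m)"
          using m by (simp add: Lnorm_powr)
        also have "\<dots> \<le> ennreal (e powr m)"
          using elim k rge[of n] m by (intro ennreal_leI powr_mono2 K) (auto simp: Lnorm_nonneg)
        finally show ?case .
      qed
    qed simp
    finally show ?thesis .
  qed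
  obtain K1 where K1: "\<And>i j. i \<ge> K1 \<Longrightarrow> j \<ge> K1 \<Longrightarrow> Lnorm \<Omega> (ereal m) (\<lambda>x. f i x - f j x) \<le> 1"
    using cauchy[of 1] by auto
  have "integrable ?M (\<lambda>x. norm (f K1 x - g x) powr m)"
  proof (rule integrableI_bounded)
    have "(\<integral>\<^sup>+x. ennreal (norm (norm (f K1 x - g x) powr m)) \<partial>?M) \<le> ennreal (1 powr m)"
      using fatou[of 1 K1 K1] K1 by simp
    also have "\<dots> < \<infinity>" by simp
    finally show "(\<integral>\<^sup>+x. ennreal (norm (norm (f K1 x - g x) powr m)) \<partial>?M) < \<infinity>" .
  qed measurable
  then have "(\<lambda>x. f K1 x - g x) \<in> Lspace \<Omega> m" by (simp add: Lspace_def)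
  from Lspace_diff[OF m f[of K1] this] have g: "g \<in> Lspace \<Omega> m" by simp
  have "(\<lambda>n. Lnorm \<Omega> (ereal m) (\<lambda>x. f n x - g x)) \<longlonglongrightarrow> 0"
  proof (rule LIMSEQ_I)
    fix e :: real assume e: "e > 0"
    then obtain K where K: "\<And>i j. i \<ge> K \<Longrightarrow> j \<ge> K \<Longrightarrow> Lnorm \<Omega> (ereal m) (\<lambda>x. f i x - f j x) \<le> e / 2"
      using cauchy[of "e / 2"] by auto
    have "Lnorm \<Omega> (ereal m) (\<lambda>x. f k x - g x) \<le> e / 2" if k: "k \<ge> K" for k
    proof (rule Lnorm_leI)
      have "ennreal (\<integral>x. norm (f k x - g x) powr m \<partial>?M) = (\<integral>\<^sup>+x. ennreal (norm (f k x - g x) powr m) \<partial>?M)"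
        using Lspace_integrable[OF Lspace_diff[OF m f[of k] g]]
        by (intro nn_integral_eq_integral[symmetric]) auto
      also have "\<dots> \<le> ennreal ((e / 2) powr m)" using fatou[of "e / 2" K k] e K k by simp
      finally show "(\<integral>x. norm (f k x - g x) powr m \<partial>?M) \<le> (e / 2) powr m" by simp
    qed (use m e in auto)
    have "norm (Lnorm \<Omega> (ereal m) (\<lambda>x. f k x - g x) - 0) < e" if "k \<ge> K" for k
      using that[THEN \<open>\<And>k. k \<ge> K \<Longrightarrow> Lnorm \<Omega> (ereal m) (\<lambda>x. f k x - g x) \<le> e / 2\<close>] e
        Lnorm_nonneg[of \<Omega> m "\<lambda>x. f k x - g x"] by simp
    then show "\<exists>no. \<forall>n\<ge>no. norm (Lnorm \<Omega> (ereal m) (\<lambda>x. f n x - g x) - 0) < e"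
      by blast
  qed
  with g show ?thesis by (rule that)
qed

end

section \<open>Morrey's inequality\<close>

text \<open>The cube averages \<open>g(t)\<close> of \<open>z \<mapsto> \<phi>(x + t z)\<close> interpolate between \<open>\<phi>(x)\<close> and the average of
  \<open>\<phi>\<close> over a cube at \<open>x\<close>, and \<open>\<bar>g'(t)\<bar>\<close> is at most a multiple of \<open>t powr (- DIM / m)\<close>, which is
  integrable at \<open>0\<close> since \<open>m > DIM\<close>.\<close>
lemma morrey_cube_average:
  fixes \<phi> :: "'a::euclidean_space \<Rightarrow> real" and m K R :: real
  defines "\<alpha> \<equiv> 1 - DIM('a) / m"
  assumes d: "\<And>x. (\<phi> has_derivative (\<lambda>v. G x \<bullet> v)) (at x)" and G: "continuous_on UNIV G"
    and m: "m > DIM('a)" and K: "K > 0"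
    and GK: "\<And>a b. integral (cbox a b) (\<lambda>x. norm (G x) powr m) \<le> K"
    and R: "\<And>z. z \<in> cbox a b \<Longrightarrow> norm z \<le> R" and c: "0 < measure lborel (cbox a b)"
  shows "\<bar>integral (cbox a b) (\<lambda>z. \<phi> (x + z)) - measure lborel (cbox a b) * \<phi> x\<bar>
    \<le> 2 * R * measure lborel (cbox a b) powr (1 - 1 / m) * K powr (1 / m) / \<alpha>"
proof -
  define c where "c = measure lborel (cbox a b)"
  have c0: "c > 0" using assms by (simp add: c_def)
  have m1: "m > 1" "m > 0" using m DIM_ge_Suc0[where 'a='a] by linarith+
  have \<alpha>: "\<alpha> > 0" using m m1 by (simp add: \<alpha>_def)
  have R0: "R \<ge> 0"
  proof -
    have "cbox a b \<noteq> {}" using c by auto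
    then obtain z where "z \<in> cbox a b" by blast
    then show ?thesis using R[of z] norm_ge_zero[of z] by linarith
  qed
  have c\<phi>: "continuous_on S \<phi>" for S
    using d by (meson continuous_at_imp_continuous_on has_derivative_continuous)
  have cG: "continuous_on S (\<lambda>z. G (x + t *\<^sub>R z))" for S t
    by (intro continuous_on_compose2[OF G] continuous_intros) auto
  define g where "g t = integral (cbox a b) (\<lambda>z. \<phi> (x + t *\<^sub>R z))" for t
  define g' where "g' t = integral (cbox a b) (\<lambda>z. G (x + t *\<^sub>R z) \<bullet> z)" for t
  have dg: "(g has_real_derivative g' t) (at t)" for t
  proof -
    have "((\<lambda>t. integral (cbox a b) (\<lambda>z. \<phi> (x + t *\<^sub>R z))) has_field_derivative
      integral (cbox a b) (\<lambda>z. G (x + t *\<^sub>R z) \<bullet> z)) (at t within UNIV)"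
    proof (rule leibniz_rule_field_derivative)
      fix t z
      have "((\<lambda>t. \<phi> (x + t *\<^sub>R z)) has_derivative (\<lambda>s. G (x + t *\<^sub>R z) \<bullet> (s *\<^sub>R z))) (at t)"
        by (rule has_derivative_compose[OF _ d, of "\<lambda>t. x + t *\<^sub>R z" "\<lambda>s. s *\<^sub>R z"])
          (auto intro!: derivative_eq_intros)
      then show "((\<lambda>t. \<phi> (x + t *\<^sub>R z)) has_real_derivative G (x + t *\<^sub>R z) \<bullet> z) (at t within UNIV)"
        by (simp add: has_field_derivative_def mult_commute_abs)
      show "(\<lambda>z. \<phi> (x + t *\<^sub>R z)) integrable_on cbox a b"
        by (intro integrable_continuous continuous_on_compose2[OF c\<phi>[of UNIV]] continuous_intros) auto
    next
      show "continuous_on (UNIV \<times> cbox a b) (\<lambda>(t, z). G (x + t *\<^sub>R z) \<bullet> z)"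
        unfolding case_prod_beta
        by (intro continuous_intros continuous_on_compose2[OF G]) auto
    qed auto
    then show ?thesis by (simp add: g_def[abs_def] g'_def)
  qed
  define B where "B = 2 * R * c powr (1 - 1 / m) * K powr (1 / m)"
  have g'B: "\<bar>g' t\<bar> \<le> B * t powr (\<alpha> - 1)" if t: "t > 0" for t
  proof -
    \<comment> \<open>This \<tau> is the m-th root of a bound for the mean of
      \<open>norm (G (x + t *\<^sub>R z)) powr m\<close> over the cube; with it both terms of the
      threshold inequality integrate to at most \<open>c * \<tau>\<close>.\<close>
    define \<tau> where "\<tau> = (K / (c * t ^ DIM('a))) powr (1 / m)"
    have \<tau>: "\<tau> > 0" using K c0 t by (simp add: \<tau>_def)
    have \<tau>m: "\<tau> powr m = K / (c * t ^ DIM('a))"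
      using K c0 t m1 by (simp add: \<tau>_def powr_powr)
    have cn: "continuous_on S (\<lambda>z. norm (G (x + t *\<^sub>R z)) powr m)" for S
      using m1 by (intro continuous_on_norm_powr cG)
    have cn': "continuous_on S (\<lambda>z. norm (G z) powr m)" for S
      using m1 by (intro continuous_on_norm_powr continuous_on_subset[OF G]) auto
    \<comment> \<open>Substituting y = x + t z costs the factor t^(-DIM). The hypothesis
      \<open>GK\<close> holds for all boxes, so it bounds the integral over the moving one
      uniformly.\<close>
    have scale: "integral (cbox a b) (\<lambda>z. norm (G (x + t *\<^sub>R z)) powr m)
       = integral (cbox (t *\<^sub>R a + x) (t *\<^sub>R b + x)) (\<lambda>z. norm (G z) powr m) / t ^ DIM('a)"
    proof (rule integral_unique)
      have "((\<lambda>z. norm (G z) powr m) has_integral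
          integral (cbox (t *\<^sub>R a + x) (t *\<^sub>R b + x)) (\<lambda>z. norm (G z) powr m))
          (cbox (t *\<^sub>R a + x) (t *\<^sub>R b + x))"
        using cn' by (intro integrable_integral integrable_continuous)
      from has_integral_affinity'[OF this t, of x] t
      show "((\<lambda>z. norm (G (x + t *\<^sub>R z)) powr m) has_integral
          integral (cbox (t *\<^sub>R a + x) (t *\<^sub>R b + x)) (\<lambda>z. norm (G z) powr m) / t ^ DIM('a)) (cbox a b)"
        by (simp add: add.commute divide_inverse mult.commute)
    qed
    have "\<bar>g' t\<bar> \<le> integral (cbox a b) (\<lambda>z. R * (\<tau> + \<tau> powr (1 - m) * norm (G (x + t *\<^sub>R z)) powr m))"
      unfolding g'_def real_norm_def[symmetric]
    proof (rule integral_norm_bound_integral)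
      show "(\<lambda>z. G (x + t *\<^sub>R z) \<bullet> z) integrable_on cbox a b"
        by (intro integrable_continuous continuous_intros cG)
      show "(\<lambda>z. R * (\<tau> + \<tau> powr (1 - m) * norm (G (x + t *\<^sub>R z)) powr m)) integrable_on cbox a b"
        by (intro integrable_continuous continuous_intros cn)
      fix z assume z: "z \<in> cbox a b"
      have "norm (G (x + t *\<^sub>R z) \<bullet> z) \<le> norm (G (x + t *\<^sub>R z)) * norm z"
        by (simp add: Cauchy_Schwarz_ineq2)
      also have "\<dots> \<le> (\<tau> + \<tau> powr (1 - m) * norm (G (x + t *\<^sub>R z)) powr m) * R"
        using powr_le_threshold[of "norm (G (x + t *\<^sub>R z))" \<tau> 1 m] \<tau> m1 R[OF z]
        by (intro mult_mono) auto
      finally show "norm (G (x + t *\<^sub>R z) \<bullet> z) \<le> R * (\<tau> + \<tau> powr (1 - m) * norm (G (x + t *\<^sub>R z)) powr m)"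
        by (simp add: mult.commute)
    qed
    also have "\<dots> = R * (c * \<tau> + \<tau> powr (1 - m) * integral (cbox a b) (\<lambda>z. norm (G (x + t *\<^sub>R z)) powr m))"
      using cn by (simp add: integral_add integrable_continuous continuous_intros c_def)
    also have "\<dots> \<le> R * (c * \<tau> + \<tau> powr (1 - m) * (K / t ^ DIM('a)))"
      unfolding scale using GK t R0
      by (intro mult_left_mono add_left_mono divide_right_mono) auto
    also have "K / t ^ DIM('a) = c * \<tau> powr m" using c0 t by (simp add: \<tau>m)
    also have "\<tau> powr (1 - m) * (c * \<tau> powr m) = c * \<tau>"
      using \<tau> by (simp add: powr_add[symmetric] mult.left_commute)
    also have "R * (c * \<tau> + c * \<tau>) = 2 * R * (c * \<tau>)" by simp
    also have "c * \<tau> = c powr (1 - 1 / m) * K powr (1 / m) * t powr (\<alpha> - 1)"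
    proof -
      have "(t ^ DIM('a)) powr (1 / m) = t powr (DIM('a) / m)"
        using t by (simp add: powr_realpow[symmetric] powr_powr)
      then have "\<tau> = K powr (1 / m) / (c powr (1 / m) * t powr (DIM('a) / m))"
        using K c0 t by (simp add: \<tau>_def powr_divide powr_mult)
      moreover have "c powr (1 - 1 / m) = c / c powr (1 / m)" using c0 by (simp add: powr_diff)
      moreover have "t powr (\<alpha> - 1) = 1 / t powr (DIM('a) / m)"
        using t by (simp add: \<alpha>_def powr_minus_divide)
      ultimately show ?thesis by simp
    qed
    finally show ?thesis by (simp add: B_def mult.assoc)
  qed
  \<comment> \<open>The derivative of \<open>B / \<alpha> * t powr \<alpha>\<close> dominates |g'|,
    so adding this function to g or to -g gives something nondecreasing. The two signs of
    \<open>s\<close> yield the two halves of the estimate.\<close>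
  have mono: "s * g 0 \<le> B / \<alpha> + s * g 1" if s: "\<bar>s\<bar> = 1" for s
  proof -
    have "B / \<alpha> * 0 powr \<alpha> + s * g 0 \<le> B / \<alpha> * 1 powr \<alpha> + s * g 1"
    proof (rule DERIV_nonneg_imp_increasing_open[where f = "\<lambda>t. B / \<alpha> * t powr \<alpha> + s * g t"])
      fix t :: real assume t: "0 < t" "t < 1"
      have "((\<lambda>t. B / \<alpha> * t powr \<alpha> + s * g t) has_real_derivative (B * t powr (\<alpha> - 1) + s * g' t)) (at t)"
        using t \<alpha> by (auto intro!: derivative_eq_intros dg)
      moreover have "B * t powr (\<alpha> - 1) + s * g' t \<ge> 0"
      proof -
        have "\<bar>s * g' t\<bar> \<le> B * t powr (\<alpha> - 1)" using g'B[OF t(1)] s by (simp add: abs_mult)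
        then show ?thesis by linarith
      qed
      ultimately show "\<exists>y. ((\<lambda>t. B / \<alpha> * t powr \<alpha> + s * g t) has_real_derivative y) (at t) \<and> y \<ge> 0"
        by blast
    next
      have "continuous_on {0..1} g"
        using dg by (meson DERIV_isCont continuous_at_imp_continuous_on)
      then show "continuous_on {0..1} (\<lambda>t. B / \<alpha> * t powr \<alpha> + s * g t)"
        using \<alpha> by (intro continuous_intros continuous_on_powr') auto
    qed simp
    then show ?thesis using \<alpha> by simp
  qed
  have "\<bar>g 1 - g 0\<bar> \<le> B / \<alpha>"
    using mono[of 1] mono[of "-1"] by simp
  then show ?thesis by (simp add: g_def B_def c_def)
qed

text \<open>Compare both values with the mean over one cube, centred at \<open>x\<close> with half
  side \<rho> = |x - y|. Relative to either point the points of the cube have norm at most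
  \<open>2 * n * \<rho>\<close>. The cube estimate gives the factor 2 * (2 n), and two comparisons
  make it 8 n.\<close>

lemma morrey_holder:
  fixes \<phi> :: "'a::euclidean_space \<Rightarrow> real" and m L :: real
  defines "\<alpha> \<equiv> 1 - DIM('a) / m"
  assumes d: "\<And>x. (\<phi> has_derivative (\<lambda>v. G x \<bullet> v)) (at x)" and G: "continuous_on UNIV G"
    and m: "m > DIM('a)" and L: "L > 0"
    and GK: "\<And>a b. integral (cbox a b) (\<lambda>x. norm (G x) powr m) \<le> L powr m"
  shows "\<bar>\<phi> x - \<phi> y\<bar> \<le> 8 * DIM('a) / \<alpha> * L * norm (x - y) powr \<alpha>"
proof (cases "x = y")
  case False
  define \<rho> where "\<rho> = norm (x - y)"
  have \<rho>: "\<rho> > 0" using False by (simp add: \<rho>_def)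
  have m1: "m > 1" "m > 0" using m DIM_ge_Suc0[where 'a='a] by linarith+
  have \<alpha>: "\<alpha> > 0" using m m1 by (simp add: \<alpha>_def)
  define n where "n = real DIM('a)"
  have n: "n \<ge> 1" using DIM_ge_Suc0[where 'a='a] by (simp add: n_def)
  define c where "c = (2 * \<rho>) ^ DIM('a)"
  have c: "c > 0" using \<rho> by (simp add: c_def)
  define I where "I = integral (cbox (x - \<rho> *\<^sub>R One) (x + \<rho> *\<^sub>R One)) \<phi>"
  define B where "B = 2 * (2 * n * \<rho>) * c powr (1 - 1 / m) * L / \<alpha>"
  have av: "\<bar>I - c * \<phi> w\<bar> \<le> B" if w: "w = x \<or> w = y" for w
  proof -
    define a where "a = x - \<rho> *\<^sub>R One - w"
    define b where "b = x + \<rho> *\<^sub>R One - w"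
    have xw: "norm (x - w) \<le> \<rho>" using w by (auto simp: \<rho>_def)
    have meas: "measure lborel (cbox a b) = c"
      using \<rho> by (simp add: a_def b_def c_def content_cbox inner_simps algebra_simps)
    have "\<bar>integral (cbox a b) (\<lambda>z. \<phi> (w + z)) - measure lborel (cbox a b) * \<phi> w\<bar>
      \<le> 2 * (2 * n * \<rho>) * measure lborel (cbox a b) powr (1 - 1 / m) * (L powr m) powr (1 / m) / (1 - DIM('a) / m)"
    proof (rule morrey_cube_average[OF d G m _ GK])
      fix z assume z: "z \<in> cbox a b"
      have "norm z \<le> (\<Sum>i\<in>Basis. \<bar>z \<bullet> i\<bar>)" by (rule norm_le_l1)
      also have "\<dots> \<le> (\<Sum>i\<in>(Basis :: 'a set). 2 * \<rho>)"
      proof (rule sum_mono)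
        fix i :: 'a assume i: "i \<in> Basis"
        then have "\<bar>(x - w) \<bullet> i\<bar> \<le> \<rho>" using xw Basis_le_norm order_trans by blast
        moreover have "(x - w) \<bullet> i - \<rho> \<le> z \<bullet> i" "z \<bullet> i \<le> (x - w) \<bullet> i + \<rho>"
          using z i by (auto simp: mem_box a_def b_def inner_simps)
        ultimately show "\<bar>z \<bullet> i\<bar> \<le> 2 * \<rho>" by linarith
      qed
      finally show "norm z \<le> 2 * n * \<rho>" by (simp add: n_def mult_ac)
    qed (use L meas c in auto)
    moreover have "integral (cbox a b) (\<lambda>z. \<phi> (w + z)) = I"
      using integral_shift_cbox[of "x - \<rho> *\<^sub>R One" w "x + \<rho> *\<^sub>R One" \<phi>]
      by (simp add: I_def a_def b_def add.commute)
    ultimately show ?thesis using L m1 by (simp add: meas B_def \<alpha>_def powr_powr)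
  qed
  have "c * \<bar>\<phi> x - \<phi> y\<bar> = \<bar>(I - c * \<phi> y) - (I - c * \<phi> x)\<bar>"
  proof -
    have "(I - c * \<phi> y) - (I - c * \<phi> x) = c * (\<phi> x - \<phi> y)" by (simp add: algebra_simps)
    then show ?thesis using c by (simp only: abs_mult abs_of_pos)
  qed
  also have "\<dots> \<le> 2 * B" using av[OF disjI1[OF refl]] av[OF disjI2[OF refl]] by linarith
  also have "2 * B = c * (8 * n / \<alpha> * L * (\<rho> * c powr (- 1 / m)))"
  proof -
    have "c powr (1 - 1 / m) = c * c powr (- 1 / m)"
      using c powr_add[of c 1 "- 1 / m"] by simp
    then show ?thesis by (simp add: B_def)
  qed
  finally have "\<bar>\<phi> x - \<phi> y\<bar> \<le> 8 * n / \<alpha> * L * (\<rho> * c powr (- 1 / m))"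
    by (rule mult_left_le_imp_le[OF _ c])
  also have "\<dots> \<le> 8 * n / \<alpha> * L * \<rho> powr \<alpha>"
  proof (rule mult_left_mono)
    have "c powr (- 1 / m) = (2 * \<rho>) powr (- DIM('a) / m)"
      using \<rho> by (simp only: c_def powr_realpow[of "2 * \<rho>", symmetric] powr_powr mult_pos_pos zero_less_numeral) simp
    also have "\<dots> \<le> \<rho> powr (- DIM('a) / m)"
      using \<rho> m1 by (intro powr_mono2') auto
    finally have "\<rho> * c powr (- 1 / m) \<le> \<rho> * \<rho> powr (- DIM('a) / m)"
      using \<rho> by simp
    also have "\<dots> = \<rho> powr \<alpha>" using \<rho> powr_add[of \<rho> 1 "- DIM('a) / m"] by (simp add: \<alpha>_def)
    finally show "\<rho> * c powr (- 1 / m) \<le> \<rho> powr \<alpha>" .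
  qed (use n \<alpha> L in auto)
  finally show ?thesis by (simp add: n_def \<rho>_def)
qed simp

section \<open>Morrey's inequality for test functions\<close>

lemma test_function_Lspace:
  assumes \<phi>: "\<phi> \<in> test_functions \<Omega>" and \<Omega>: "\<Omega> \<in> sets lebesgue" and m: "m > 0"
  shows "\<phi> \<in> Lspace \<Omega> m" "classical_gradient \<phi> \<in> Lspace \<Omega> m"
    "integral (cbox a b) (\<lambda>x. norm (classical_gradient \<phi> x) powr m)
      \<le> Lnorm \<Omega> (ereal m) (classical_gradient \<phi>) powr m"
proof -
  let ?K = "closure {x. \<phi> x \<noteq> 0}"
  have K: "compact ?K" "?K \<subseteq> \<Omega>" using \<phi> by (auto simp: test_functions_def)
  note Kl = compact_lebesgue[OF K(1)]
  note d = test_function_derivative[OF \<phi>]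
  have 0: "\<phi> x = 0" if "x \<notin> ?K" for x using that closure_subset[of "{x. \<phi> x \<noteq> 0}"] by auto
  have 1: "classical_gradient \<phi> x = 0" if "x \<notin> ?K" for x
    by (rule classical_gradient_outside_support[OF that])
  have c: "continuous_on UNIV (\<lambda>x. norm (\<phi> x) powr m)"
    "continuous_on UNIV (\<lambda>x. norm (classical_gradient \<phi> x) powr m)"
    by (rule continuous_on_norm_powr[OF d(3) m], rule continuous_on_norm_powr[OF d(2) m])
  have i1: "integrable (lebesgue_on \<Omega>) (\<lambda>x. norm (\<phi> x) powr m)"
  proof (rule lebesgue_on_support(1)[OF K(2) Kl \<Omega>, THEN iffD2])
    show "norm (\<phi> x) powr m = 0" if "x \<notin> ?K" for x using 0[OF that] by simp
  qed (rule integrable_lebesgue_on_compact[OF K(1) c(1)])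
  have i2: "integrable (lebesgue_on \<Omega>) (\<lambda>x. norm (classical_gradient \<phi> x) powr m)"
  proof (rule lebesgue_on_support(1)[OF K(2) Kl \<Omega>, THEN iffD2])
    show "norm (classical_gradient \<phi> x) powr m = 0" if "x \<notin> ?K" for x using 1[OF that] by simp
  qed (rule integrable_lebesgue_on_compact[OF K(1) c(2)])
  show "\<phi> \<in> Lspace \<Omega> m"
    using i1 continuous_imp_measurable_on_sets_lebesgue[OF continuous_on_subset[OF d(3) subset_UNIV] \<Omega>]
    unfolding Lspace_def by blast
  show "classical_gradient \<phi> \<in> Lspace \<Omega> m"
    using i2 continuous_imp_measurable_on_sets_lebesgue[OF continuous_on_subset[OF d(2) subset_UNIV] \<Omega>]
    unfolding Lspace_def by blast
  let ?f = "\<lambda>x. norm (classical_gradient \<phi> x) powr m"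
  have ib: "integrable (lebesgue_on (cbox a b)) ?f"
    by (rule integrable_lebesgue_on_compact[OF compact_cbox c(2)])
  have "integral (cbox a b) ?f = integral\<^sup>L (lebesgue_on (cbox a b)) ?f"
    by (rule lebesgue_integral_eq_integral[OF ib, symmetric]) simp
  also have "\<dots> = (\<integral>x. indicator (cbox a b) x *\<^sub>R ?f x \<partial>lebesgue)"
    by (simp add: integral_restrict_space)
  also have "\<dots> \<le> (\<integral>x. indicator \<Omega> x *\<^sub>R ?f x \<partial>lebesgue)"
  proof (rule integral_mono)
    show "integrable lebesgue (\<lambda>x. indicator (cbox a b) x *\<^sub>R ?f x)"
      using ib by (simp add: integrable_restrict_space)
    show "integrable lebesgue (\<lambda>x. indicator \<Omega> x *\<^sub>R ?f x)"
      using i2 \<Omega> by (simp add: integrable_restrict_space)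
    fix x
    \<comment> \<open>The part of the box outside \<Omega> contributes nothing, since the gradient
      vanishes there.\<close>
    have "?f x = 0" if "x \<notin> \<Omega>" using 1[of x] that K(2) m by auto
    then show "indicator (cbox a b) x *\<^sub>R ?f x \<le> indicator \<Omega> x *\<^sub>R ?f x"
      by (auto simp: indicator_def)
  qed
  also have "\<dots> = integral\<^sup>L (lebesgue_on \<Omega>) ?f" using \<Omega> by (simp add: integral_restrict_space)
  finally show "integral (cbox a b) ?f \<le> Lnorm \<Omega> (ereal m) (classical_gradient \<phi>) powr m"
    using m by (simp add: Lnorm_powr)
qed

definition morrey_const :: "'a::euclidean_space itself \<Rightarrow> real \<Rightarrow> real" where
  "morrey_const _ m = 8 * DIM('a) / (1 - DIM('a) / m)"

lemma test_function_holder: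
  fixes \<Omega> :: "'a::euclidean_space set" and m :: real
  assumes \<phi>: "\<phi> \<in> test_functions \<Omega>" and \<Omega>: "\<Omega> \<in> sets lebesgue" and m: "m > DIM('a)"
  shows "\<bar>\<phi> x - \<phi> y\<bar> \<le> morrey_const TYPE('a) m * Lnorm \<Omega> (ereal m) (classical_gradient \<phi>)
    * norm (x - y) powr (1 - DIM('a) / m)"
proof (rule field_le_epsilon)
  fix e :: real assume e: "e > 0"
  have m0: "m > 0" using m of_nat_0_le_iff[of "DIM('a)", where 'a=real] by linarith
  define \<alpha> where "\<alpha> = 1 - DIM('a) / m"
  have \<alpha>: "\<alpha> > 0" using m m0 by (simp add: \<alpha>_def)
  define C where "C = 8 * DIM('a) / \<alpha> * norm (x - y) powr \<alpha>"
  have C: "C \<ge> 0" using \<alpha> by (simp add: C_def)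
  \<comment> \<open>\<open>morrey_holder\<close> wants \<open>L > 0\<close>, so the norm is enlarged
    by an amount that costs at most \<open>e\<close>; the summand 1 covers
    \<open>C = 0\<close>.\<close>
  define L where "L = Lnorm \<Omega> (ereal m) (classical_gradient \<phi>) + e / (C + 1)"
  have L: "Lnorm \<Omega> (ereal m) (classical_gradient \<phi>) \<le> L" "L > 0"
    using e C Lnorm_nonneg[of \<Omega> m "classical_gradient \<phi>"] by (auto simp: L_def add_nonneg_pos)
  have "\<bar>\<phi> x - \<phi> y\<bar> \<le> 8 * DIM('a) / (1 - DIM('a) / m) * L * norm (x - y) powr (1 - DIM('a) / m)"
  proof (rule morrey_holder[OF test_function_derivative(1,2)[OF \<phi>] m L(2)])
    fix a b
    show "integral (cbox a b) (\<lambda>x. norm (classical_gradient \<phi> x) powr m) \<le> L powr m"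
      using test_function_Lspace(3)[OF \<phi> \<Omega> m0, of a b] L Lnorm_nonneg m0
      by (meson order_trans powr_mono2 less_imp_le)
  qed
  also have "\<dots> = C * L" by (simp add: C_def \<alpha>_def)
  also have "\<dots> = C * Lnorm \<Omega> (ereal m) (classical_gradient \<phi>) + C * e / (C + 1)"
    by (simp add: L_def distrib_left)
  also have "C * e / (C + 1) \<le> e" using C e by (simp add: field_simps)
  finally show "\<bar>\<phi> x - \<phi> y\<bar> \<le> morrey_const TYPE('a) m * Lnorm \<Omega> (ereal m) (classical_gradient \<phi>)
    * norm (x - y) powr (1 - DIM('a) / m) + e"
    by (simp add: C_def \<alpha>_def morrey_const_def mult_ac)
qed

text \<open>Apply the Hoelder estimate to \<open>x\<close> and a fixed point outside the bounded set
  \<Omega>, where every test function vanishes.\<close>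

lemma test_function_sup_bound:
  fixes \<Omega> :: "'a::euclidean_space set" and m :: real
  assumes \<Omega>: "open \<Omega>" "bounded \<Omega>" and m: "m > DIM('a)"
  obtains C where "C > 0" "\<And>\<phi> x. \<phi> \<in> test_functions \<Omega> \<Longrightarrow>
    \<bar>\<phi> x\<bar> \<le> C * Lnorm \<Omega> (ereal m) (classical_gradient \<phi>)"
proof -
  have \<Omega>l: "\<Omega> \<in> sets lebesgue" using \<Omega>(1) by auto
  have m0: "m > 0" using m of_nat_0_le_iff[of "DIM('a)", where 'a=real] by linarith
  have "\<Omega> \<noteq> UNIV" using \<Omega>(2) not_bounded_UNIV by auto
  then obtain y where y: "y \<notin> \<Omega>" by blast
  obtain D where D: "D > 0" "\<And>x. x \<in> \<Omega> \<Longrightarrow> norm (x - y) \<le> D"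
    using \<Omega>(2) unfolding bounded_any_center[where a = y]
    by (metis dist_commute dist_norm less_le_trans max.cobounded1 max.cobounded2 order.trans zero_less_one)
  define C where "C = morrey_const TYPE('a) m * D powr (1 - DIM('a) / m)"
  have mc: "morrey_const TYPE('a) m > 0" using m m0 by (simp add: morrey_const_def)
  then have "C > 0" using D by (simp add: C_def)
  moreover have "\<bar>\<phi> x\<bar> \<le> C * Lnorm \<Omega> (ereal m) (classical_gradient \<phi>)"
    if \<phi>: "\<phi> \<in> test_functions \<Omega>" for \<phi> x
  proof (cases "x \<in> \<Omega>")
    case True
    have 0: "\<phi> z = 0" if "z \<notin> \<Omega>" for z
      using that \<phi> closure_subset[of "{x. \<phi> x \<noteq> 0}"] by (auto simp: test_functions_def)
    have "\<bar>\<phi> x\<bar> = \<bar>\<phi> x - \<phi> y\<bar>" using 0[OF y] by simp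
    also have "\<dots> \<le> morrey_const TYPE('a) m * Lnorm \<Omega> (ereal m) (classical_gradient \<phi>)
      * norm (x - y) powr (1 - DIM('a) / m)"
      by (rule test_function_holder[OF \<phi> \<Omega>l m])
    also have "\<dots> \<le> morrey_const TYPE('a) m * Lnorm \<Omega> (ereal m) (classical_gradient \<phi>)
      * D powr (1 - DIM('a) / m)"
      using mc D(2)[OF True] m m0
      by (intro mult_left_mono powr_mono2 mult_nonneg_nonneg Lnorm_nonneg) auto
    finally show ?thesis by (simp add: C_def mult_ac)
  next
    case False
    then have "\<phi> x = 0"
      using \<phi> closure_subset[of "{x. \<phi> x \<noteq> 0}"] by (auto simp: test_functions_def)
    then show ?thesis using \<open>C > 0\<close> by (simp add: mult_nonneg_nonneg Lnorm_nonneg)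
  qed
  ultimately show ?thesis by (rule that)
qed

section \<open>Sobolev spaces above the dimension\<close>

lemma test_functions_comb:
  assumes "\<phi> \<in> test_functions \<Omega>" "\<psi> \<in> test_functions \<Omega>"
  shows "(\<lambda>x. a * \<phi> x + b * \<psi> x) \<in> test_functions \<Omega>"
proof -
  have "smooth_on UNIV (\<lambda>x. a * \<phi> x + b * \<psi> x)"
    using assms by (auto simp: test_functions_def smooth_on_def intro!: Ck_on_add Ck_on_mult Ck_on_const)
  moreover have sub: "closure {x. a * \<phi> x + b * \<psi> x \<noteq> 0} \<subseteq> closure {x. \<phi> x \<noteq> 0} \<union> closure {x. \<psi> x \<noteq> 0}"
    unfolding closure_Un[symmetric] by (intro closure_mono) auto
  moreover have "compact (closure {x. \<phi> x \<noteq> 0} \<union> closure {x. \<psi> x \<noteq> 0})"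
    using assms by (auto simp: test_functions_def)
  ultimately show ?thesis
    using assms compact_Int_closed[of "closure {x. \<phi> x \<noteq> 0} \<union> closure {x. \<psi> x \<noteq> 0}"
        "closure {x. a * \<phi> x + b * \<psi> x \<noteq> 0}"]
    by (auto simp: test_functions_def Int_absorb1)
qed

lemma classical_gradient_comb:
  assumes "\<phi> \<in> test_functions \<Omega>" "\<psi> \<in> test_functions \<Omega>"
  shows "classical_gradient (\<lambda>x. a * \<phi> x + b * \<psi> x) x
    = a *\<^sub>R classical_gradient \<phi> x + b *\<^sub>R classical_gradient \<psi> x"
  by (rule classical_gradient_unique, rule has_derivative_eq_rhs)
    (auto intro!: derivative_eq_intros test_function_derivative(1)[OF assms(1)]
      test_function_derivative(1)[OF assms(2)] simp: inner_simps)

lemma powr_add_root_le: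
  fixes A B m :: real
  assumes "m \<ge> 1" "0 \<le> A" "0 \<le> B"
  shows "(A powr m + B powr m) powr (1 / m) \<le> A + B"
proof -
  have "(A powr m + B powr m) powr (1 / m) \<le> ((A + B) powr m) powr (1 / m)"
    using powr_add_ge[OF assms] assms by (intro powr_mono2) auto
  then show ?thesis using assms by (simp add: powr_powr)
qed

lemma le_powr_add_root:
  fixes A B m :: real
  assumes "m > 0" "0 \<le> A" "0 \<le> B"
  shows "A \<le> (A powr m + B powr m) powr (1 / m)"
proof -
  have "A = (A powr m) powr (1 / m)" using assms by (simp add: powr_powr)
  also have "\<dots> \<le> (A powr m + B powr m) powr (1 / m)" using assms by (intro powr_mono2) auto
  finally show ?thesis .
qed

text \<open>Rests on the completeness of Lebesgue measure. As \<open>weak_gradient\<close> is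
  obtained by choice, its measurability is derived from a.e. equality with a known gradient.\<close>

lemma borel_measurable_lebesgue_on_cong_AE:
  fixes f g :: "'a::euclidean_space \<Rightarrow> 'b::euclidean_space"
  assumes S: "S \<in> sets lebesgue" and f: "f \<in> borel_measurable (lebesgue_on S)"
    and ae: "AE x in lebesgue_on S. f x = g x"
  shows "g \<in> borel_measurable (lebesgue_on S)"
proof -
  have iff: "(\<lambda>x. if x \<in> S then h x else 0) \<in> borel_measurable lebesgue \<longleftrightarrow> h \<in> borel_measurable (lebesgue_on S)"
    for h :: "'a \<Rightarrow> 'b"
    using borel_measurable_if_lebesgue_on[OF S, of UNIV h] by (simp add: lebesgue_on_UNIV_eq)
  have "AE x in lebesgue. (if x \<in> S then f x else 0) = (if x \<in> S then g x else 0)"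
    using ae S by (auto simp: AE_restrict_space_iff elim!: eventually_mono)
  from borel_measurable_AE[OF _ this] show ?thesis using f iff by blast
qed

section \<open>Sobolev functions on a bounded open set and their approximation\<close>

locale bounded_open =
  fixes \<Omega> :: "'a::euclidean_space set"
  assumes open_dom: "open \<Omega>" and bounded_dom: "bounded \<Omega>"
begin

abbreviation grad :: "('a \<Rightarrow> real) \<Rightarrow> 'a \<Rightarrow> 'a" where
  "grad \<equiv> weak_gradient \<Omega>"

abbreviation L :: "real \<Rightarrow> ('a \<Rightarrow> 'b::euclidean_space) \<Rightarrow> real" where
  "L m \<equiv> Lnorm \<Omega> (ereal m)"

lemma dom_lebesgue [simp]: "\<Omega> \<in> sets lebesgue"
  using open_dom by auto

lemma dom_lmeasurable: "\<Omega> \<in> lmeasurable"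
  using open_dom bounded_dom by (simp add: lmeasurable_open)

lemma Lspace_locally_integrable:
  assumes "m \<ge> 1" "f \<in> Lspace \<Omega> m"
  shows "locally_integrable \<Omega> f"
  unfolding locally_integrable_def
  using integrable_lebesgue_on_subset[OF Lspace_imp_integrable[OF dom_lmeasurable assms]]
    compact_lebesgue by auto

lemma W1I:
  assumes "u \<in> Lspace \<Omega> m" "g \<in> Lspace \<Omega> m" "is_weak_gradient \<Omega> u g"
  shows "u \<in> W1 \<Omega> m"
  using assms by (auto simp: W1_def)

lemma grad_eq:
  assumes "g \<in> Lspace \<Omega> m" "is_weak_gradient \<Omega> u g"
  shows "AE x in lebesgue_on \<Omega>. grad u x = g x" "grad u \<in> Lspace \<Omega> m"
    "is_weak_gradient \<Omega> u (grad u)"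
proof -
  show ae: "AE x in lebesgue_on \<Omega>. grad u x = g x"
    by (rule weak_gradient_AE_eq[OF open_dom assms(2)])
  then have ae': "AE x in lebesgue_on \<Omega>. g x = grad u x" by eventually_elim simp
  show "grad u \<in> Lspace \<Omega> m"
    by (rule Lspace_cong_AE[OF assms(1) borel_measurable_lebesgue_on_cong_AE[OF dom_lebesgue
            Lspace_measurable[OF assms(1)] ae'] ae'])
  show "is_weak_gradient \<Omega> u (grad u)"
    unfolding weak_gradient_def using someI[of "is_weak_gradient \<Omega> u", OF assms(2)] .
qed

lemma W1D:
  assumes "u \<in> W1 \<Omega> m"
  shows "u \<in> Lspace \<Omega> m" "grad u \<in> Lspace \<Omega> m" "is_weak_gradient \<Omega> u (grad u)"
  using assms grad_eq by (auto simp: W1_def)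

lemma W1_comb:
  assumes m: "m \<ge> 1" and u: "u \<in> W1 \<Omega> m" and v: "v \<in> W1 \<Omega> m"
  shows "(\<lambda>x. a * u x + b * v x) \<in> W1 \<Omega> m"
    "AE x in lebesgue_on \<Omega>. grad (\<lambda>x. a * u x + b * v x) x = a *\<^sub>R grad u x + b *\<^sub>R grad v x"
proof -
  note w = is_weak_gradient_comb[OF dom_lebesgue W1D(3)[OF u] W1D(3)[OF v], of a b]
  note g = Lspace_comb[OF m W1D(2)[OF u] W1D(2)[OF v], of a b]
  show "(\<lambda>x. a * u x + b * v x) \<in> W1 \<Omega> m"
    using W1I[OF _ g w] Lspace_comb[OF m W1D(1)[OF u] W1D(1)[OF v], of a b] by simp
  show "AE x in lebesgue_on \<Omega>. grad (\<lambda>x. a * u x + b * v x) x = a *\<^sub>R grad u x + b *\<^sub>R grad v x"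
    by (rule grad_eq(1)[OF g w])
qed

lemma Lnorm_grad_comb:
  assumes m: "m \<ge> 1" and u: "u \<in> W1 \<Omega> m" and v: "v \<in> W1 \<Omega> m"
  shows "L s (grad (\<lambda>x. a * u x + b * v x)) = L s (\<lambda>x. a *\<^sub>R grad u x + b *\<^sub>R grad v x)"
  by (rule Lnorm_cong_AE[OF Lspace_measurable[OF W1D(2)[OF W1_comb(1)[OF m u v]]]
      Lspace_measurable[OF Lspace_comb[OF m W1D(2)[OF u] W1D(2)[OF v]]] W1_comb(2)[OF m u v]])

lemma test_function_W1:
  assumes "\<phi> \<in> test_functions \<Omega>" "m > 0"
  shows "\<phi> \<in> W1 \<Omega> m" "AE x in lebesgue_on \<Omega>. grad \<phi> x = classical_gradient \<phi> x"
proof -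
  note w = test_function_is_weak_gradient[OF assms(1) dom_lebesgue]
  note l = test_function_Lspace(1,2)[OF assms(1) dom_lebesgue assms(2)]
  show "\<phi> \<in> W1 \<Omega> m" by (rule W1I[OF l w])
  show "AE x in lebesgue_on \<Omega>. grad \<phi> x = classical_gradient \<phi> x" by (rule grad_eq(1)[OF l(2) w])
qed

lemma Lnorm_grad_diff_test:
  assumes m: "m \<ge> 1" and u: "u \<in> W1 \<Omega> m" and \<phi>: "\<phi> \<in> test_functions \<Omega>"
  shows "L s (grad (\<lambda>x. \<phi> x - u x)) = L s (\<lambda>x. classical_gradient \<phi> x - grad u x)"
proof -
  have m0: "m > 0" using m by simp
  note \<phi>W = test_function_W1[OF \<phi> m0]
  have "L s (grad (\<lambda>x. \<phi> x - u x)) = L s (\<lambda>x. grad \<phi> x - grad u x)"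
    using Lnorm_grad_comb[OF m \<phi>W(1) u, of s 1 "-1"] by simp
  also have "\<dots> = L s (\<lambda>x. classical_gradient \<phi> x - grad u x)"
  proof (rule Lnorm_cong_AE)
    show "(\<lambda>x. grad \<phi> x - grad u x) \<in> borel_measurable (lebesgue_on \<Omega>)"
      by (rule Lspace_measurable[OF Lspace_diff[OF m W1D(2)[OF \<phi>W(1)] W1D(2)[OF u]]])
    show "(\<lambda>x. classical_gradient \<phi> x - grad u x) \<in> borel_measurable (lebesgue_on \<Omega>)"
      by (rule Lspace_measurable[OF Lspace_diff[OF m test_function_Lspace(2)[OF \<phi> dom_lebesgue m0] W1D(2)[OF u]]])
    show "AE x in lebesgue_on \<Omega>. grad \<phi> x - grad u x = classical_gradient \<phi> x - grad u x"
      using \<phi>W(2) by eventually_elim simp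
  qed
  finally show ?thesis .
qed

lemma W1_norm_bounds:
  assumes "m \<ge> 1"
  shows "L m u \<le> W1_norm \<Omega> m u" "L m (grad u) \<le> W1_norm \<Omega> m u"
    "W1_norm \<Omega> m u \<le> L m u + L m (grad u)"
  using le_powr_add_root[of m "L m u" "L m (grad u)"] le_powr_add_root[of m "L m (grad u)" "L m u"]
    powr_add_root_le[of m "L m u" "L m (grad u)"] assms
  by (simp_all add: W1_norm_def Lnorm_nonneg add.commute)

text \<open>Together with \<open>W10I\<close> this trades the sequence and the combined norm in the
  definition for single approximants with separate bounds, stated with the classical gradient of the
  test function instead of a chosen weak one.\<close>

lemma W10_approx:
  assumes m: "m \<ge> 1" and u: "u \<in> W10 \<Omega> m" and e: "e > 0"
  obtains \<phi> where "\<phi> \<in> test_functions \<Omega>" "L m (\<lambda>x. \<phi> x - u x) \<le> e"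
    "L m (\<lambda>x. classical_gradient \<phi> x - grad u x) \<le> e"
proof -
  obtain \<phi> where \<phi>: "\<And>k. \<phi> k \<in> test_functions \<Omega>" "(\<lambda>k. W1_norm \<Omega> m (\<lambda>x. \<phi> k x - u x)) \<longlonglongrightarrow> 0"
    and u1: "u \<in> W1 \<Omega> m"
    using u by (auto simp: W10_def)
  from order_tendstoD(2)[OF \<phi>(2) e] obtain k where k: "W1_norm \<Omega> m (\<lambda>x. \<phi> k x - u x) < e"
    by (auto simp: eventually_sequentially)
  show ?thesis
    using that[OF \<phi>(1)[of k]] W1_norm_bounds[OF m, of "\<lambda>x. \<phi> k x - u x"] k
      Lnorm_grad_diff_test[OF m u1 \<phi>(1)[of k], of m] by linarith
qed

lemma W10I:
  assumes m: "m \<ge> 1" and u: "u \<in> W1 \<Omega> m"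
    and approx: "\<And>e. e > 0 \<Longrightarrow> \<exists>\<phi>\<in>test_functions \<Omega>. L m (\<lambda>x. \<phi> x - u x) \<le> e \<and>
       L m (\<lambda>x. classical_gradient \<phi> x - grad u x) \<le> e"
  shows "u \<in> W10 \<Omega> m"
proof -
  have "\<forall>k. \<exists>\<phi>\<in>test_functions \<Omega>. L m (\<lambda>x. \<phi> x - u x) \<le> inverse (real (Suc k)) \<and>
       L m (\<lambda>x. classical_gradient \<phi> x - grad u x) \<le> inverse (real (Suc k))"
    by (intro allI approx) simp
  then obtain \<phi> where \<phi>: "\<And>k. \<phi> k \<in> test_functions \<Omega>"
    "\<And>k. L m (\<lambda>x. \<phi> k x - u x) \<le> inverse (real (Suc k))"
    "\<And>k. L m (\<lambda>x. classical_gradient (\<phi> k) x - grad u x) \<le> inverse (real (Suc k))"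
    by metis
  have "(\<lambda>k. W1_norm \<Omega> m (\<lambda>x. \<phi> k x - u x)) \<longlonglongrightarrow> 0"
  proof (rule tendsto_sandwich[where f = "\<lambda>_. 0" and h = "\<lambda>k. 2 * inverse (real (Suc k))"])
    have "(\<lambda>k. 2 * inverse (real (Suc k))) \<longlonglongrightarrow> 2 * 0"
      by (intro tendsto_intros LIMSEQ_inverse_real_of_nat)
    then show "(\<lambda>k. 2 * inverse (real (Suc k))) \<longlonglongrightarrow> 0" by simp
    show "\<forall>\<^sub>F k in sequentially. W1_norm \<Omega> m (\<lambda>x. \<phi> k x - u x) \<le> 2 * inverse (real (Suc k))"
    proof (rule always_eventually, rule allI)
      fix k
      show "W1_norm \<Omega> m (\<lambda>x. \<phi> k x - u x) \<le> 2 * inverse (real (Suc k))"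
        using W1_norm_bounds(3)[OF m, of "\<lambda>x. \<phi> k x - u x"] \<phi>(2)[of k] \<phi>(3)[of k]
          Lnorm_grad_diff_test[OF m u \<phi>(1)[of k], of m] by linarith
    qed
    show "\<forall>\<^sub>F k in sequentially. 0 \<le> W1_norm \<Omega> m (\<lambda>x. \<phi> k x - u x)"
      by (simp add: W1_norm_def)
  qed auto
  then show ?thesis using u \<phi>(1) by (auto simp: W10_def)
qed

lemma W10_W1: "u \<in> W10 \<Omega> m \<Longrightarrow> u \<in> W1 \<Omega> m"
  by (simp add: W10_def)

lemmas W10D = W1D[OF W10_W1]

lemma test_function_W10:
  assumes m: "m \<ge> 1" and \<phi>: "\<phi> \<in> test_functions \<Omega>"
  shows "\<phi> \<in> W10 \<Omega> m"
proof (rule W10I[OF m])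
  have m0: "m > 0" using m by simp
  show W: "\<phi> \<in> W1 \<Omega> m" by (rule test_function_W1(1)[OF \<phi> m0])
  have ae: "AE x in lebesgue_on \<Omega>. classical_gradient \<phi> x - grad \<phi> x = 0"
    using test_function_W1(2)[OF \<phi> m0] by eventually_elim simp
  have "L m (\<lambda>x. classical_gradient \<phi> x - grad \<phi> x) = L m (\<lambda>x. 0 :: 'a)"
    by (rule Lnorm_cong_AE[OF Lspace_measurable[OF Lspace_diff[OF m
            test_function_Lspace(2)[OF \<phi> dom_lebesgue m0] W1D(2)[OF W]]] _ ae]) simp
  then show "\<exists>\<psi>\<in>test_functions \<Omega>. L m (\<lambda>x. \<psi> x - \<phi> x) \<le> e \<and>
       L m (\<lambda>x. classical_gradient \<psi> x - grad \<phi> x) \<le> e" if "e > 0" for e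
    using \<phi> that by (intro bexI[of _ \<phi>]) (auto simp: Lnorm_finite)
qed

lemma W10_comb:
  assumes m: "m \<ge> 1" and u: "u \<in> W10 \<Omega> m" and v: "v \<in> W10 \<Omega> m"
  shows "(\<lambda>x. a * u x + b * v x) \<in> W10 \<Omega> m"
proof (rule W10I[OF m])
  have m0: "m > 0" using m by simp
  note uW = W10_W1[OF u] and vW = W10_W1[OF v]
  show W: "(\<lambda>x. a * u x + b * v x) \<in> W1 \<Omega> m" by (rule W1_comb(1)[OF m uW vW])
  have combo: "L m (\<lambda>x. (a *\<^sub>R f x + b *\<^sub>R g x) - (a *\<^sub>R f' x + b *\<^sub>R g' x)) \<le>
      (\<bar>a\<bar> + \<bar>b\<bar>) * d"
    if "f \<in> Lspace \<Omega> m" "g \<in> Lspace \<Omega> m" "f' \<in> Lspace \<Omega> m" "g' \<in> Lspace \<Omega> m"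
      "L m (\<lambda>x. f x - f' x) \<le> d" "L m (\<lambda>x. g x - g' x) \<le> d"
    for f g f' g' :: "'a \<Rightarrow> 'c::euclidean_space" and d
  proof -
    have "L m (\<lambda>x. a *\<^sub>R (f x - f' x) + b *\<^sub>R (g x - g' x)) \<le>
        L m (\<lambda>x. a *\<^sub>R (f x - f' x)) + L m (\<lambda>x. b *\<^sub>R (g x - g' x))"
      by (intro Lnorm_triangle m Lspace_scaleR Lspace_diff that)
    also have "\<dots> = \<bar>a\<bar> * L m (\<lambda>x. f x - f' x) + \<bar>b\<bar> * L m (\<lambda>x. g x - g' x)"
      by (simp only: Lnorm_scaleR[OF m0])
    also have "\<dots> \<le> \<bar>a\<bar> * d + \<bar>b\<bar> * d"
      using that by (intro add_mono mult_left_mono) auto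
    finally show ?thesis by (simp add: algebra_simps)
  qed
  fix e :: real assume e: "e > 0"
  define d where "d = e / (\<bar>a\<bar> + \<bar>b\<bar> + 1)"
  have d: "d > 0" "(\<bar>a\<bar> + \<bar>b\<bar>) * d \<le> e" using e by (auto simp: d_def field_simps add_nonneg_pos)
  obtain \<phi> where \<phi>: "\<phi> \<in> test_functions \<Omega>" "L m (\<lambda>x. \<phi> x - u x) \<le> d"
    "L m (\<lambda>x. classical_gradient \<phi> x - grad u x) \<le> d" using W10_approx[OF m u d(1)] .
  obtain \<psi> where \<psi>: "\<psi> \<in> test_functions \<Omega>" "L m (\<lambda>x. \<psi> x - v x) \<le> d"
    "L m (\<lambda>x. classical_gradient \<psi> x - grad v x) \<le> d" using W10_approx[OF m v d(1)] .
  note l = test_function_Lspace(1,2)[OF _ dom_lebesgue m0]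
  let ?\<eta> = "\<lambda>x. a * \<phi> x + b * \<psi> x"
  show "\<exists>\<eta>\<in>test_functions \<Omega>. L m (\<lambda>x. \<eta> x - (a * u x + b * v x)) \<le> e \<and>
    L m (\<lambda>x. classical_gradient \<eta> x - grad (\<lambda>x. a * u x + b * v x) x) \<le> e"
  proof (intro bexI conjI)
    show \<eta>: "?\<eta> \<in> test_functions \<Omega>" by (rule test_functions_comb[OF \<phi>(1) \<psi>(1)])
    show "L m (\<lambda>x. ?\<eta> x - (a * u x + b * v x)) \<le> e"
      using combo[OF l(1)[OF \<phi>(1)] l(1)[OF \<psi>(1)] W1D(1)[OF uW] W1D(1)[OF vW] \<phi>(2) \<psi>(2)] d by simp
    have "L m (\<lambda>x. classical_gradient ?\<eta> x - grad (\<lambda>x. a * u x + b * v x) x)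
       = L m (\<lambda>x. (a *\<^sub>R classical_gradient \<phi> x + b *\<^sub>R classical_gradient \<psi> x) - (a *\<^sub>R grad u x + b *\<^sub>R grad v x))"
    proof (rule Lnorm_cong_AE)
      show "(\<lambda>x. classical_gradient ?\<eta> x - grad (\<lambda>x. a * u x + b * v x) x) \<in> borel_measurable (lebesgue_on \<Omega>)"
        by (intro Lspace_measurable[OF Lspace_diff[OF m l(2)[OF \<eta>] W1D(2)[OF W]]])
      show "(\<lambda>x. (a *\<^sub>R classical_gradient \<phi> x + b *\<^sub>R classical_gradient \<psi> x) - (a *\<^sub>R grad u x + b *\<^sub>R grad v x))
        \<in> borel_measurable (lebesgue_on \<Omega>)"
        by (intro Lspace_measurable[where m = m] Lspace_diff Lspace_comb m l(2) \<phi> \<psi> W1D(2)[OF uW] W1D(2)[OF vW])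
      show "AE x in lebesgue_on \<Omega>. classical_gradient ?\<eta> x - grad (\<lambda>x. a * u x + b * v x) x =
        (a *\<^sub>R classical_gradient \<phi> x + b *\<^sub>R classical_gradient \<psi> x) - (a *\<^sub>R grad u x + b *\<^sub>R grad v x)"
        using W1_comb(2)[OF m uW vW, of a b]
        by eventually_elim (simp add: classical_gradient_comb[OF \<phi>(1) \<psi>(1)])
    qed
    also have "\<dots> \<le> e"
      using combo[OF l(2)[OF \<phi>(1)] l(2)[OF \<psi>(1)] W1D(2)[OF uW] W1D(2)[OF vW] \<phi>(3) \<psi>(3)] d by simp
    finally show "L m (\<lambda>x. classical_gradient ?\<eta> x - grad (\<lambda>x. a * u x + b * v x) x) \<le> e" .
  qed
qed

lemma W10_diff_test:
  assumes m: "m \<ge> 1" and u: "u \<in> W10 \<Omega> m" and \<phi>: "\<phi> \<in> test_functions \<Omega>"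
  shows "(\<lambda>x. \<phi> x - u x) \<in> W10 \<Omega> m"
  using W10_comb[OF m test_function_W10[OF m \<phi>] u, of 1 "-1"] by simp

section \<open>Sup bounds, compactness and closedness in \<open>W10\<close>\<close>

lemma Lnorm_tendsto_imp_AE_subseq:
  fixes f :: "nat \<Rightarrow> 'a \<Rightarrow> 'b::euclidean_space"
  assumes m: "m \<ge> 1" and f: "\<And>n. f n \<in> Lspace \<Omega> m" and lim: "(\<lambda>n. L m (f n)) \<longlonglongrightarrow> 0"
  obtains r :: "nat \<Rightarrow> nat" where "strict_mono r" "AE x in lebesgue_on \<Omega>. (\<lambda>n. f (r n) x) \<longlonglongrightarrow> 0"
proof -
  have "(\<lambda>n. \<integral>x. norm (f n x) \<partial>lebesgue_on \<Omega>) \<longlonglongrightarrow> 0"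
  proof (rule tendsto_sandwich[where f = "\<lambda>_. 0" and h = "\<lambda>n. (measure lebesgue \<Omega> + 1) * L m (f n)"])
    show "\<forall>\<^sub>F n in sequentially. (\<integral>x. norm (f n x) \<partial>lebesgue_on \<Omega>) \<le> (measure lebesgue \<Omega> + 1) * L m (f n)"
      by (intro always_eventually allI integral_norm_le_Lnorm[OF dom_lmeasurable m f])
    show "(\<lambda>n. (measure lebesgue \<Omega> + 1) * L m (f n)) \<longlonglongrightarrow> 0"
      using tendsto_mult[OF tendsto_const[of "measure lebesgue \<Omega> + 1"] lim] by simp
  qed (auto simp: integral_nonneg_AE)
  from tendsto_L1_AE_subseq[OF Lspace_imp_integrable[OF dom_lmeasurable m f] this]
  show ?thesis using that by blast
qed


text \<open>The exponent \<open>s\<close> of the bound is fixed while \<open>m\<close> varies, with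
  one constant for all \<open>m\<close>. For \<open>q < p\<close> this bounds functions of
  \<open>W10 \<Omega> p\<close> by the L^q norm of the gradient. The estimate for test functions
  survives the limit along an a.e. convergent subsequence.\<close>

theorem W10_sup_bound:
  fixes s :: real
  assumes s: "s > DIM('a)"
  obtains C where "C > 0" "\<And>m u. s \<le> m \<Longrightarrow> u \<in> W10 \<Omega> m \<Longrightarrow>
    AE x in lebesgue_on \<Omega>. \<bar>u x\<bar> \<le> C * L s (grad u)"
proof -
  have s1: "s \<ge> 1" "s > 0" using s DIM_ge_Suc0[where 'a='a] by linarith+
  obtain C where C: "C > 0" "\<And>\<phi> x. \<phi> \<in> test_functions \<Omega> \<Longrightarrow> \<bar>\<phi> x\<bar> \<le> C * L s (classical_gradient \<phi>)"
    using test_function_sup_bound[OF open_dom bounded_dom s] by metis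
  have "AE x in lebesgue_on \<Omega>. \<bar>u x\<bar> \<le> C * L s (grad u)" if sm: "s \<le> m" and u: "u \<in> W10 \<Omega> m" for m u
  proof -
    have m: "m \<ge> 1" "m > 0" using s1 sm by auto
    have "\<forall>k. \<exists>\<phi>\<in>test_functions \<Omega>. L m (\<lambda>x. \<phi> x - u x) \<le> inverse (real (Suc k)) \<and>
         L m (\<lambda>x. classical_gradient \<phi> x - grad u x) \<le> inverse (real (Suc k))"
      by (metis W10_approx[OF m(1) u] inverse_positive_iff_positive of_nat_0_less_iff zero_less_Suc)
    then obtain \<phi> where \<phi>: "\<And>k. \<phi> k \<in> test_functions \<Omega>"
      "\<And>k. L m (\<lambda>x. \<phi> k x - u x) \<le> inverse (real (Suc k))"
      "\<And>k. L m (\<lambda>x. classical_gradient (\<phi> k) x - grad u x) \<le> inverse (real (Suc k))"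
      by metis
    have lim1: "(\<lambda>k. L m (\<lambda>x. \<phi> k x - u x)) \<longlonglongrightarrow> 0"
      by (rule tendsto_sandwich[OF _ _ tendsto_const LIMSEQ_inverse_real_of_nat])
        (rule always_eventually, rule allI, rule Lnorm_nonneg \<phi>(2))+
    have dL: "(\<lambda>x. \<phi> k x - u x) \<in> Lspace \<Omega> m" for k
      by (rule Lspace_diff[OF m(1) test_function_Lspace(1)[OF \<phi>(1) dom_lebesgue m(2)] W10D(1)[OF u]])
    obtain r :: "nat \<Rightarrow> nat" where r: "strict_mono r"
      "AE x in lebesgue_on \<Omega>. (\<lambda>n. \<phi> (r n) x - u x) \<longlonglongrightarrow> 0"
      by (rule Lnorm_tendsto_imp_AE_subseq[OF m(1) dL lim1])
    define K where "K = (measure lebesgue \<Omega> + 1) powr (1 / s)"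
    have bound: "\<bar>\<phi> k x\<bar> \<le> C * (L s (grad u) + K * inverse (real (Suc k)))" for k x
    proof -
      have gl: "classical_gradient (\<phi> k) \<in> Lspace \<Omega> m"
        by (rule test_function_Lspace(2)[OF \<phi>(1) dom_lebesgue m(2)])
      note dl = Lspace_diff[OF m(1) gl W10D(2)[OF u]]
      have "L s (classical_gradient (\<phi> k)) \<le> L s (grad u) + L s (\<lambda>x. classical_gradient (\<phi> k) x - grad u x)"
        by (intro Lnorm_triangle_diff[OF s1(1)] Lspace_mono[OF dom_lmeasurable s1(2) sm] gl W10D(2)[OF u])
      also have "L s (\<lambda>x. classical_gradient (\<phi> k) x - grad u x) \<le>
          K * L m (\<lambda>x. classical_gradient (\<phi> k) x - grad u x)"
        unfolding K_def by (rule Lnorm_le_Lnorm[OF dom_lmeasurable s1(2) sm dl])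
      also have "\<dots> \<le> K * inverse (real (Suc k))"
        using \<phi>(3) by (intro mult_left_mono) (auto simp: K_def)
      finally have "L s (classical_gradient (\<phi> k)) \<le> L s (grad u) + K * inverse (real (Suc k))" by simp
      then show ?thesis using C(2)[OF \<phi>(1)[of k], of x] C(1) by (smt (verit) mult_left_mono)
    qed
    have lim2: "(\<lambda>k. C * (L s (grad u) + K * inverse (real (Suc (r k))))) \<longlonglongrightarrow> C * (L s (grad u) + K * 0)"
      using LIMSEQ_subseq_LIMSEQ[OF LIMSEQ_inverse_real_of_nat r(1)]
      by (intro tendsto_intros) (simp add: o_def)
    from r(2) show ?thesis
    proof eventually_elim
      case (elim x)
      then have "(\<lambda>n. (\<phi> (r n) x - u x) + u x) \<longlonglongrightarrow> 0 + u x" by (intro tendsto_intros)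
      then have "(\<lambda>n. \<bar>\<phi> (r n) x\<bar>) \<longlonglongrightarrow> \<bar>u x\<bar>" by (intro tendsto_rabs) simp
      from LIMSEQ_le[OF this lim2] bound show ?case by simp
    qed
  qed
  with C(1) show ?thesis by (rule that)
qed

text \<open>Elements of \<open>W10\<close> are only classes, so equicontinuity is established for
  test functions \<open>\<phi> n\<close> close to \<open>u n\<close>. By the sup bound the
  differences \<open>\<phi> n - u n\<close> tend to 0 uniformly, so the Arzela-Ascoli limit is also
  that of \<open>u (k n)\<close>.\<close>

theorem W10_compact:
  fixes u :: "nat \<Rightarrow> 'a \<Rightarrow> real" and m K :: real
  assumes m: "m > DIM('a)" and u: "\<And>n. u n \<in> W10 \<Omega> m" and K: "\<And>n. L m (grad (u n)) \<le> K"
  obtains w and k :: "nat \<Rightarrow> nat" and B :: real where "strict_mono k" "w \<in> borel_measurable (lebesgue_on \<Omega>)"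
    "\<And>x. x \<in> \<Omega> \<Longrightarrow> \<bar>w x\<bar> \<le> B"
    "\<And>e. e > 0 \<Longrightarrow> \<exists>N. \<forall>n\<ge>N. AE x in lebesgue_on \<Omega>. \<bar>u (k n) x - w x\<bar> \<le> e"
proof -
  have m1: "m \<ge> 1" "m > 0" using m DIM_ge_Suc0[where 'a='a] by linarith+
  define \<alpha> where "\<alpha> = 1 - DIM('a) / m"
  have \<alpha>: "\<alpha> > 0" using m m1 by (simp add: \<alpha>_def)
  have "\<forall>n. \<exists>\<phi>\<in>test_functions \<Omega>. L m (\<lambda>x. classical_gradient \<phi> x - grad (u n) x) \<le> inverse (real (Suc n))"
    by (metis W10_approx[OF m1(1) u] inverse_positive_iff_positive of_nat_0_less_iff zero_less_Suc)
  then obtain \<phi> where \<phi>: "\<And>n. \<phi> n \<in> test_functions \<Omega>"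
    "\<And>n. L m (\<lambda>x. classical_gradient (\<phi> n) x - grad (u n) x) \<le> inverse (real (Suc n))"
    by metis
  have \<phi>K: "L m (classical_gradient (\<phi> n)) \<le> \<bar>K\<bar> + 1" for n
  proof -
    have "L m (classical_gradient (\<phi> n)) \<le> L m (grad (u n)) + L m (\<lambda>x. classical_gradient (\<phi> n) x - grad (u n) x)"
      by (intro Lnorm_triangle_diff[OF m1(1)] W10D(2)[OF u] test_function_Lspace(2)[OF \<phi>(1) dom_lebesgue m1(2)])
    moreover have "inverse (real (Suc n)) \<le> 1" by (simp add: field_simps)
    ultimately show ?thesis using K[of n] \<phi>(2)[of n] by linarith
  qed
  obtain C where C: "C > 0" "\<And>\<phi> x. \<phi> \<in> test_functions \<Omega> \<Longrightarrow> \<bar>\<phi> x\<bar> \<le> C * L m (classical_gradient \<phi>)"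
    using test_function_sup_bound[OF open_dom bounded_dom m] by metis
  define B where "B = C * (\<bar>K\<bar> + 1)"
  have \<phi>B: "\<bar>\<phi> n x\<bar> \<le> B" for n x
    unfolding B_def
    by (rule order_trans[OF C(2)[OF \<phi>(1)] mult_left_mono[OF \<phi>K less_imp_le[OF C(1)]]])
  define M where "M = morrey_const TYPE('a) m * (\<bar>K\<bar> + 1) + 1"
  have mc: "morrey_const TYPE('a) m > 0" using m m1 by (simp add: morrey_const_def)
  have M: "M > 0" using mc by (simp add: M_def add_nonneg_pos)
  have holder: "\<bar>\<phi> n x - \<phi> n y\<bar> \<le> M * norm (x - y) powr \<alpha>" for n x y
  proof -
    have "\<bar>\<phi> n x - \<phi> n y\<bar> \<le> morrey_const TYPE('a) m * L m (classical_gradient (\<phi> n)) * norm (x - y) powr \<alpha>"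
      unfolding \<alpha>_def by (rule test_function_holder[OF \<phi>(1) dom_lebesgue m])
    also have "\<dots> \<le> M * norm (x - y) powr \<alpha>"
    proof (rule mult_right_mono)
      show "morrey_const TYPE('a) m * L m (classical_gradient (\<phi> n)) \<le> M"
        using mult_left_mono[OF \<phi>K[of n] less_imp_le[OF mc]] by (simp only: M_def)
    qed simp
    finally show ?thesis .
  qed
  obtain g and k :: "nat \<Rightarrow> nat" where g: "continuous_on (closure \<Omega>) g" "strict_mono k"
    "\<And>e. 0 < e \<Longrightarrow> \<exists>N. \<forall>n x. n \<ge> N \<and> x \<in> closure \<Omega> \<longrightarrow> norm (\<phi> (k n) x - g x) < e"
  proof (rule Arzela_Ascoli[of "closure \<Omega>" \<phi> B])
    show "compact (closure \<Omega>)" using bounded_dom by simp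
    fix x :: 'a and e :: real assume e: "0 < e"
    define d where "d = (e / M) powr (1 / \<alpha>)"
    have "d > 0" using e M by (simp add: d_def)
    moreover have "norm (\<phi> n x - \<phi> n y) < e" if "norm (x - y) < d" for n y
    proof -
      have "norm (x - y) powr \<alpha> < d powr \<alpha>" using that \<alpha> by (intro powr_less_mono2) auto
      also have "d powr \<alpha> = e / M" using e M \<alpha> by (simp add: d_def powr_powr)
      finally have "M * norm (x - y) powr \<alpha> < e" using M by (simp add: field_simps)
      then show ?thesis using holder[of n x y] by simp
    qed
    ultimately show "\<exists>d. 0 < d \<and> (\<forall>n y. y \<in> closure \<Omega> \<and> norm (x - y) < d \<longrightarrow> norm (\<phi> n x - \<phi> n y) < e)"
      by blast
  qed (use \<phi>B in auto)
  have gB: "\<bar>g x\<bar> \<le> B + 1" if "x \<in> \<Omega>" for x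
  proof -
    obtain N where "\<And>n x. n \<ge> N \<Longrightarrow> x \<in> closure \<Omega> \<Longrightarrow> norm (\<phi> (k n) x - g x) < 1"
      using g(3)[of 1] by auto
    from this[of N x] that have "\<bar>\<phi> (k N) x - g x\<bar> < 1" using closure_subset by auto
    then show ?thesis using \<phi>B[of "k N" x] by linarith
  qed
  have gm: "g \<in> borel_measurable (lebesgue_on \<Omega>)"
    by (rule continuous_imp_measurable_on_sets_lebesgue[OF continuous_on_subset[OF g(1) closure_subset] dom_lebesgue])
  obtain C' where C': "C' > 0" "\<And>u. u \<in> W10 \<Omega> m \<Longrightarrow> AE x in lebesgue_on \<Omega>. \<bar>u x\<bar> \<le> C' * L m (grad u)"
    using W10_sup_bound[OF m] by (metis order_refl)
  have near: "AE x in lebesgue_on \<Omega>. \<bar>\<phi> n x - u n x\<bar> \<le> C' * inverse (real (Suc n))" for n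
  proof -
    have "AE x in lebesgue_on \<Omega>. \<bar>\<phi> n x - u n x\<bar> \<le> C' * L m (grad (\<lambda>x. \<phi> n x - u n x))"
      by (rule C'(2)[OF W10_diff_test[OF m1(1) u \<phi>(1)]])
    then show ?thesis
      unfolding Lnorm_grad_diff_test[OF m1(1) W10_W1[OF u] \<phi>(1)]
      by eventually_elim (use \<phi>(2)[of n] C'(1) in \<open>smt (verit) mult_left_mono\<close>)
  qed
  have "\<exists>N. \<forall>n\<ge>N. AE x in lebesgue_on \<Omega>. \<bar>u (k n) x - g x\<bar> \<le> e" if e: "e > 0" for e
  proof -
    have "(\<lambda>n. C' * inverse (real (Suc (k n)))) \<longlonglongrightarrow> C' * 0"
      using LIMSEQ_subseq_LIMSEQ[OF LIMSEQ_inverse_real_of_nat g(2)]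
      by (intro tendsto_intros) (simp add: o_def)
    then have "eventually (\<lambda>n. C' * inverse (real (Suc (k n))) < e / 2) sequentially"
      using e by (intro order_tendstoD(2)[where y = "C' * 0"]) auto
    then obtain N1 where N1: "\<And>n. n \<ge> N1 \<Longrightarrow> C' * inverse (real (Suc (k n))) < e / 2"
      by (auto simp: eventually_sequentially)
    obtain N2 where N2: "\<And>n x. n \<ge> N2 \<Longrightarrow> x \<in> closure \<Omega> \<Longrightarrow> norm (\<phi> (k n) x - g x) < e / 2"
      using g(3)[of "e / 2"] e by auto
    have "AE x in lebesgue_on \<Omega>. \<bar>u (k n) x - g x\<bar> \<le> e" if n: "n \<ge> max N1 N2" for n
      using near[of "k n"] AE_space
    proof eventually_elim
      case (elim x)
      then have "x \<in> closure \<Omega>" using closure_subset by auto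
      then have "\<bar>\<phi> (k n) x - g x\<bar> < e / 2" using N2[of n x] n by simp
      then show ?case using elim(1) N1[of n] n by linarith
    qed
    then show ?thesis by blast
  qed
  from that[OF g(2) gm gB this] show ?thesis .
qed

text \<open>Meant for both sides of the weak gradient identity, where \<open>h n\<close> is
  \<open>f n\<close> times a bounded factor coming from a test function.\<close>

lemma integral_tendsto_Lspace:
  fixes f :: "nat \<Rightarrow> 'a \<Rightarrow> 'b::euclidean_space" and h :: "nat \<Rightarrow> 'a \<Rightarrow> 'c::euclidean_space"
  assumes m: "m \<ge> 1" and f: "\<And>n. f n \<in> Lspace \<Omega> m" "f' \<in> Lspace \<Omega> m"
    and lim: "(\<lambda>n. L m (\<lambda>x. f n x - f' x)) \<longlonglongrightarrow> 0"
    and h: "\<And>n. integrable (lebesgue_on \<Omega>) (h n)" "integrable (lebesgue_on \<Omega>) h'"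
    and B: "\<And>n x. norm (h n x - h' x) \<le> B * norm (f n x - f' x)"
  shows "(\<lambda>n. integral\<^sup>L (lebesgue_on \<Omega>) (h n)) \<longlonglongrightarrow> integral\<^sup>L (lebesgue_on \<Omega>) h'"
proof -
  have "(\<lambda>n. integral\<^sup>L (lebesgue_on \<Omega>) (h n) - integral\<^sup>L (lebesgue_on \<Omega>) h') \<longlonglongrightarrow> 0"
  proof (rule Lim_null_comparison)
    show "\<forall>\<^sub>F n in sequentially. norm (integral\<^sup>L (lebesgue_on \<Omega>) (h n) - integral\<^sup>L (lebesgue_on \<Omega>) h')
       \<le> \<bar>B\<bar> * (measure lebesgue \<Omega> + 1) * L m (\<lambda>x. f n x - f' x)"
    proof (rule always_eventually, rule allI)
      fix n
      have d: "(\<lambda>x. f n x - f' x) \<in> Lspace \<Omega> m" by (intro Lspace_diff m f)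
      have "norm (integral\<^sup>L (lebesgue_on \<Omega>) (h n) - integral\<^sup>L (lebesgue_on \<Omega>) h')
          = norm (\<integral>x. h n x - h' x \<partial>lebesgue_on \<Omega>)"
        using h by simp
      also have "\<dots> \<le> (\<integral>x. \<bar>B\<bar> * norm (f n x - f' x) \<partial>lebesgue_on \<Omega>)"
      proof (rule Bochner_Integration.integral_norm_bound_integral)
        show "norm (h n x - h' x) \<le> \<bar>B\<bar> * norm (f n x - f' x)" for x
          using B[of n x] mult_right_mono[OF abs_ge_self[of B] norm_ge_zero[of "f n x - f' x"]] by linarith
      qed (use h Lspace_imp_integrable[OF dom_lmeasurable m d] in auto)
      also have "\<dots> = \<bar>B\<bar> * (\<integral>x. norm (f n x - f' x) \<partial>lebesgue_on \<Omega>)" by simp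
      also have "\<dots> \<le> \<bar>B\<bar> * ((measure lebesgue \<Omega> + 1) * L m (\<lambda>x. f n x - f' x))"
        by (intro mult_left_mono integral_norm_le_Lnorm[OF dom_lmeasurable m d]) simp
      finally show "norm (integral\<^sup>L (lebesgue_on \<Omega>) (h n) - integral\<^sup>L (lebesgue_on \<Omega>) h')
         \<le> \<bar>B\<bar> * (measure lebesgue \<Omega> + 1) * L m (\<lambda>x. f n x - f' x)"
        by (simp add: mult.assoc)
    qed
    show "(\<lambda>n. \<bar>B\<bar> * (measure lebesgue \<Omega> + 1) * L m (\<lambda>x. f n x - f' x)) \<longlonglongrightarrow> 0"
      using tendsto_mult[OF tendsto_const[of "\<bar>B\<bar> * (measure lebesgue \<Omega> + 1)"] lim] by simp
  qed
  then show ?thesis by (rule LIM_zero_cancel)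
qed

lemma Lnorm_AE_bound:
  fixes f :: "'a \<Rightarrow> 'b::euclidean_space"
  assumes f: "f \<in> borel_measurable (lebesgue_on \<Omega>)" and m: "m > 0" and e: "e \<ge> 0"
    and b: "AE x in lebesgue_on \<Omega>. norm (f x) \<le> e"
  shows "f \<in> Lspace \<Omega> m" "L m f \<le> measure lebesgue \<Omega> powr (1 / m) * e"
proof -
  note ci = integrable_const_lebesgue_on[OF dom_lmeasurable]
  have b': "AE x in lebesgue_on \<Omega>. norm (f x) powr m \<le> e powr m"
    using b by eventually_elim (use m in \<open>auto intro!: powr_mono2\<close>)
  show fL: "f \<in> Lspace \<Omega> m" by (rule Lspace_bound[OF f ci b'])
  show "L m f \<le> measure lebesgue \<Omega> powr (1 / m) * e"
  proof (rule Lnorm_leI[OF m])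
    have "(\<integral>x. norm (f x) powr m \<partial>lebesgue_on \<Omega>) \<le> (\<integral>x. e powr m \<partial>lebesgue_on \<Omega>)"
      by (rule integral_mono_AE[OF Lspace_integrable[OF fL] ci b'])
    also have "\<dots> = measure lebesgue \<Omega> * e powr m" by (simp add: measure_restrict_space)
    also have "\<dots> = (measure lebesgue \<Omega> powr (1 / m) * e) powr m"
      using m by (simp add: powr_mult powr_powr)
    finally show "(\<integral>x. norm (f x) powr m \<partial>lebesgue_on \<Omega>) \<le> (measure lebesgue \<Omega> powr (1 / m) * e) powr m" .
  qed (use e in simp)
qed

text \<open>Uniform convergence implies L^m convergence because \<Omega> has finite measure. The
  identity defining a weak gradient then passes to the limit on both sides, which identifies
  \<open>g\<close> as a gradient of \<open>w\<close>.\<close>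

theorem W10_closed:
  fixes u :: "nat \<Rightarrow> 'a \<Rightarrow> real"
  assumes m: "m \<ge> 1" and u: "\<And>n. u n \<in> W10 \<Omega> m"
    and w: "w \<in> borel_measurable (lebesgue_on \<Omega>)" "\<And>x. x \<in> \<Omega> \<Longrightarrow> \<bar>w x\<bar> \<le> B"
    and unif: "\<And>e. e > 0 \<Longrightarrow> \<exists>N. \<forall>n\<ge>N. AE x in lebesgue_on \<Omega>. \<bar>u n x - w x\<bar> \<le> e"
    and g: "g \<in> Lspace \<Omega> m" and lim: "(\<lambda>n. L m (\<lambda>x. grad (u n) x - g x)) \<longlonglongrightarrow> 0"
  shows "w \<in> W10 \<Omega> m" "AE x in lebesgue_on \<Omega>. grad w x = g x"
    "(\<lambda>n. W1_norm \<Omega> m (\<lambda>x. u n x - w x)) \<longlonglongrightarrow> 0"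
proof -
  have m0: "m > 0" using m by simp
  define K where "K = measure lebesgue \<Omega> powr (1 / m)"
  have K: "K \<ge> 0" by (simp add: K_def)
  have "AE x in lebesgue_on \<Omega>. norm (w x) \<le> \<bar>B\<bar>"
    using w(2) by (intro AE_I2) (force intro: order_trans)
  then have wL: "w \<in> Lspace \<Omega> m" by (intro Lnorm_AE_bound(1)[OF w(1) m0, of "\<bar>B\<bar>"]) auto
  note uL = W10D(1)[OF u] and guL = W10D(2)[OF u]
  have lim0: "(\<lambda>n. L m (\<lambda>x. u n x - w x)) \<longlonglongrightarrow> 0"
  proof (rule LIMSEQ_I)
    fix e :: real assume e: "e > 0"
    define d where "d = e / (K + 1)"
    have d: "d > 0" "K * d < e" using e K by (auto simp: d_def field_simps)
    obtain N where N: "\<And>n. n \<ge> N \<Longrightarrow> AE x in lebesgue_on \<Omega>. \<bar>u n x - w x\<bar> \<le> d" using unif[OF d(1)] by auto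
    have "norm (L m (\<lambda>x. u n x - w x) - 0) < e" if n: "n \<ge> N" for n
    proof -
      have "L m (\<lambda>x. u n x - w x) \<le> K * d"
        unfolding K_def using N[OF n] d
        by (intro Lnorm_AE_bound(2) m0 Lspace_measurable[OF Lspace_diff[OF m uL wL]]) auto
      then show ?thesis using d Lnorm_nonneg[of \<Omega> m "\<lambda>x. u n x - w x"] by simp
    qed
    then show "\<exists>no. \<forall>n\<ge>no. norm (L m (\<lambda>x. u n x - w x) - 0) < e" by blast
  qed
  have wg: "is_weak_gradient \<Omega> w g"
    unfolding is_weak_gradient_def
  proof (intro conjI ballI)
    show wl: "locally_integrable \<Omega> w" and gl: "locally_integrable \<Omega> g"
      by (rule Lspace_locally_integrable[OF m wL] Lspace_locally_integrable[OF m g])+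
    fix \<phi> assume \<phi>: "\<phi> \<in> test_functions \<Omega>"
    let ?K = "closure {x. \<phi> x \<noteq> 0}"
    have cK: "compact ?K" using \<phi> by (auto simp: test_functions_def)
    have "compact (classical_gradient \<phi> ` ?K)" "compact (\<phi> ` ?K)"
      by (intro compact_continuous_image cK continuous_on_subset[OF test_function_derivative(2)[OF \<phi>]]
          continuous_on_subset[OF test_function_derivative(3)[OF \<phi>]] subset_UNIV)+
    then obtain B1 B2 where B12: "\<And>x. x \<in> ?K \<Longrightarrow> norm (classical_gradient \<phi> x) \<le> B1" "\<And>x. x \<in> ?K \<Longrightarrow> norm (\<phi> x) \<le> B2"
      unfolding compact_eq_bounded_closed bounded_iff by blast
    have B1: "norm (classical_gradient \<phi> x) \<le> \<bar>B1\<bar>" for x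
      using B12(1)[of x] classical_gradient_outside_support[of x \<phi>]
      by (cases "x \<in> ?K") (auto intro: order_trans)
    have B2: "norm (\<phi> x) \<le> \<bar>B2\<bar>" for x
      using B12(2)[of x] closure_subset[of "{x. \<phi> x \<noteq> 0}"]
      by (cases "\<phi> x = 0") (auto intro: order_trans)
    have "(\<lambda>n. \<integral>x. u n x *\<^sub>R classical_gradient \<phi> x \<partial>lebesgue_on \<Omega>) \<longlonglongrightarrow>
        (\<integral>x. w x *\<^sub>R classical_gradient \<phi> x \<partial>lebesgue_on \<Omega>)"
    proof (rule integral_tendsto_Lspace[OF m uL wL lim0])
      fix n x
      show "norm (u n x *\<^sub>R classical_gradient \<phi> x - w x *\<^sub>R classical_gradient \<phi> x) \<le> \<bar>B1\<bar> * norm (u n x - w x)"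
        using mult_right_mono[OF B1[of x] norm_ge_zero[of "u n x - w x"]]
        by (simp add: scaleR_diff_left[symmetric] mult.commute)
    qed (rule test_function_integrable(2)[OF \<phi> dom_lebesgue] Lspace_locally_integrable[OF m] uL wl)+
    moreover have "(\<lambda>n. \<integral>x. \<phi> x *\<^sub>R grad (u n) x \<partial>lebesgue_on \<Omega>) \<longlonglongrightarrow> (\<integral>x. \<phi> x *\<^sub>R g x \<partial>lebesgue_on \<Omega>)"
    proof (rule integral_tendsto_Lspace[OF m guL g lim])
      fix n x
      show "norm (\<phi> x *\<^sub>R grad (u n) x - \<phi> x *\<^sub>R g x) \<le> \<bar>B2\<bar> * norm (grad (u n) x - g x)"
        using mult_right_mono[OF B2[of x] norm_ge_zero[of "grad (u n) x - g x"]]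
        by (simp add: scaleR_diff_right[symmetric])
    qed (rule test_function_integrable(1)[OF \<phi> dom_lebesgue] Lspace_locally_integrable[OF m] guL gl)+
    moreover have "(\<integral>x. u n x *\<^sub>R classical_gradient \<phi> x \<partial>lebesgue_on \<Omega>) =
       - (\<integral>x. \<phi> x *\<^sub>R grad (u n) x \<partial>lebesgue_on \<Omega>)" for n
      using W10D(3)[OF u] \<phi> by (simp add: is_weak_gradient_def)
    ultimately have "(\<lambda>n. - (\<integral>x. \<phi> x *\<^sub>R grad (u n) x \<partial>lebesgue_on \<Omega>)) \<longlonglongrightarrow>
        (\<integral>x. w x *\<^sub>R classical_gradient \<phi> x \<partial>lebesgue_on \<Omega>)"
      "(\<lambda>n. - (\<integral>x. \<phi> x *\<^sub>R grad (u n) x \<partial>lebesgue_on \<Omega>)) \<longlonglongrightarrow> - (\<integral>x. \<phi> x *\<^sub>R g x \<partial>lebesgue_on \<Omega>)"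
      by (auto intro: tendsto_minus)
    then show "(\<integral>x. w x *\<^sub>R classical_gradient \<phi> x \<partial>lebesgue_on \<Omega>) = - (\<integral>x. \<phi> x *\<^sub>R g x \<partial>lebesgue_on \<Omega>)"
      by (rule LIMSEQ_unique)
  qed
  have W: "w \<in> W1 \<Omega> m" by (rule W1I[OF wL g wg])
  show ae: "AE x in lebesgue_on \<Omega>. grad w x = g x" by (rule grad_eq(1)[OF g wg])
  have gradlim: "L m (\<lambda>x. f x - grad w x) = L m (\<lambda>x. f x - g x)" if "f \<in> Lspace \<Omega> m" for f
    by (rule Lnorm_cong_AE[OF Lspace_measurable[OF Lspace_diff[OF m that W1D(2)[OF W]]]
          Lspace_measurable[OF Lspace_diff[OF m that g]]]) (use ae in \<open>auto elim: eventually_mono\<close>)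
  show "w \<in> W10 \<Omega> m"
  proof (rule W10I[OF m W])
    fix e :: real assume e: "e > 0"
    have e2: "e / 2 > 0" using e by simp
    have "eventually (\<lambda>n. L m (\<lambda>x. u n x - w x) < e / 2 \<and> L m (\<lambda>x. grad (u n) x - g x) < e / 2) sequentially"
      using order_tendstoD(2)[OF lim0 e2] order_tendstoD(2)[OF lim e2] by (rule eventually_conj)
    then obtain n where n: "L m (\<lambda>x. u n x - w x) < e / 2" "L m (\<lambda>x. grad (u n) x - g x) < e / 2"
      by (auto simp: eventually_sequentially)
    \<comment> \<open>A test function close to one \<open>u n\<close> that is itself close to
      \<open>w\<close>; the triangle inequality does the rest.\<close>
    obtain \<phi> where \<phi>: "\<phi> \<in> test_functions \<Omega>" "L m (\<lambda>x. \<phi> x - u n x) \<le> e / 2"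
      "L m (\<lambda>x. classical_gradient \<phi> x - grad (u n) x) \<le> e / 2" using W10_approx[OF m u e2] .
    note l = test_function_Lspace(1,2)[OF \<phi>(1) dom_lebesgue m0]
    show "\<exists>\<phi>\<in>test_functions \<Omega>. L m (\<lambda>x. \<phi> x - w x) \<le> e \<and> L m (\<lambda>x. classical_gradient \<phi> x - grad w x) \<le> e"
    proof (intro bexI[OF _ \<phi>(1)] conjI)
      show "L m (\<lambda>x. \<phi> x - w x) \<le> e"
        using Lnorm_triangle3[OF m l(1) uL[of n] wL] n \<phi> by simp
      show "L m (\<lambda>x. classical_gradient \<phi> x - grad w x) \<le> e"
        unfolding gradlim[OF l(2)]
        using Lnorm_triangle3[OF m l(2) guL[of n] g] n \<phi> by simp
    qed
  qed
  have "L m (grad (\<lambda>x. u n x - w x)) = L m (\<lambda>x. grad (u n) x - g x)" for n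
    using Lnorm_grad_comb[OF m W10_W1[OF u] W, of m 1 _ "-1"] gradlim[OF guL] by simp
  then have up: "W1_norm \<Omega> m (\<lambda>x. u n x - w x) \<le> L m (\<lambda>x. u n x - w x) + L m (\<lambda>x. grad (u n) x - g x)" for n
    using W1_norm_bounds(3)[OF m, of "\<lambda>x. u n x - w x"] by simp
  show "(\<lambda>n. W1_norm \<Omega> m (\<lambda>x. u n x - w x)) \<longlonglongrightarrow> 0"
  proof (rule tendsto_sandwich[where f = "\<lambda>_. 0"])
    show "(\<lambda>n. L m (\<lambda>x. u n x - w x) + L m (\<lambda>x. grad (u n) x - g x)) \<longlonglongrightarrow> 0"
      using tendsto_add[OF lim0 lim] by simp
    show "\<forall>\<^sub>F n in sequentially. W1_norm \<Omega> m (\<lambda>x. u n x - w x) \<le> L m (\<lambda>x. u n x - w x) + L m (\<lambda>x. grad (u n) x - g x)"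
      by (intro always_eventually allI up)
    show "\<forall>\<^sub>F n in sequentially. 0 \<le> W1_norm \<Omega> m (\<lambda>x. u n x - w x)"
      by (simp add: W1_norm_def)
  qed simp
qed

end

section \<open>Convergence of minimizers\<close>

lemma powr_inverse_tendsto_1:
  fixes c :: real
  assumes "c > 0"
  shows "((\<lambda>r. c powr (1 / r)) \<longlongrightarrow> 1) at_top"
proof -
  have "((\<lambda>r::real. 1 / r) \<longlongrightarrow> 0) at_top"
    using tendsto_inverse_0_at_top[OF filterlim_ident] by (simp add: inverse_eq_divide)
  then have "((\<lambda>r. c powr (1 / r)) \<longlongrightarrow> c powr 0) at_top"
    using assms by (intro tendsto_intros) auto
  then show ?thesis using assms by simp
qed

lemma Lnorm_geI:
  assumes "m > 0" "c powr m \<le> (\<integral>x. norm (f x) powr m \<partial>lebesgue_on \<Omega>)" "0 \<le> c"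
  shows "c \<le> Lnorm \<Omega> (ereal m) f"
proof -
  have "(c powr m) powr (1 / m) \<le> Lnorm \<Omega> (ereal m) f"
    unfolding Lnorm_finite using assms by (intro powr_mono2) auto
  then show ?thesis using assms by (simp add: powr_powr)
qed

locale nonempty_bounded_open = bounded_open +
  assumes nonempty_dom: "\<Omega> \<noteq> {}"
begin

text \<open>Excludes a null domain, on which every essential supremum would be -\<infinity>.\<close>

lemma emeasure_dom_pos: "emeasure (lebesgue_on \<Omega>) (space (lebesgue_on \<Omega>)) \<noteq> 0"
  using open_not_negligible[OF open_dom nonempty_dom]
  by (simp add: negligible_iff_emeasure0 emeasure_restrict_space)

lemma measure_dom_pos: "measure lebesgue \<Omega> > 0"
  using open_not_negligible[OF open_dom nonempty_dom] dom_lmeasurable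
  by (metis negligible_iff_measure0 measure_nonneg less_le)

text \<open>The a.e. bound makes the essential supremum finite, so that \<open>real_of_ereal\<close>
  does not fall back to its default 0.\<close>

lemma Lnorm_infinity:
  fixes f :: "'a \<Rightarrow> real"
  assumes f: "f \<in> borel_measurable (lebesgue_on \<Omega>)" and B: "AE x in lebesgue_on \<Omega>. \<bar>f x\<bar> \<le> B"
  shows "AE x in lebesgue_on \<Omega>. \<bar>f x\<bar> \<le> Lnorm \<Omega> \<infinity> f" "0 \<le> Lnorm \<Omega> \<infinity> f"
    "(AE x in lebesgue_on \<Omega>. \<bar>f x\<bar> \<le> c) \<Longrightarrow> Lnorm \<Omega> \<infinity> f \<le> c"
proof -
  define E where "E = esssup (lebesgue_on \<Omega>) (\<lambda>x. ereal \<bar>f x\<bar>)"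
  have fm: "(\<lambda>x. ereal \<bar>f x\<bar>) \<in> borel_measurable (lebesgue_on \<Omega>)" using f by measurable
  have le: "E \<le> ereal c" if "AE x in lebesgue_on \<Omega>. \<bar>f x\<bar> \<le> c" for c
    unfolding E_def using that by (intro esssup_I fm) auto
  have "esssup (lebesgue_on \<Omega>) (\<lambda>x. 0 :: ereal) \<le> E"
    unfolding E_def by (intro esssup_mono) auto
  then have E0: "0 \<le> E" by (simp add: esssup_const[OF emeasure_dom_pos])
  then obtain e where e: "E = ereal e" using le[OF B] by (cases E) auto
  have N: "Lnorm \<Omega> \<infinity> f = e" by (simp add: Lnorm_def E_def[symmetric] e)
  show "AE x in lebesgue_on \<Omega>. \<bar>f x\<bar> \<le> Lnorm \<Omega> \<infinity> f"
    using esssup_AE[of "\<lambda>x. ereal \<bar>f x\<bar>" "lebesgue_on \<Omega>"] by (simp add: E_def[symmetric] e N)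
  show "0 \<le> Lnorm \<Omega> \<infinity> f" using E0 by (simp add: N e)
  show "(AE x in lebesgue_on \<Omega>. \<bar>f x\<bar> \<le> c) \<Longrightarrow> Lnorm \<Omega> \<infinity> f \<le> c"
    using le[of c] by (simp add: N e)
qed

text \<open>Uniformity over all \<open>h\<close> near \<open>f\<close> is needed because the
  functions change together with the exponent. From above, |h| is at most S + \<delta>; from below,
  it exceeds S - 2 \<delta> on a fixed set of positive measure; and c^(1/r) tends to 1 for every c >
  0.\<close>

lemma Lnorm_near_infinity:
  fixes f :: "'a \<Rightarrow> real"
  assumes f: "f \<in> borel_measurable (lebesgue_on \<Omega>)" and B: "AE x in lebesgue_on \<Omega>. \<bar>f x\<bar> \<le> B"
    and \<eta>: "\<eta> > 0"
  obtains \<delta> where "\<delta> > 0"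
    "\<forall>\<^sub>F r in at_top. \<forall>h. h \<in> borel_measurable (lebesgue_on \<Omega>) \<and>
       (AE x in lebesgue_on \<Omega>. \<bar>h x - f x\<bar> \<le> \<delta>) \<longrightarrow> \<bar>L r h - Lnorm \<Omega> \<infinity> f\<bar> \<le> \<eta>"
proof -
  define S where "S = Lnorm \<Omega> \<infinity> f"
  note I = Lnorm_infinity[OF f B, folded S_def]
  \<comment> \<open>A quarter leaves a strict margin on both sides: S + \<delta> < S + \<eta> and S
    - 2 \<delta> > S - \<eta>.\<close>
  define \<delta> where "\<delta> = \<eta> / 4"
  have \<delta>: "\<delta> > 0" using \<eta> by (simp add: \<delta>_def)
  define E where "E = {x \<in> \<Omega>. \<bar>f x\<bar> > S - \<delta>}"
  have Es: "E \<in> sets (lebesgue_on \<Omega>)"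
  proof -
    have "{x \<in> space (lebesgue_on \<Omega>). \<bar>f x\<bar> > S - \<delta>} \<in> sets (lebesgue_on \<Omega>)" using f by measurable
    then show ?thesis by (simp add: E_def)
  qed
  have EO: "E \<inter> \<Omega> = E" by (auto simp: E_def)
  interpret finite_measure "lebesgue_on \<Omega>" by (rule finite_measure_lebesgue_on[OF dom_lmeasurable])
  \<comment> \<open>If \<open>E\<close> were null, \<open>S - \<delta>\<close> would be an a.e.
    bound below the essential supremum \<open>S\<close>.\<close>
  have Epos: "measure (lebesgue_on \<Omega>) E > 0"
  proof (rule ccontr)
    assume "\<not> measure (lebesgue_on \<Omega>) E > 0"
    then have "measure (lebesgue_on \<Omega>) E = 0" using measure_nonneg[of "lebesgue_on \<Omega>" E] by linarith
    then have "E \<in> null_sets (lebesgue_on \<Omega>)" using Es by (simp add: null_sets_def emeasure_eq_measure)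
    then have "AE x in lebesgue_on \<Omega>. x \<notin> E" by (rule AE_not_in)
    then have "AE x in lebesgue_on \<Omega>. \<bar>f x\<bar> \<le> S - \<delta>"
      using AE_space by eventually_elim (auto simp: E_def)
    from I(3)[OF this] \<delta> show False by simp
  qed
  have lim1: "((\<lambda>r. measure lebesgue \<Omega> powr (1 / r) * (S + \<delta>)) \<longlongrightarrow> 1 * (S + \<delta>)) at_top"
    by (intro tendsto_intros powr_inverse_tendsto_1 measure_dom_pos)
  have lim2: "((\<lambda>r. measure (lebesgue_on \<Omega>) E powr (1 / r) * (S - 2 * \<delta>)) \<longlongrightarrow> 1 * (S - 2 * \<delta>)) at_top"
    by (intro tendsto_intros powr_inverse_tendsto_1 Epos)
  have ev1: "\<forall>\<^sub>F r in at_top. measure lebesgue \<Omega> powr (1 / r) * (S + \<delta>) < S + \<eta>"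
    using \<eta> by (intro order_tendstoD(2)[OF lim1]) (simp add: \<delta>_def)
  have ev2: "\<forall>\<^sub>F r in at_top. S - \<eta> < measure (lebesgue_on \<Omega>) E powr (1 / r) * (S - 2 * \<delta>)"
    using \<eta> by (intro order_tendstoD(1)[OF lim2]) (simp add: \<delta>_def)
  have "\<forall>\<^sub>F r in at_top. \<forall>h. h \<in> borel_measurable (lebesgue_on \<Omega>) \<and>
       (AE x in lebesgue_on \<Omega>. \<bar>h x - f x\<bar> \<le> \<delta>) \<longrightarrow> \<bar>L r h - S\<bar> \<le> \<eta>"
    using ev1 ev2 eventually_gt_at_top[of "0::real"]
  proof eventually_elim
    case (elim r)
    show ?case
    proof (intro allI impI, elim conjE)
      fix h :: "'a \<Rightarrow> real"
      assume h: "h \<in> borel_measurable (lebesgue_on \<Omega>)" and hf: "AE x in lebesgue_on \<Omega>. \<bar>h x - f x\<bar> \<le> \<delta>"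
      have hb: "AE x in lebesgue_on \<Omega>. norm (h x) \<le> S + \<delta>"
        using hf I(1) by eventually_elim (auto simp: abs_if split: if_splits)
      note hL = Lnorm_AE_bound[OF h elim(3) _ hb]
      have up: "L r h \<le> S + \<eta>" using hL(2) elim(1) I(2) \<delta> by simp
      have low: "S - \<eta> \<le> L r h"
      proof (cases "S - 2 * \<delta> \<le> 0")
        case True
        then show ?thesis using Lnorm_nonneg[of \<Omega> r h] \<eta> by (simp add: \<delta>_def)
      next
        case False
        define a where "a = S - 2 * \<delta>"
        have a: "a > 0" using False by (simp add: a_def)
        have "measure (lebesgue_on \<Omega>) E * a powr r = (\<integral>x. indicator E x * a powr r \<partial>lebesgue_on \<Omega>)"
          using Es by (simp add: EO)
        also have "\<dots> \<le> (\<integral>x. norm (h x) powr r \<partial>lebesgue_on \<Omega>)"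
        proof (rule integral_mono_AE)
          show "integrable (lebesgue_on \<Omega>) (\<lambda>x. indicator E x * a powr r)"
            using Es by (intro integrable_mult_left) (simp add: integrable_indicator_iff emeasure_eq_measure EO)
          show "integrable (lebesgue_on \<Omega>) (\<lambda>x. norm (h x) powr r)"
            using Lspace_integrable[OF hL(1)] I(2) \<delta> by simp
          show "AE x in lebesgue_on \<Omega>. indicator E x * a powr r \<le> norm (h x) powr r"
            using hf
          proof eventually_elim
            case (elim x)
            show ?case
            proof (cases "x \<in> E")
              case True
              then have "a \<le> norm (h x)" using elim by (auto simp: E_def a_def)
              then show ?thesis using True a \<open>0 < r\<close> by (simp add: powr_mono2)
            qed simp
          qed
        qed
        also have "measure (lebesgue_on \<Omega>) E * a powr r = (measure (lebesgue_on \<Omega>) E powr (1 / r) * a) powr r"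
          using elim(3) by (simp add: powr_mult powr_powr)
        finally have "measure (lebesgue_on \<Omega>) E powr (1 / r) * a \<le> L r h"
          using a elim(3) by (intro Lnorm_geI) auto
        then show ?thesis using elim(2) by (simp add: a_def)
      qed
      show "\<bar>L r h - S\<bar> \<le> \<eta>" using up low by linarith
    qed
  qed
  with \<delta> show ?thesis unfolding S_def by (rule that)
qed

lemma Lnorm_powr_near_infinity:
  fixes f :: "'a \<Rightarrow> real" and p :: real
  assumes f: "f \<in> borel_measurable (lebesgue_on \<Omega>)" and B: "AE x in lebesgue_on \<Omega>. \<bar>f x\<bar> \<le> B"
    and p: "p > 0" and \<epsilon>: "\<epsilon> > 0"
  obtains \<delta> where "\<delta> > 0"
    "\<forall>\<^sub>F r in at_top. \<forall>h. h \<in> borel_measurable (lebesgue_on \<Omega>) \<and>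
       (AE x in lebesgue_on \<Omega>. \<bar>h x - f x\<bar> \<le> \<delta>) \<longrightarrow> \<bar>L r h powr p - Lnorm \<Omega> \<infinity> f powr p\<bar> \<le> \<epsilon>"
proof -
  have "continuous_on {0..} (\<lambda>t::real. t powr p)"
    using p by (intro continuous_on_powr' continuous_intros) auto
  then obtain \<eta> where \<eta>: "\<eta> > 0" "\<And>t. t \<ge> 0 \<Longrightarrow> \<bar>t - Lnorm \<Omega> \<infinity> f\<bar> < \<eta> \<Longrightarrow> \<bar>t powr p - Lnorm \<Omega> \<infinity> f powr p\<bar> < \<epsilon>"
    using Lnorm_infinity(2)[OF f B] \<epsilon> unfolding continuous_on_iff dist_real_def
    by (metis atLeast_iff)
  obtain \<delta> where \<delta>: "\<delta> > 0"
    "\<forall>\<^sub>F r in at_top. \<forall>h. h \<in> borel_measurable (lebesgue_on \<Omega>) \<and>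
       (AE x in lebesgue_on \<Omega>. \<bar>h x - f x\<bar> \<le> \<delta>) \<longrightarrow> \<bar>L r h - Lnorm \<Omega> \<infinity> f\<bar> \<le> \<eta> / 2"
    using Lnorm_near_infinity[OF f B, of "\<eta> / 2"] \<eta>(1) by auto
  have "\<forall>\<^sub>F r in at_top. \<forall>h. h \<in> borel_measurable (lebesgue_on \<Omega>) \<and>
       (AE x in lebesgue_on \<Omega>. \<bar>h x - f x\<bar> \<le> \<delta>) \<longrightarrow> \<bar>L r h powr p - Lnorm \<Omega> \<infinity> f powr p\<bar> \<le> \<epsilon>"
    using \<delta>(2)
  proof eventually_elim
    case (elim r)
    show ?case
    proof (intro allI impI)
      fix h :: "'a \<Rightarrow> real"
      assume "h \<in> borel_measurable (lebesgue_on \<Omega>) \<and> (AE x in lebesgue_on \<Omega>. \<bar>h x - f x\<bar> \<le> \<delta>)"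
      then have "\<bar>L r h - Lnorm \<Omega> \<infinity> f\<bar> \<le> \<eta> / 2" using elim by blast
      then show "\<bar>L r h powr p - Lnorm \<Omega> \<infinity> f powr p\<bar> \<le> \<epsilon>"
        using \<eta>(2)[OF Lnorm_nonneg, of \<Omega> r h] \<eta>(1) by simp
    qed
  qed
  with \<delta>(1) show ?thesis by (rule that)
qed

lemma Lnorm_tendsto_infinity:
  fixes f :: "'a \<Rightarrow> real" and h :: "nat \<Rightarrow> 'a \<Rightarrow> real"
  assumes f: "f \<in> borel_measurable (lebesgue_on \<Omega>)" and B: "AE x in lebesgue_on \<Omega>. \<bar>f x\<bar> \<le> B"
    and h: "\<And>n. h n \<in> borel_measurable (lebesgue_on \<Omega>)"
    and unif: "\<And>e. e > 0 \<Longrightarrow> \<exists>N. \<forall>n\<ge>N. AE x in lebesgue_on \<Omega>. \<bar>h n x - f x\<bar> \<le> e"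
    and r: "filterlim r at_top sequentially"
  shows "(\<lambda>n. L (r n) (h n)) \<longlonglongrightarrow> Lnorm \<Omega> \<infinity> f"
proof (rule LIMSEQ_I)
  fix e :: real assume e: "e > 0"
  obtain \<delta> where \<delta>: "\<delta> > 0"
    "\<forall>\<^sub>F r in at_top. \<forall>h. h \<in> borel_measurable (lebesgue_on \<Omega>) \<and>
       (AE x in lebesgue_on \<Omega>. \<bar>h x - f x\<bar> \<le> \<delta>) \<longrightarrow> \<bar>L r h - Lnorm \<Omega> \<infinity> f\<bar> \<le> e / 2"
    using Lnorm_near_infinity[OF f B, of "e / 2"] e by auto
  have "\<forall>\<^sub>F n in sequentially. AE x in lebesgue_on \<Omega>. \<bar>h n x - f x\<bar> \<le> \<delta>"
    using unif[OF \<delta>(1)] by (simp add: eventually_sequentially)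
  then have "\<forall>\<^sub>F n in sequentially. norm (L (r n) (h n) - Lnorm \<Omega> \<infinity> f) < e"
    using eventually_compose_filterlim[OF \<delta>(2) r]
  proof eventually_elim
    case (elim n)
    then have "\<bar>L (r n) (h n) - Lnorm \<Omega> \<infinity> f\<bar> \<le> e / 2" using h by blast
    then show ?case using e by simp
  qed
  then show "\<exists>no. \<forall>n\<ge>no. norm (L (r n) (h n) - Lnorm \<Omega> \<infinity> f) < e"
    by (simp add: eventually_sequentially)
qed

text \<open>Both problems fit. For \<open>p < q\<close>, m = q and s = p give the energy. For
  \<open>q < p\<close>, m = p and s = q make every term homogeneous of degree \<open>p\<close>,
  which is why the lower order norm carries the power \<open>p\<close> and not
  \<open>s\<close>.\<close>

definition functional :: "real \<Rightarrow> real \<Rightarrow> real \<Rightarrow> real \<Rightarrow> real \<Rightarrow> real \<Rightarrow> ereal \<Rightarrow> ('a \<Rightarrow> real) \<Rightarrow> real" where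
  "functional al be m s p \<kappa> r w =
     al * L m (grad w) powr m + \<kappa> * L s (grad w) powr p - be * Lnorm \<Omega> r w powr p"

text \<open>Compare \<open>u\<^sub>i\<close> and \<open>u\<^sub>j\<close> with their midpoint: the lower order terms almost cancel, because
  \<open>\<parallel>\<cdot>\<parallel>\<close> of all three tends to the same limit, and Clarkson's inequality bounds the difference of
  the gradients.\<close>
lemma midpoint_estimate:
  assumes m: "m \<ge> 2" and s: "1 \<le> s" "s \<le> m" and p: "p \<ge> 1" and al: "al > 0" and be: "be \<ge> 0"
    and u: "u \<in> W10 \<Omega> m" and v: "v \<in> W10 \<Omega> m"
    and \<kappa>: "\<kappa> \<ge> 0" "\<kappa>' \<ge> 0" "\<bar>\<kappa> - \<kappa>'\<bar> \<le> c"
    and K: "L s (grad u) powr p \<le> K" "L s (grad v) powr p \<le> K"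
    and min: "functional al be m s p \<kappa> r u \<le> functional al be m s p \<kappa> r (\<lambda>x. 1/2 * u x + 1/2 * v x)"
      "functional al be m s p \<kappa>' r' v \<le> functional al be m s p \<kappa>' r' (\<lambda>x. 1/2 * u x + 1/2 * v x)"
    and near: "\<bar>Lnorm \<Omega> r u powr p - S\<bar> \<le> d" "\<bar>Lnorm \<Omega> r' v powr p - S\<bar> \<le> d"
      "\<bar>Lnorm \<Omega> r (\<lambda>x. 1/2 * u x + 1/2 * v x) powr p - S\<bar> \<le> d"
      "\<bar>Lnorm \<Omega> r' (\<lambda>x. 1/2 * u x + 1/2 * v x) powr p - S\<bar> \<le> d"
  shows "2 * al * (1/2 * L m (\<lambda>x. grad u x - grad v x)) powr m \<le> c * K / 2 + 4 * be * d"
proof -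
  have m1: "m \<ge> 1" "m > 0" using m by auto
  let ?h = "\<lambda>x. 1/2 * u x + 1/2 * v x"
  note gu = W10D(2)[OF u] and gv = W10D(2)[OF v]
  note gu' = Lspace_mono[OF dom_lmeasurable _ s(2) gu] and gv' = Lspace_mono[OF dom_lmeasurable _ s(2) gv]
  have gh: "L t (grad ?h) = L t (\<lambda>x. (1/2) *\<^sub>R (grad u x + grad v x))" for t
    using Lnorm_grad_comb[OF m1(1) W10_W1[OF u] W10_W1[OF v], of t "1/2" "1/2"]
    by (simp only: scaleR_add_right)
  define G where "G w = L m (grad w) powr m" for w
  define D where "D w = L s (grad w) powr p" for w
  define X where "X = (1/2 * L m (\<lambda>x. grad u x - grad v x)) powr m"
  have X: "L m (\<lambda>x. (1/2) *\<^sub>R (grad u x - grad v x)) powr m = X"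
    unfolding X_def Lnorm_scaleR[OF m1(2)] by simp
  have G: "G ?h + X \<le> (G u + G v) / 2"
    unfolding G_def gh X[symmetric] by (rule Lnorm_clarkson[OF m gu gv])
  have D: "D ?h \<le> (D u + D v) / 2"
    unfolding D_def gh using s by (intro Lnorm_midpoint_powr gu' gv' p) auto
  have "2 * al * X \<le> al * (G u + G v) - 2 * al * G ?h"
    using mult_left_mono[OF G, of "2 * al"] al by (simp add: algebra_simps)
  \<comment> \<open>Sum of the two minimality inequalities; each of the four zeroth order terms lies
    within \<open>d\<close> of \<open>S\<close>.\<close>
  also have "\<dots> \<le> (\<kappa> + \<kappa>') * D ?h - \<kappa> * D u - \<kappa>' * D v + be * (4 * d)"
  proof -
    have "be * ((Lnorm \<Omega> r u powr p - Lnorm \<Omega> r ?h powr p) + (Lnorm \<Omega> r' v powr p - Lnorm \<Omega> r' ?h powr p)) \<le> be * (4 * d)"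
      using near be by (intro mult_left_mono) auto
    then show ?thesis using min unfolding functional_def G_def D_def by (simp add: algebra_simps)
  qed
  also have "(\<kappa> + \<kappa>') * D ?h \<le> (\<kappa> + \<kappa>') * ((D u + D v) / 2)"
    using D \<kappa> by (intro mult_left_mono) auto
  \<comment> \<open>By convexity the lower order gradient terms cancel up to the difference of the
    two coefficients.\<close>
  also have "(\<kappa> + \<kappa>') * ((D u + D v) / 2) - \<kappa> * D u - \<kappa>' * D v = (\<kappa> - \<kappa>') * (D v - D u) / 2"
    by (simp add: field_simps)
  also have "(\<kappa> - \<kappa>') * (D v - D u) / 2 \<le> c * K / 2"
  proof -
    have "D u \<ge> 0" "D v \<ge> 0" by (auto simp: D_def)
    then have "\<bar>D v - D u\<bar> \<le> K" using K[folded D_def] by linarith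
    then have "\<bar>\<kappa> - \<kappa>'\<bar> * \<bar>D v - D u\<bar> \<le> c * K" using \<kappa>(3) by (intro mult_mono) auto
    then show ?thesis using abs_ge_self[of "(\<kappa> - \<kappa>') * (D v - D u)"] by (simp add: abs_mult)
  qed
  finally show ?thesis by (simp add: X_def algebra_simps)
qed


section \<open>Convergence of sequences of minimizers\<close>

lemma W10_AE_bounded:
  fixes m :: real
  assumes "m > DIM('a)" "u \<in> W10 \<Omega> m"
  obtains B where "AE x in lebesgue_on \<Omega>. \<bar>u x\<bar> \<le> B"
  using W10_sup_bound[OF assms(1)] assms(2) by (metis order_refl)

lemma Lnorm_tendsto_infinity_const:
  fixes m :: real
  assumes "m > DIM('a)" "u \<in> W10 \<Omega> m" "filterlim r at_top sequentially"
  shows "(\<lambda>n. L (r n) u) \<longlonglongrightarrow> Lnorm \<Omega> \<infinity> u"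
proof -
  have um: "u \<in> borel_measurable (lebesgue_on \<Omega>)" by (rule Lspace_measurable[OF W10D(1)[OF assms(2)]])
  obtain B where B: "AE x in lebesgue_on \<Omega>. \<bar>u x\<bar> \<le> B" using W10_AE_bounded[OF assms(1,2)] .
  show ?thesis by (rule Lnorm_tendsto_infinity[OF um B um _ assms(3)]) simp
qed

lemma Lnorm_grad_tendsto:
  assumes m: "m \<ge> 1" and s: "0 < s" "s \<le> m" "1 \<le> s" and f: "\<And>n. f n \<in> Lspace \<Omega> m" and g: "g \<in> Lspace \<Omega> m"
    and lim: "(\<lambda>n. L m (\<lambda>x. f n x - g x)) \<longlonglongrightarrow> 0"
  shows "(\<lambda>n. L s (f n)) \<longlonglongrightarrow> L s g"
proof (rule LIM_zero_cancel, rule Lim_null_comparison)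
  let ?C = "(measure lebesgue \<Omega> + 1) powr (1 / s)"
  show "(\<lambda>n. ?C * L m (\<lambda>x. f n x - g x)) \<longlonglongrightarrow> 0"
    using tendsto_mult[OF tendsto_const[of ?C] lim] by simp
  note mono = Lspace_mono[OF dom_lmeasurable s(1,2)]
  show "\<forall>\<^sub>F n in sequentially. norm (L s (f n) - L s g) \<le> ?C * L m (\<lambda>x. f n x - g x)"
  proof (rule always_eventually, rule allI)
    fix n
    have "norm (L s (f n) - L s g) \<le> L s (\<lambda>x. f n x - g x)"
      using abs_Lnorm_diff_le[OF s(3) mono[OF f] mono[OF g]] by simp
    also have "\<dots> \<le> ?C * L m (\<lambda>x. f n x - g x)"
      by (rule Lnorm_le_Lnorm[OF dom_lmeasurable s(1,2) Lspace_diff[OF m f g]])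
    finally show "norm (L s (f n) - L s g) \<le> ?C * L m (\<lambda>x. f n x - g x)" .
  qed
qed

text \<open>Only nonzero competitors are allowed, and it is the nonnegativity of the
  \<open>u n\<close> that makes their midpoints admissible. The conclusion leaves open whether
  \<open>v\<close> vanishes; the limits of the separate norms let the case \<open>q < p\<close>
  decide this.\<close>

theorem minimizers_converge:
  fixes u :: "nat \<Rightarrow> 'a \<Rightarrow> real" and m s p al be K kap :: real and \<kappa> r :: "nat \<Rightarrow> real"
  assumes mD: "m > DIM('a)" and m: "m \<ge> 2" and s: "1 \<le> s" "s \<le> m" and p: "p \<ge> 1"
    and al: "al > 0" and be: "be \<ge> 0"
    and u: "\<And>n. u n \<in> W10 \<Omega> m" "\<And>n. nonneg_on \<Omega> (u n)" "\<And>n. nonzero_on \<Omega> (u n)"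
    and K: "\<And>n. L m (grad (u n)) \<le> K"
    and \<kappa>: "\<And>n. \<kappa> n \<ge> 0" "\<kappa> \<longlonglongrightarrow> kap" and r: "filterlim r at_top sequentially"
    and min: "\<And>n w. w \<in> W10 \<Omega> m \<Longrightarrow> nonzero_on \<Omega> w \<Longrightarrow>
       functional al be m s p (\<kappa> n) (ereal (r n)) (u n) \<le> functional al be m s p (\<kappa> n) (ereal (r n)) w"
  obtains k :: "nat \<Rightarrow> nat" and v where "strict_mono k" "v \<in> W10 \<Omega> m" "nonneg_on \<Omega> v"
    "(\<lambda>j. W1_norm \<Omega> m (\<lambda>x. u (k j) x - v x)) \<longlonglongrightarrow> 0"
    "(\<lambda>j. L m (grad (u (k j)))) \<longlonglongrightarrow> L m (grad v)"
    "(\<lambda>j. L s (grad (u (k j)))) \<longlonglongrightarrow> L s (grad v)"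
    "(\<lambda>j. L (r (k j)) (u (k j))) \<longlonglongrightarrow> Lnorm \<Omega> \<infinity> v"
    "\<And>w. w \<in> W10 \<Omega> m \<Longrightarrow> nonzero_on \<Omega> w \<Longrightarrow>
       functional al be m s p kap \<infinity> v \<le> functional al be m s p kap \<infinity> w"
proof -
  have m1: "m \<ge> 1" "m > 0" and s0: "s > 0" and p0: "p > 0" using m s p by auto
  obtain w and k :: "nat \<Rightarrow> nat" and B where k: "strict_mono k"
    and wm: "w \<in> borel_measurable (lebesgue_on \<Omega>)" and wB: "\<And>x. x \<in> \<Omega> \<Longrightarrow> \<bar>w x\<bar> \<le> B"
    and unif: "\<And>e. e > 0 \<Longrightarrow> \<exists>N. \<forall>n\<ge>N. AE x in lebesgue_on \<Omega>. \<bar>u (k n) x - w x\<bar> \<le> e"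
    by (rule W10_compact[of m u K, OF mD u(1) K]) (rule that)
  have wB': "AE x in lebesgue_on \<Omega>. \<bar>w x\<bar> \<le> B" using wB by (intro AE_I2) simp
  define U where "U j = u (k j)" for j
  have U: "U j \<in> W10 \<Omega> m" "nonneg_on \<Omega> (U j)" "nonzero_on \<Omega> (U j)" for j
    using u by (auto simp: U_def)
  have Um: "U j \<in> borel_measurable (lebesgue_on \<Omega>)" for j
    by (rule Lspace_measurable[OF W10D(1)[OF U(1)]])
  have gU: "grad (U j) \<in> Lspace \<Omega> m" for j by (rule W10D(2)[OF U(1)])
  define S where "S = Lnorm \<Omega> \<infinity> w powr p"
  define C where "C = (measure lebesgue \<Omega> + 1) powr (1 / s)"
  define D where "D = (C * \<bar>K\<bar>) powr p"
  have DU: "L s (grad (U j)) powr p \<le> D" for j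
  proof -
    have "L s (grad (U j)) \<le> C * L m (grad (U j))"
      unfolding C_def by (rule Lnorm_le_Lnorm[OF dom_lmeasurable s0 s(2) gU])
    also have "\<dots> \<le> C * \<bar>K\<bar>"
      using K[of "k j"] by (intro mult_left_mono) (auto simp: U_def C_def)
    finally show ?thesis unfolding D_def using p Lnorm_nonneg by (intro powr_mono2) auto
  qed
  have D0: "D \<ge> 0" by (simp add: D_def)
  have rk: "filterlim (\<lambda>j. r (k j)) at_top sequentially"
    by (rule filterlim_compose[OF r filterlim_subseq[OF k]])
  have \<kappa>k: "(\<lambda>j. \<kappa> (k j)) \<longlonglongrightarrow> kap"
    using LIMSEQ_subseq_LIMSEQ[OF \<kappa>(2) k] by (simp add: o_def)
  have cauchy_powr: "\<exists>N. \<forall>i\<ge>N. \<forall>j\<ge>N. (1/2 * L m (\<lambda>x. grad (U i) x - grad (U j) x)) powr m \<le> \<epsilon>" if \<epsilon>: "\<epsilon> > 0" for \<epsilon>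
  proof -
    \<comment> \<open>\<open>d\<close> and \<open>c\<close> are chosen so that each of the two
      errors in \<open>midpoint_estimate\<close> is at most \<open>al * \<epsilon>\<close>, to be
      cancelled against the factor \<open>2 * al\<close>.\<close>
    define d where "d = al * \<epsilon> / (4 * (be + 1))"
    have d: "d > 0" "4 * be * d \<le> al * \<epsilon>" using al be \<epsilon> by (auto simp: d_def field_simps)
    define c where "c = al * \<epsilon> / (D + 1)"
    have c: "c > 0" "c * D / 2 \<le> al * \<epsilon>"
    proof -
      show "c > 0" using al \<epsilon> D0 by (simp add: c_def add_nonneg_pos)
      then have "c * D / 2 \<le> c * (D + 1)" using D0 by (simp add: field_simps)
      also have "c * (D + 1) = al * \<epsilon>" using D0 by (simp add: c_def)
      finally show "c * D / 2 \<le> al * \<epsilon>" .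
    qed
    obtain \<delta> where \<delta>: "\<delta> > 0"
      "\<forall>\<^sub>F r in at_top. \<forall>h. h \<in> borel_measurable (lebesgue_on \<Omega>) \<and>
       (AE x in lebesgue_on \<Omega>. \<bar>h x - w x\<bar> \<le> \<delta>) \<longrightarrow> \<bar>L r h powr p - Lnorm \<Omega> \<infinity> w powr p\<bar> \<le> d"
      using Lnorm_powr_near_infinity[OF wm wB' p0 d(1)] .
    have "\<forall>\<^sub>F j in sequentially. AE x in lebesgue_on \<Omega>. \<bar>U j x - w x\<bar> \<le> \<delta>"
      using unif[OF \<delta>(1)] by (simp add: eventually_sequentially U_def)
    moreover have "\<forall>\<^sub>F j in sequentially. \<bar>\<kappa> (k j) - kap\<bar> < c / 2"
      using tendstoD[OF \<kappa>k, of "c / 2"] c(1) by (simp add: dist_real_def)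
    ultimately have "\<forall>\<^sub>F j in sequentially. (AE x in lebesgue_on \<Omega>. \<bar>U j x - w x\<bar> \<le> \<delta>) \<and> \<bar>\<kappa> (k j) - kap\<bar> < c / 2 \<and>
      (\<forall>h. h \<in> borel_measurable (lebesgue_on \<Omega>) \<and>
       (AE x in lebesgue_on \<Omega>. \<bar>h x - w x\<bar> \<le> \<delta>) \<longrightarrow> \<bar>L (r (k j)) h powr p - S\<bar> \<le> d)"
      using eventually_compose_filterlim[OF \<delta>(2) rk] unfolding S_def by eventually_elim blast
    then obtain N where NN: "\<forall>j\<ge>N. (AE x in lebesgue_on \<Omega>. \<bar>U j x - w x\<bar> \<le> \<delta>) \<and> \<bar>\<kappa> (k j) - kap\<bar> < c / 2 \<and>
      (\<forall>h. h \<in> borel_measurable (lebesgue_on \<Omega>) \<and>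
       (AE x in lebesgue_on \<Omega>. \<bar>h x - w x\<bar> \<le> \<delta>) \<longrightarrow> \<bar>L (r (k j)) h powr p - S\<bar> \<le> d)"
      unfolding eventually_sequentially by (elim exE)
    have N: "\<And>j. j \<ge> N \<Longrightarrow> AE x in lebesgue_on \<Omega>. \<bar>U j x - w x\<bar> \<le> \<delta>"
      "\<And>j. j \<ge> N \<Longrightarrow> \<bar>\<kappa> (k j) - kap\<bar> < c / 2"
      "\<And>j h. j \<ge> N \<Longrightarrow> h \<in> borel_measurable (lebesgue_on \<Omega>) \<Longrightarrow>
       (AE x in lebesgue_on \<Omega>. \<bar>h x - w x\<bar> \<le> \<delta>) \<Longrightarrow> \<bar>L (r (k j)) h powr p - S\<bar> \<le> d"
      using NN by blast+
    have "(1/2 * L m (\<lambda>x. grad (U i) x - grad (U j) x)) powr m \<le> \<epsilon>" if i: "i \<ge> N" and j: "j \<ge> N" for i j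
    proof -
      let ?h = "\<lambda>x. 1/2 * U i x + 1/2 * U j x"
      have hW: "?h \<in> W10 \<Omega> m" by (rule W10_comb[OF m1(1) U(1) U(1)])
      have hm: "?h \<in> borel_measurable (lebesgue_on \<Omega>)" by (rule Lspace_measurable[OF W10D(1)[OF hW]])
      have hw: "AE x in lebesgue_on \<Omega>. \<bar>?h x - w x\<bar> \<le> \<delta>"
        using N(1)[OF i] N(1)[OF j] by eventually_elim (auto simp: abs_le_iff)
      \<comment> \<open>Two nonnegative functions whose sum vanishes both vanish.\<close>
      have hnz: "nonzero_on \<Omega> ?h"
        unfolding nonzero_on_def
      proof
        assume "AE x in lebesgue_on \<Omega>. ?h x = 0"
        with U(2)[of i, unfolded nonneg_on_def] U(2)[of j, unfolded nonneg_on_def]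
        have "AE x in lebesgue_on \<Omega>. U i x = 0" by eventually_elim linarith
        then show False using U(3)[of i] by (simp add: nonzero_on_def)
      qed
      have "2 * al * (1/2 * L m (\<lambda>x. grad (U i) x - grad (U j) x)) powr m \<le> c * D / 2 + 4 * be * d"
      proof (rule midpoint_estimate[OF m s p al be U(1) U(1) \<kappa>(1) \<kappa>(1) _ DU DU])
        show "\<bar>\<kappa> (k i) - \<kappa> (k j)\<bar> \<le> c" using N(2)[OF i] N(2)[OF j] by linarith
        show "functional al be m s p (\<kappa> (k i)) (ereal (r (k i))) (U i) \<le> functional al be m s p (\<kappa> (k i)) (ereal (r (k i))) ?h"
          unfolding U_def using min[OF hW hnz, of "k i"] by (simp add: U_def)
        show "functional al be m s p (\<kappa> (k j)) (ereal (r (k j))) (U j) \<le> functional al be m s p (\<kappa> (k j)) (ereal (r (k j))) ?h"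
          unfolding U_def using min[OF hW hnz, of "k j"] by (simp add: U_def)
        show "\<bar>L (r (k i)) (U i) powr p - S\<bar> \<le> d" by (rule N(3)[OF i Um N(1)[OF i]])
        show "\<bar>L (r (k j)) (U j) powr p - S\<bar> \<le> d" by (rule N(3)[OF j Um N(1)[OF j]])
        show "\<bar>L (r (k i)) ?h powr p - S\<bar> \<le> d" by (rule N(3)[OF i hm hw])
        show "\<bar>L (r (k j)) ?h powr p - S\<bar> \<le> d" by (rule N(3)[OF j hm hw])
      qed
      also have "\<dots> \<le> 2 * al * \<epsilon>" using c(2) d(2) by linarith
      finally show ?thesis using al by simp
    qed
    then show ?thesis by blast
  qed
  have cauchy: "\<exists>N. \<forall>i\<ge>N. \<forall>j\<ge>N. L m (\<lambda>x. grad (U i) x - grad (U j) x) \<le> e" if e: "e > 0" for e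
  proof -
    have "L m (\<lambda>x. grad (U i) x - grad (U j) x) \<le> e"
      if "(1/2 * L m (\<lambda>x. grad (U i) x - grad (U j) x)) powr m \<le> (e / 2) powr m" for i j
    proof -
      have "1/2 * L m (\<lambda>x. grad (U i) x - grad (U j) x) \<le> e / 2"
      proof (rule ccontr)
        assume "\<not> ?thesis"
        then have "(e / 2) powr m < (1/2 * L m (\<lambda>x. grad (U i) x - grad (U j) x)) powr m"
          using e m1 by (intro powr_less_mono2) auto
        then show False using that by simp
      qed
      then show ?thesis by simp
    qed
    moreover have "(e / 2) powr m > 0" using e by simp
    ultimately show ?thesis using cauchy_powr by blast
  qed
  obtain g where g: "g \<in> Lspace \<Omega> m" "(\<lambda>n. L m (\<lambda>x. grad (U n) x - g x)) \<longlonglongrightarrow> 0"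
    using Lspace_complete[OF dom_lmeasurable m1(1) gU cauchy] .
  have unifU: "\<exists>N. \<forall>n\<ge>N. AE x in lebesgue_on \<Omega>. \<bar>U n x - w x\<bar> \<le> e" if "e > 0" for e
    unfolding U_def by (rule unif[OF that])
  note closed = W10_closed[OF m1(1) U(1) wm wB unifU g]
  note gw = W10D(2)[OF closed(1)]
  have Lg: "L t g = L t (grad w)" for t
    by (rule Lnorm_cong_AE[OF Lspace_measurable[OF g(1)] Lspace_measurable[OF gw]])
      (use closed(2) in \<open>auto elim: eventually_mono\<close>)
  have limm: "(\<lambda>j. L m (grad (U j))) \<longlonglongrightarrow> L m (grad w)"
    using Lnorm_grad_tendsto[OF m1(1) m1(2) order_refl m1(1) gU g] by (simp add: Lg)
  have lims: "(\<lambda>j. L s (grad (U j))) \<longlonglongrightarrow> L s (grad w)"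
    using Lnorm_grad_tendsto[OF m1(1) s0 s(2) s(1) gU g] by (simp add: Lg)
  have limr: "(\<lambda>j. L (r (k j)) (U j)) \<longlonglongrightarrow> Lnorm \<Omega> \<infinity> w"
    by (rule Lnorm_tendsto_infinity[OF wm wB' Um unifU rk])
  have nonneg: "nonneg_on \<Omega> w"
  proof -
    have "AE x in lebesgue_on \<Omega>. \<forall>n. w x \<ge> - inverse (real (Suc n))"
    proof (subst AE_all_countable, rule allI)
      fix n
      obtain N where "AE x in lebesgue_on \<Omega>. \<bar>U N x - w x\<bar> \<le> inverse (real (Suc n))"
        using unifU[of "inverse (real (Suc n))"] by auto
      with U(2)[of N, unfolded nonneg_on_def]
      show "AE x in lebesgue_on \<Omega>. w x \<ge> - inverse (real (Suc n))"
        by eventually_elim linarith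
    qed
    then show ?thesis
      unfolding nonneg_on_def
    proof eventually_elim
      case (elim x)
      have "(\<lambda>n. - inverse (real (Suc n))) \<longlonglongrightarrow> - 0"
        by (intro tendsto_intros LIMSEQ_inverse_real_of_nat)
      from LIMSEQ_le_const2[OF this, of "w x"] elim show ?case by simp
    qed
  qed
  have lim_powr: "(\<lambda>j. f j powr t) \<longlonglongrightarrow> a powr t" if "f \<longlonglongrightarrow> a" "\<And>j. f j \<ge> 0" "t > 0" for f :: "nat \<Rightarrow> real" and a t
    using that by (intro tendsto_powr2 tendsto_const) auto
  \<comment> \<open>A competitor \<open>z\<close> is bounded, so its L^r norms tend to its sup norm
    and both sides of the minimality inequality converge.\<close>
  have min_lim: "functional al be m s p kap \<infinity> w \<le> functional al be m s p kap \<infinity> z"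
    if z: "z \<in> W10 \<Omega> m" "nonzero_on \<Omega> z" for z
  proof (rule LIMSEQ_le)
    show "(\<lambda>j. functional al be m s p (\<kappa> (k j)) (ereal (r (k j))) (U j)) \<longlonglongrightarrow> functional al be m s p kap \<infinity> w"
      unfolding functional_def
      by (intro tendsto_diff tendsto_add tendsto_mult tendsto_const lim_powr limm lims limr \<kappa>k Lnorm_nonneg m1 p0)
    show "(\<lambda>j. functional al be m s p (\<kappa> (k j)) (ereal (r (k j))) z) \<longlonglongrightarrow> functional al be m s p kap \<infinity> z"
      unfolding functional_def
      by (intro tendsto_diff tendsto_add tendsto_mult tendsto_const lim_powr
          Lnorm_tendsto_infinity_const[OF mD z(1) rk] \<kappa>k Lnorm_nonneg p0)
    show "\<exists>N. \<forall>n\<ge>N. functional al be m s p (\<kappa> (k n)) (ereal (r (k n))) (U n)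
        \<le> functional al be m s p (\<kappa> (k n)) (ereal (r (k n))) z"
      unfolding U_def using min[OF z] by blast
  qed
  show ?thesis
    by (rule that[OF k closed(1) nonneg closed(3)[unfolded U_def] limm[unfolded U_def]
          lims[unfolded U_def] limr[unfolded U_def] min_lim])
qed

section \<open>Least energy solutions\<close>


lemma exists_nonzero_test_function:
  obtains \<phi> where "\<phi> \<in> test_functions \<Omega>" "nonzero_on \<Omega> \<phi>"
proof -
  obtain x where "x \<in> \<Omega>" using nonempty_dom by blast
  then obtain a b where ab: "cbox a b \<subseteq> \<Omega>" "x \<in> box a b"
    using open_contains_cbox[OF open_dom] by metis
  have "nonzero_on \<Omega> (box_bump a b 1)"
    unfolding nonzero_on_def
  proof
    assume "AE x in lebesgue_on \<Omega>. box_bump a b 1 x = 0"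
    then have "AE x in lebesgue. x \<in> \<Omega> \<longrightarrow> box_bump a b 1 x = 0" by (simp add: AE_restrict_space_iff)
    then have "AE x in lebesgue. x \<notin> box a b"
    proof eventually_elim
      case (elim x)
      then show ?case
        using ab(1) box_subset_cbox[of a b] box_bump_eq_0_iff[of 1 a b x] by fastforce
    qed
    then have "negligible (box a b)"
      by (simp add: AE_iff_null_sets negligible_iff_null_sets)
    then show False using open_not_negligible[of "box a b"] ab(2) by blast
  qed
  then show ?thesis using box_bump_test_function[OF _ ab(1), of 1] that by simp
qed

lemma Lnorm_infinity_pos:
  fixes m :: real
  assumes m: "m > DIM('a)" and u: "u \<in> W10 \<Omega> m" "nonzero_on \<Omega> u"
  shows "Lnorm \<Omega> \<infinity> u > 0"
proof -
  have um: "u \<in> borel_measurable (lebesgue_on \<Omega>)" by (rule Lspace_measurable[OF W10D(1)[OF u(1)]])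
  obtain B where B: "AE x in lebesgue_on \<Omega>. \<bar>u x\<bar> \<le> B" using W10_AE_bounded[OF m u(1)] .
  note I = Lnorm_infinity[OF um B]
  have "Lnorm \<Omega> \<infinity> u \<noteq> 0"
  proof
    assume "Lnorm \<Omega> \<infinity> u = 0"
    with I(1) have "AE x in lebesgue_on \<Omega>. u x = 0" by simp
    with u(2) show False by (simp add: nonzero_on_def)
  qed
  with I(2) show ?thesis by simp
qed

text \<open>With a vanishing gradient norm the sup bound would force \<open>u = 0\<close>.\<close>

lemma Lnorm_grad_pos:
  fixes m s :: real
  assumes s: "s > DIM('a)" "s \<le> m" and u: "u \<in> W10 \<Omega> m" "nonzero_on \<Omega> u"
  shows "L s (grad u) > 0"
proof -
  obtain C where C: "AE x in lebesgue_on \<Omega>. \<bar>u x\<bar> \<le> C * L s (grad u)"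
    using W10_sup_bound[OF s(1)] s(2) u(1) by metis
  have "L s (grad u) \<noteq> 0"
  proof
    assume "L s (grad u) = 0"
    with C have "AE x in lebesgue_on \<Omega>. u x = 0" by simp
    with u(2) show False by (simp add: nonzero_on_def)
  qed
  with Lnorm_nonneg[of \<Omega> s "grad u"] show ?thesis by simp
qed

text \<open>The constant has to be uniform in \<open>r\<close>. A number V >= 1 satisfies V^(1/r) <=
  V for all r >= 1, which is why the measure of \<Omega> is enlarged by 1.\<close>

lemma Lnorm_le_grad:
  fixes s :: real
  assumes s: "s > DIM('a)"
  obtains M where "M > 0" "\<And>m r u. s \<le> m \<Longrightarrow> r \<ge> 1 \<Longrightarrow> u \<in> W10 \<Omega> m \<Longrightarrow> L r u \<le> M * L s (grad u)"
proof -
  obtain C where C: "C > 0" "\<And>m u. s \<le> m \<Longrightarrow> u \<in> W10 \<Omega> m \<Longrightarrow>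
    AE x in lebesgue_on \<Omega>. \<bar>u x\<bar> \<le> C * L s (grad u)"
    using W10_sup_bound[OF s] by metis
  define V where "V = measure lebesgue \<Omega> + 1"
  have V: "V \<ge> 1" by (simp add: V_def)
  have "L r u \<le> V * C * L s (grad u)" if sm: "s \<le> m" and r: "r \<ge> 1" and u: "u \<in> W10 \<Omega> m" for m r u
  proof -
    have um: "u \<in> borel_measurable (lebesgue_on \<Omega>)" by (rule Lspace_measurable[OF W10D(1)[OF u]])
    have CL: "C * L s (grad u) \<ge> 0" using C(1) Lnorm_nonneg by (intro mult_nonneg_nonneg) auto
    have "L r u \<le> measure lebesgue \<Omega> powr (1 / r) * (C * L s (grad u))"
      using C(2)[OF sm u] CL r by (intro Lnorm_AE_bound(2) um) auto
    also have "measure lebesgue \<Omega> powr (1 / r) \<le> V powr (1 / r)"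
      using r by (intro powr_mono2) (auto simp: V_def)
    also have "V powr (1 / r) \<le> V powr 1" using V r by (intro powr_mono) auto
    finally show ?thesis using CL V by (simp add: mult_right_mono mult.assoc)
  qed
  with that[of "V * C"] C(1) V show ?thesis by simp
qed

lemma Lnorm_grad_scale:
  assumes m: "m \<ge> 1" and u: "u \<in> W10 \<Omega> m" and s: "s > 0"
  shows "L s (grad (\<lambda>x. t * u x)) = \<bar>t\<bar> * L s (grad u)"
  using Lnorm_grad_comb[OF m W10_W1[OF u] W10_W1[OF u], of s t 0] Lnorm_scaleR[OF s, of \<Omega> t "grad u"]
  by simp

lemma W10_scale: "m \<ge> 1 \<Longrightarrow> u \<in> W10 \<Omega> m \<Longrightarrow> (\<lambda>x. t * u x) \<in> W10 \<Omega> m"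
  using W10_comb[of m u u t 0] by simp

lemma nonzero_on_scale: "t \<noteq> 0 \<Longrightarrow> nonzero_on \<Omega> u \<Longrightarrow> nonzero_on \<Omega> (\<lambda>x. t * u x)"
  by (simp add: nonzero_on_def)

lemma Lnorm_infinity_scale:
  assumes t: "t > 0" and f: "f \<in> borel_measurable (lebesgue_on \<Omega>)" and B: "AE x in lebesgue_on \<Omega>. \<bar>f x\<bar> \<le> B"
  shows "Lnorm \<Omega> \<infinity> (\<lambda>x. t * f x) = t * Lnorm \<Omega> \<infinity> f"
proof -
  have le: "Lnorm \<Omega> \<infinity> (\<lambda>x. t * f x) \<le> t * Lnorm \<Omega> \<infinity> f"
    if "t > 0" "f \<in> borel_measurable (lebesgue_on \<Omega>)" "AE x in lebesgue_on \<Omega>. \<bar>f x\<bar> \<le> B" for t f B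
  proof -
    have "AE x in lebesgue_on \<Omega>. \<bar>t * f x\<bar> \<le> t * Lnorm \<Omega> \<infinity> f"
      using Lnorm_infinity(1)[OF that(2,3)] by eventually_elim (use that(1) in \<open>simp add: abs_mult\<close>)
    then show ?thesis using that(2) by (intro Lnorm_infinity(3)) auto
  qed
  have "AE x in lebesgue_on \<Omega>. \<bar>t * f x\<bar> \<le> t * B"
    using B by eventually_elim (use t in \<open>simp add: abs_mult\<close>)
  \<comment> \<open>The reverse inequality is \<open>le\<close> for the factor
    \<open>inverse t\<close>.\<close>
  then have "Lnorm \<Omega> \<infinity> (\<lambda>x. inverse t * (t * f x)) \<le> inverse t * Lnorm \<Omega> \<infinity> (\<lambda>x. t * f x)"
    using t f by (intro le) auto
  moreover have "(\<lambda>x. inverse t * (t * f x)) = f" using t by (auto simp: fun_eq_iff)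
  ultimately have "t * Lnorm \<Omega> \<infinity> f \<le> Lnorm \<Omega> \<infinity> (\<lambda>x. t * f x)" using t by (simp add: field_simps)
  with le[OF t f B] show ?thesis by simp
qed

text \<open>Along multiples t \<phi> of a test function with t -> 0 every term tends to 0. So
  although 0 is not a competitor, the infimum does not exceed its value.\<close>

lemma functional_nonpos:
  fixes m :: real
  assumes m: "m > DIM('a)" and s: "s > 0" and p: "p > 0"
    and r: "r = \<infinity> \<or> (\<exists>r'>0. r = ereal r')"
    and min: "\<And>w. w \<in> W10 \<Omega> m \<Longrightarrow> nonzero_on \<Omega> w \<Longrightarrow> c \<le> functional al be m s p \<kappa> r w"
  shows "c \<le> 0"
proof -
  have m1: "m \<ge> 1" "m > 0" using m DIM_ge_Suc0[where 'a='a] by linarith+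
  obtain \<phi> where \<phi>: "\<phi> \<in> test_functions \<Omega>" "nonzero_on \<Omega> \<phi>" using exists_nonzero_test_function .
  have \<phi>W: "\<phi> \<in> W10 \<Omega> m" by (rule test_function_W10[OF m1(1) \<phi>(1)])
  have \<phi>m: "\<phi> \<in> borel_measurable (lebesgue_on \<Omega>)" by (rule Lspace_measurable[OF W10D(1)[OF \<phi>W]])
  obtain B where B: "AE x in lebesgue_on \<Omega>. \<bar>\<phi> x\<bar> \<le> B" using W10_AE_bounded[OF m \<phi>W] .
  have scale: "Lnorm \<Omega> r (\<lambda>x. t * \<phi> x) = t * Lnorm \<Omega> r \<phi>" if "t > 0" for t
    using r Lnorm_infinity_scale[OF that \<phi>m B] Lnorm_mult[of _ \<Omega> t \<phi>] that by auto
  define t where "t n = inverse (real (Suc n))" for n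
  have t: "t n > 0" for n by (simp add: t_def)
  have t0: "t \<longlonglongrightarrow> 0" unfolding t_def by (rule LIMSEQ_inverse_real_of_nat)
  have z: "(\<lambda>n. (t n * a) powr b) \<longlonglongrightarrow> 0" if "b > 0" "a \<ge> 0" for a b
  proof -
    have "(\<lambda>n. (t n * a) powr b) \<longlonglongrightarrow> (0 * a) powr b"
    proof (rule tendsto_powr2)
      show "(\<lambda>n. t n * a) \<longlonglongrightarrow> 0 * a" by (intro tendsto_intros t0)
      have "0 \<le> t n * a" for n using t[of n] that by simp
      then show "\<forall>\<^sub>F n in sequentially. 0 \<le> t n * a" by (rule always_eventually[OF allI])
    qed (use that in auto)
    then show ?thesis by simp
  qed
  have r0: "Lnorm \<Omega> r \<phi> \<ge> 0" using r Lnorm_infinity(2)[OF \<phi>m B] Lnorm_nonneg by auto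
  have eq: "functional al be m s p \<kappa> r (\<lambda>x. t n * \<phi> x) =
      al * (t n * L m (grad \<phi>)) powr m + \<kappa> * (t n * L s (grad \<phi>)) powr p - be * (t n * Lnorm \<Omega> r \<phi>) powr p" for n
    using t[of n] by (simp add: functional_def scale Lnorm_grad_scale[OF m1(1) \<phi>W] m1 s)
  have "(\<lambda>n. functional al be m s p \<kappa> r (\<lambda>x. t n * \<phi> x)) \<longlonglongrightarrow> al * 0 + \<kappa> * 0 - be * 0"
    unfolding eq by (intro tendsto_intros z m1 p Lnorm_nonneg r0)
  moreover have "c \<le> functional al be m s p \<kappa> r (\<lambda>x. t n * \<phi> x)" for n
    using t[of n] by (intro min W10_scale m1 \<phi>W nonzero_on_scale \<phi>(2)) auto
  ultimately show ?thesis by (intro LIMSEQ_le_const[where a = c]) auto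
qed

lemma functional_AE_zero:
  fixes m :: real
  assumes m: "m > DIM('a)" and u: "u \<in> W10 \<Omega> m" "\<not> nonzero_on \<Omega> u" and s: "s > 0"
  shows "L s (grad u) = 0" "Lnorm \<Omega> \<infinity> u = 0"
proof -
  have m1: "m \<ge> 1" using m DIM_ge_Suc0[where 'a='a] by linarith
  \<comment> \<open>A weak gradient is chosen for each function separately, so \<open>u\<close> is
    compared with \<open>0 * u\<close>, whose gradient norm is known by scaling.\<close>
  have ae: "AE x in lebesgue_on \<Omega>. u x = 0 * u x" using u(2) by (simp add: nonzero_on_def)
  have W: "(\<lambda>x. 0 * u x) \<in> W10 \<Omega> m" by (rule W10_scale[OF m1 u(1)])
  have "AE x in lebesgue_on \<Omega>. grad u x = grad (\<lambda>x. 0 * u x) x"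
    by (rule weak_gradient_unique[OF open_dom W10D(3)[OF u(1)] W10D(3)[OF W] ae])
  then have "L s (grad u) = L s (grad (\<lambda>x. 0 * u x))"
    by (rule Lnorm_cong_AE[OF Lspace_measurable[OF W10D(2)[OF u(1)]] Lspace_measurable[OF W10D(2)[OF W]]])
  then show "L s (grad u) = 0" using Lnorm_grad_scale[OF m1 u(1) s, of 0] by simp
  have um: "u \<in> borel_measurable (lebesgue_on \<Omega>)" by (rule Lspace_measurable[OF W10D(1)[OF u(1)]])
  have b: "AE x in lebesgue_on \<Omega>. \<bar>u x\<bar> \<le> 0" using ae by eventually_elim simp
  show "Lnorm \<Omega> \<infinity> u = 0" using Lnorm_infinity(2)[OF um b] Lnorm_infinity(3)[OF um b b] by simp
qed

text \<open>The hypothesis that \<open>lam\<close> exceeds the eigenvalue acts only through such a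
  \<open>v\<close>: \<open>lam\<close> lies above an infimum of quotients, hence above one of them,
  and the positive sup norm clears the denominator.\<close>

lemma eigenvalue_competitor:
  fixes p :: real
  assumes p: "p > DIM('a)" and lam: "lam > sobolev_eigenvalue \<Omega> \<infinity> p"
  obtains v where "v \<in> W10 \<Omega> p" "nonzero_on \<Omega> v" "L p (grad v) powr p < lam * Lnorm \<Omega> \<infinity> v powr p"
proof -
  have p1: "p \<ge> 1" using p DIM_ge_Suc0[where 'a='a] by linarith
  obtain \<phi> where \<phi>: "\<phi> \<in> test_functions \<Omega>" "nonzero_on \<Omega> \<phi>" using exists_nonzero_test_function .
  let ?S = "{L p (grad v) powr p / Lnorm \<Omega> \<infinity> v powr p | v. v \<in> W10 \<Omega> p \<and> nonzero_on \<Omega> v}"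
  have "?S \<noteq> {}" using test_function_W10[OF p1 \<phi>(1)] \<phi>(2) by blast
  moreover have "Inf ?S < lam" using lam by (simp add: sobolev_eigenvalue_def)
  ultimately have "\<exists>x\<in>?S. x < lam" by (rule cInf_lessD)
  then obtain v where v: "v \<in> W10 \<Omega> p" "nonzero_on \<Omega> v" "L p (grad v) powr p / Lnorm \<Omega> \<infinity> v powr p < lam"
    by (elim bexE CollectE exE conjE) simp
  have "Lnorm \<Omega> \<infinity> v > 0" by (rule Lnorm_infinity_pos[OF p v(1,2)])
  then have "L p (grad v) powr p < lam * Lnorm \<Omega> \<infinity> v powr p" using v(3) by (simp add: field_simps)
  with v show ?thesis by (intro that)
qed

text \<open>One function suffices: its quotient for exponent \<infinity> is below
  \<open>lam\<close>, its quotients for \<open>r n\<close> converge to that one, and they bound the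
  infima from above.\<close>

lemma eventually_eigenvalue_less:
  fixes p :: real
  assumes p: "p > DIM('a)" and lam: "lam > sobolev_eigenvalue \<Omega> \<infinity> p"
    and r: "filterlim r at_top sequentially"
  shows "\<forall>\<^sub>F n in sequentially. sobolev_eigenvalue \<Omega> (ereal (r n)) p < lam"
proof -
  obtain v where v: "v \<in> W10 \<Omega> p" "nonzero_on \<Omega> v" "L p (grad v) powr p < lam * Lnorm \<Omega> \<infinity> v powr p"
    using eigenvalue_competitor[OF p lam] .
  have pos: "Lnorm \<Omega> \<infinity> v > 0" by (rule Lnorm_infinity_pos[OF p v(1,2)])
  have p0: "p > 0" using p of_nat_0_le_iff[of "DIM('a)", where 'a=real] by linarith
  have "(\<lambda>n. L p (grad v) powr p / L (r n) v powr p) \<longlonglongrightarrow> L p (grad v) powr p / Lnorm \<Omega> \<infinity> v powr p"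
    using pos p0 by (intro tendsto_divide tendsto_const tendsto_powr
        Lnorm_tendsto_infinity_const[OF p v(1) r]) auto
  moreover have "L p (grad v) powr p / Lnorm \<Omega> \<infinity> v powr p < lam" using v(3) pos by (simp add: field_simps)
  ultimately have "\<forall>\<^sub>F n in sequentially. L p (grad v) powr p / L (r n) v powr p < lam"
    by (rule order_tendstoD(2))
  then show ?thesis
  proof eventually_elim
    case (elim n)
    have "sobolev_eigenvalue \<Omega> (ereal (r n)) p \<le> L p (grad v) powr p / L (r n) v powr p"
      unfolding sobolev_eigenvalue_def
      using v by (intro cInf_lower bdd_belowI[of _ 0]) auto
    with elim show ?case by linarith
  qed
qed

section \<open>The case p < q\<close>

lemma energy_eq_functional:
  "energy \<Omega> p q lam r u = functional (1 / q) (lam / p) q p p (1 / p) r u"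
  by (simp add: energy_def functional_def)

text \<open>Coercivity gives the gradient bound: a nonpositive minimum implies g^q <= T g^p for the
  L^q norm g of the gradient, and p < q then bounds g independently of \<open>n\<close>.\<close>

theorem least_energy_limit_less:
  fixes p q lam :: real and u :: "nat \<Rightarrow> 'a \<Rightarrow> real"
  assumes p: "p > DIM('a)" "p \<ge> 2" and pq: "p < q" and lam: "lam \<ge> 0"
    and r: "\<And>n. r n \<ge> 1" "filterlim r at_top sequentially"
    and u: "\<And>n. nonneg_on \<Omega> (u n)" "\<And>n. least_energy_solution \<Omega> p q lam (r n) (u n)"
  obtains k :: "nat \<Rightarrow> nat" and v where "strict_mono k" "nonneg_on \<Omega> v" "least_energy_solution_infinity \<Omega> p q lam v"
    "(\<lambda>j. W1_norm \<Omega> (max p q) (\<lambda>x. u (k j) x - v x)) \<longlonglongrightarrow> 0"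
proof -
  have q: "q > DIM('a)" "q \<ge> 2" "q > 0" using p pq by auto
  have p0: "p > 0" "p \<ge> 1" using p by auto
  have mx: "max p q = q" using pq by simp
  have uW: "u n \<in> W10 \<Omega> q" "nonzero_on \<Omega> (u n)" for n
    using u(2)[of n] pq by (auto simp: least_energy_solution_def is_arg_min_def X_space_def mx)
  have min: "functional (1 / q) (lam / p) q p p (1 / p) (ereal (r n)) (u n) \<le> functional (1 / q) (lam / p) q p p (1 / p) (ereal (r n)) w"
    if "w \<in> W10 \<Omega> q" "nonzero_on \<Omega> w" for n w
    using u(2)[of n] pq that
    by (auto simp: least_energy_solution_def is_arg_min_def X_space_def mx energy_eq_functional not_less)
  obtain M where M: "M > 0" "\<And>m r u. q \<le> m \<Longrightarrow> r \<ge> 1 \<Longrightarrow> u \<in> W10 \<Omega> m \<Longrightarrow> L r u \<le> M * L q (grad u)"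
    using Lnorm_le_grad[OF q(1)] by metis
  \<comment> \<open>Solves (1/q) g^q <= (lam/p) (M g)^p for g^q.\<close>
  define T where "T = q * lam / p * M powr p"
  have K: "L q (grad (u n)) \<le> T powr (1 / (q - p))" for n
  proof (cases "L q (grad (u n)) = 0")
    case False
    define g where "g = L q (grad (u n))"
    have g: "g > 0" using False Lnorm_nonneg[of \<Omega> q "grad (u n)"] by (simp add: g_def)
    have "functional (1 / q) (lam / p) q p p (1 / p) (ereal (r n)) (u n) \<le> 0"
      using r(1)[of n] by (intro functional_nonpos[OF q(1) p0(1) p0(1) _ min]) (auto intro!: exI[of _ "r n"])
    moreover have "1 / p * L p (grad (u n)) powr p \<ge> 0" using p0 by simp
    ultimately have "1 / q * g powr q \<le> lam / p * L (r n) (u n) powr p"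
      by (simp add: functional_def g_def)
    also have "\<dots> \<le> lam / p * (M * g) powr p"
      using M(2)[OF order_refl r(1) uW(1), of n n] lam p0 Lnorm_nonneg[of \<Omega> "r n" "u n"]
      by (intro mult_left_mono powr_mono2) (auto simp: g_def)
    finally have "g powr q \<le> T * g powr p"
      using q(3) M(1) g by (simp add: T_def powr_mult field_simps)
    then have "g powr (q - p) \<le> T" using g by (simp add: powr_diff field_simps)
    then have "(g powr (q - p)) powr (1 / (q - p)) \<le> T powr (1 / (q - p))"
      using pq by (intro powr_mono2) auto
    then show ?thesis using g pq by (simp add: powr_powr g_def)
  qed simp
  obtain k :: "nat \<Rightarrow> nat" and v where k: "strict_mono k" and v: "v \<in> W10 \<Omega> q" "nonneg_on \<Omega> v"
    and conv: "(\<lambda>j. W1_norm \<Omega> q (\<lambda>x. u (k j) x - v x)) \<longlonglongrightarrow> 0"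
    and vmin: "\<And>w. w \<in> W10 \<Omega> q \<Longrightarrow> nonzero_on \<Omega> w \<Longrightarrow>
       functional (1 / q) (lam / p) q p p (1 / p) \<infinity> v \<le> functional (1 / q) (lam / p) q p p (1 / p) \<infinity> w"
  proof (rule minimizers_converge[of q p p "1 / q" "lam / p" u "T powr (1 / (q - p))" "\<lambda>_. 1 / p" "1 / p" r])
    show "0 \<le> lam / p" using lam p0 by simp
  qed (use q p0 pq uW u(1) K r(2) min in auto)
  have "least_energy_solution_infinity \<Omega> p q lam v"
    unfolding least_energy_solution_infinity_def if_P[OF pq] is_arg_min_def X_space_def mx energy_eq_functional
  proof (intro conjI v notI, elim exE conjE)
    fix w assume w: "w \<in> W10 \<Omega> q"
      and less: "functional (1 / q) (lam / p) q p p (1 / p) \<infinity> w < functional (1 / q) (lam / p) q p p (1 / p) \<infinity> v"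
    \<comment> \<open>\<open>vmin\<close> covers nonzero competitors only. A function vanishing a.e.
      has energy 0, which the minimum does not exceed.\<close>
    have "functional (1 / q) (lam / p) q p p (1 / p) \<infinity> v \<le> 0"
      by (rule functional_nonpos[OF q(1) p0(1) p0(1) _ vmin]) auto
    moreover have "functional (1 / q) (lam / p) q p p (1 / p) \<infinity> w = 0" if "\<not> nonzero_on \<Omega> w"
      using functional_AE_zero[OF q(1) w that q(3)] functional_AE_zero[OF q(1) w that p0(1)]
      by (simp add: functional_def)
    ultimately show False using vmin[OF w] less by fastforce
  qed
  then show ?thesis using that[OF k v(2)] conv by (simp add: mx)
qed


section \<open>The case q < p\<close>

lemma energy_nehari:
  assumes "w \<in> nehari \<Omega> p q lam r" "p > 0"
  shows "energy \<Omega> p q lam r w = (1 / q - 1 / p) * L q (grad w) powr q"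
proof -
  have C: "lam * Lnorm \<Omega> r w powr p = L p (grad w) powr p + L q (grad w) powr q"
    using assms by (simp add: nehari_def)
  have "energy \<Omega> p q lam r w = 1 / p * L p (grad w) powr p + 1 / q * L q (grad w) powr q
      - (lam * Lnorm \<Omega> r w powr p) / p" by (simp add: energy_def)
  also have "\<dots> = (1 / q - 1 / p) * L q (grad w) powr q"
    unfolding C by (simp add: add_divide_distrib left_diff_distrib)
  finally show ?thesis .
qed

text \<open>Every \<open>w\<close> with \<open>\<parallel>\<nabla>w\<parallel>\<^sub>p\<^bsup>p\<^esup> < \<lambda> \<parallel>w\<parallel>\<^sub>r\<^bsup>p\<^esup>\<close> has a unique multiple on the Nehari set, so
  minimality on that set is a homogeneous inequality valid for all \<open>w\<close>.\<close>
lemma nehari_minimizer_inequality: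
  fixes p q lam r :: real
  assumes q: "q > DIM('a)" "q < p" and r: "r > 0"
    and u: "u \<in> nehari \<Omega> p q lam (ereal r)"
    and min: "\<And>w. w \<in> nehari \<Omega> p q lam (ereal r) \<Longrightarrow> energy \<Omega> p q lam (ereal r) u \<le> energy \<Omega> p q lam (ereal r) w"
    and w: "w \<in> W10 \<Omega> p" "nonzero_on \<Omega> w"
  shows "functional 1 lam p q p (L q (grad u) powr (q - p)) (ereal r) u = 0"
    "0 \<le> functional 1 lam p q p (L q (grad u) powr (q - p)) (ereal r) w"
proof -
  have q0: "q > 0" "p > 0" "p \<ge> 1" using q DIM_ge_Suc0[where 'a='a] by linarith+
  have mx: "max p q = p" using q by simp
  have uW: "u \<in> W10 \<Omega> p" "nonzero_on \<Omega> u" using u by (auto simp: nehari_def X_space_def mx)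
  define \<beta> where "\<beta> = L q (grad u)"
  have \<beta>: "\<beta> > 0" unfolding \<beta>_def by (rule Lnorm_grad_pos[OF q(1) less_imp_le[OF q(2)] uW])
  define b where "b = L q (grad w)"
  have b: "b > 0" unfolding b_def by (rule Lnorm_grad_pos[OF q(1) less_imp_le[OF q(2)] w])
  have "\<beta> powr (q - p) * \<beta> powr p = \<beta> powr q" by (simp add: powr_add[symmetric])
  then show "functional 1 lam p q p (L q (grad u) powr (q - p)) (ereal r) u = 0"
    using u by (simp add: functional_def nehari_def \<beta>_def)
  define A where "A = L p (grad w) powr p"
  define C where "C = L r w powr p"
  have "lam * C - A \<le> \<beta> powr (q - p) * b powr p"
  proof (cases "lam * C \<le> A")
    case True
    have "0 \<le> \<beta> powr (q - p) * b powr p" by simp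
    with True show ?thesis by linarith
  next
    case False
    define E where "E = lam * C - A"
    have E: "E > 0" using False by (simp add: E_def)
    \<comment> \<open>\<open>t\<close> solves t^p E = t^q b^q, which puts \<open>t * w\<close> on
      the Nehari set.\<close>
    define t where "t = (b powr q / E) powr (1 / (p - q))"
    have t: "t > 0" using b E by (simp add: t_def)
    have tE: "t powr (p - q) = b powr q / E" using b E q by (simp add: t_def powr_powr)
    let ?w = "\<lambda>x. t * w x"
    have tp: "t powr p = t powr q * (b powr q / E)"
      unfolding tE[symmetric] by (simp add: powr_add[symmetric])
    have tw: "?w \<in> nehari \<Omega> p q lam (ereal r)"
      unfolding nehari_def X_space_def mx
    proof (intro CollectI conjI)
      show "?w \<in> W10 \<Omega> p" by (rule W10_scale[OF q0(3) w(1)])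
      show "nonzero_on \<Omega> ?w" using t w by (intro nonzero_on_scale) auto
      have "L p (grad ?w) powr p = t powr p * A" "L q (grad ?w) powr q = t powr q * b powr q"
        "L r ?w powr p = t powr p * C"
        using t q0 r by (simp_all add: Lnorm_grad_scale[OF q0(3) w(1)] Lnorm_mult powr_mult A_def b_def C_def)
      moreover have "t powr q * b powr q = t powr p * E" using E by (simp add: tp)
      ultimately show "L p (grad ?w) powr p + L q (grad ?w) powr q = lam * L r ?w powr p"
        by (simp add: E_def algebra_simps)
    qed
    \<comment> \<open>On the Nehari set the energy is a positive multiple of the q-th power of the
      L^q norm of the gradient, so minimality just compares these norms.\<close>
    have "(1 / q - 1 / p) * \<beta> powr q \<le> (1 / q - 1 / p) * L q (grad ?w) powr q"
      using min[OF tw] unfolding energy_nehari[OF u q0(2)] energy_nehari[OF tw q0(2)] \<beta>_def .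
    moreover have "1 / q - 1 / p > 0" using q q0 by (simp add: field_simps)
    ultimately have "\<beta> powr q \<le> L q (grad ?w) powr q" by simp
    also have "L q (grad ?w) = t * b" using t q0 by (simp add: Lnorm_grad_scale[OF q0(3) w(1)] b_def)
    finally have "\<beta> powr q \<le> (t * b) powr q" .
    then have "\<beta> \<le> t * b"
      using powr_less_mono2[of q "t * b" \<beta>] q0(1) t b by (meson less_imp_le mult_pos_pos not_less)
    \<comment> \<open>Raising to the power p - q eliminates \<open>t\<close>, since t^(p - q) = b^q
      / E.\<close>
    then have "\<beta> powr (p - q) \<le> (t * b) powr (p - q)" using \<beta> q by (intro powr_mono2) auto
    also have "\<dots> = b powr q * b powr (p - q) / E" by (simp add: powr_mult tE)
    also have "b powr q * b powr (p - q) = b powr p" by (simp add: powr_add[symmetric])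
    finally have "E * \<beta> powr (p - q) \<le> b powr p" using E by (simp add: field_simps)
    then have "E \<le> b powr p / \<beta> powr (p - q)" using \<beta> by (simp add: field_simps)
    also have "\<dots> = \<beta> powr (q - p) * b powr p"
      using powr_minus_divide[of \<beta> "p - q"] by simp
    finally show ?thesis by (simp add: E_def)
  qed
  then show "0 \<le> functional 1 lam p q p (L q (grad u) powr (q - p)) (ereal r) w"
    by (simp add: functional_def A_def b_def C_def \<beta>_def)
qed

text \<open>The coefficients \<open>\<kappa> n\<close> lie eventually in a compact interval of
  positive numbers, so a subsequence converges before \<open>minimizers_converge\<close> is applied.
  As \<open>\<kappa> n\<close> determines the L^q norm of the gradient, its limit determines that of
  \<open>v\<close>.\<close>

theorem least_energy_limit_greater:
  fixes p q lam :: real and u :: "nat \<Rightarrow> 'a \<Rightarrow> real"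
  assumes q: "q > DIM('a)" "q < p" and p: "p \<ge> 2" and lam: "lam > sobolev_eigenvalue \<Omega> \<infinity> p" "lam \<ge> 0"
    and r: "\<And>n. r n \<ge> 1" "filterlim r at_top sequentially"
    and u: "\<And>n. nonneg_on \<Omega> (u n)" "\<And>n. least_energy_solution \<Omega> p q lam (r n) (u n)"
  obtains k :: "nat \<Rightarrow> nat" and v where "strict_mono k" "nonneg_on \<Omega> v" "least_energy_solution_infinity \<Omega> p q lam v"
    "(\<lambda>j. W1_norm \<Omega> (max p q) (\<lambda>x. u (k j) x - v x)) \<longlonglongrightarrow> 0"
proof -
  have pD: "p > DIM('a)" and npq: "\<not> p < q" and mx: "max p q = p" using q by auto
  have q0: "q > 0" "q \<ge> 1" "p > 0" "p \<ge> 1" using q DIM_ge_Suc0[where 'a='a] by linarith+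
  have uN: "u n \<in> nehari \<Omega> p q lam (ereal (r n))"
    and umin: "w \<in> nehari \<Omega> p q lam (ereal (r n)) \<Longrightarrow>
      energy \<Omega> p q lam (ereal (r n)) (u n) \<le> energy \<Omega> p q lam (ereal (r n)) w" for n w
    using u(2)[of n] npq by (auto simp: least_energy_solution_def is_arg_min_def not_less)
  have uW: "u n \<in> W10 \<Omega> p" "nonzero_on \<Omega> (u n)" for n
    using uN[of n] by (auto simp: nehari_def X_space_def mx)
  have uC: "L p (grad (u n)) powr p + L q (grad (u n)) powr q = lam * L (r n) (u n) powr p" for n
    using uN[of n] by (simp add: nehari_def)
  define b where "b n = L q (grad (u n))" for n
  have b: "b n > 0" for n
    unfolding b_def by (rule Lnorm_grad_pos[OF q(1) less_imp_le[OF q(2)] uW])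
  define \<kappa> where "\<kappa> n = b n powr (q - p)" for n
  have \<kappa>0: "\<kappa> n > 0" for n using b[of n] by (simp add: \<kappa>_def)
  have r0: "r n > 0" for n using r(1)[of n] by linarith
  note ineq = nehari_minimizer_inequality[OF q r0 uN umin, folded b_def, folded \<kappa>_def]
  \<comment> \<open>Bounds for \<kappa> thus become bounds for \<open>b\<close>, reversed because q
    - p < 0.\<close>
  have b\<kappa>: "b n = \<kappa> n powr (- 1 / (p - q))" for n
  proof -
    have "(q - p) * (- 1 / (p - q)) = 1" using q by (simp add: field_simps)
    then show ?thesis using b[of n] unfolding \<kappa>_def powr_powr by simp
  qed
  obtain M where M: "M > 0" "\<And>m r u. q \<le> m \<Longrightarrow> r \<ge> 1 \<Longrightarrow> u \<in> W10 \<Omega> m \<Longrightarrow> L r u \<le> M * L q (grad u)"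
    using Lnorm_le_grad[OF q(1)] by metis
  have C: "lam * L (r n) (u n) powr p \<le> lam * M powr p * b n powr p" for n
  proof -
    have "L (r n) (u n) powr p \<le> (M * b n) powr p"
      unfolding b_def using M(2)[OF less_imp_le[OF q(2)] r(1) uW(1)] q0 Lnorm_nonneg by (intro powr_mono2) auto
    then show ?thesis using lam(2) by (simp add: powr_mult mult_left_mono mult.assoc)
  qed
  \<comment> \<open>The Nehari identity bounds b^q by the zeroth order term, and the embedding
    bounds that term by a multiple of b^p.\<close>
  have \<kappa>up: "\<kappa> n \<le> lam * M powr p" for n
  proof -
    have "\<kappa> n * b n powr p = b n powr q" by (simp add: \<kappa>_def powr_add[symmetric])
    also have "\<dots> \<le> lam * M powr p * b n powr p"
      using uC[of n] C[of n] by (simp add: b_def) (smt (verit) powr_ge_zero)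
    finally show ?thesis using b[of n] by simp
  qed
  obtain v0 where v0: "v0 \<in> W10 \<Omega> p" "nonzero_on \<Omega> v0" "L p (grad v0) powr p < lam * Lnorm \<Omega> \<infinity> v0 powr p"
    using eigenvalue_competitor[OF pD lam(1)] .
  define b0 where "b0 = L q (grad v0)"
  have b0: "b0 > 0" unfolding b0_def by (rule Lnorm_grad_pos[OF q(1) less_imp_le[OF q(2)] v0(1,2)])
  \<comment> \<open>Half of the limit of the lower bounds for \<open>\<kappa> n\<close> that the
    competitor \<open>v0\<close> provides; halving makes room for a strict inequality.\<close>
  define c where "c = (lam * Lnorm \<Omega> \<infinity> v0 powr p - L p (grad v0) powr p) / b0 powr p / 2"
  have c: "c > 0" using v0(3) b0 by (simp add: c_def)
  have "\<forall>\<^sub>F n in sequentially. c < \<kappa> n"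
  proof -
    have "(\<lambda>n. (lam * L (r n) v0 powr p - L p (grad v0) powr p) / b0 powr p) \<longlonglongrightarrow>
        (lam * Lnorm \<Omega> \<infinity> v0 powr p - L p (grad v0) powr p) / b0 powr p"
      using b0 Lnorm_infinity_pos[OF pD v0(1,2)]
      by (intro tendsto_intros Lnorm_tendsto_infinity_const[OF pD v0(1) r(2)]) auto
    moreover have "c < (lam * Lnorm \<Omega> \<infinity> v0 powr p - L p (grad v0) powr p) / b0 powr p"
      using c unfolding c_def by linarith
    ultimately have "\<forall>\<^sub>F n in sequentially. c < (lam * L (r n) v0 powr p - L p (grad v0) powr p) / b0 powr p"
      by (rule order_tendstoD(1))
    then show ?thesis
    proof eventually_elim
      case (elim n)
      have "lam * L (r n) v0 powr p - L p (grad v0) powr p \<le> \<kappa> n * b0 powr p"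
        using ineq(2)[OF _ v0(1,2), of n] by (simp add: functional_def b0_def)
      then have "(lam * L (r n) v0 powr p - L p (grad v0) powr p) / b0 powr p \<le> \<kappa> n"
        using b0 by (simp add: field_simps)
      with elim show ?case by linarith
    qed
  qed
  then obtain N where N: "\<And>n. n \<ge> N \<Longrightarrow> c < \<kappa> n" by (auto simp: eventually_sequentially)
  have "\<forall>n. \<kappa> (n + N) \<in> {c..lam * M powr p}" using N \<kappa>up by (auto intro: less_imp_le)
  then obtain kap k1 where kap: "kap \<in> {c..lam * M powr p}" and k1: "strict_mono k1"
    and \<kappa>lim: "((\<lambda>n. \<kappa> (n + N)) \<circ> k1) \<longlonglongrightarrow> kap"
    using compact_imp_seq_compact[OF compact_Icc] by (metis seq_compactE)
  define h where "h j = k1 j + N" for j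
  have h: "strict_mono h" using k1 by (simp add: h_def strict_mono_def)
  have hN: "h j \<ge> N" for j by (simp add: h_def)
  have \<kappa>h: "(\<lambda>j. \<kappa> (h j)) \<longlonglongrightarrow> kap" using \<kappa>lim by (simp add: h_def o_def)
  have rh: "filterlim (\<lambda>j. r (h j)) at_top sequentially"
    by (rule filterlim_compose[OF r(2) filterlim_subseq[OF h]])
  have bh: "b (h j) \<le> c powr (- 1 / (p - q))" for j
    unfolding b\<kappa> using N[OF hN[of j]] c q by (intro powr_mono2') auto
  \<comment> \<open>Via the Nehari identity the bound on \<open>b\<close> controls the L^p norm of
    the gradient too.\<close>
  define K where "K = (lam * M powr p * (c powr (- 1 / (p - q))) powr p) powr (1 / p)"
  have K: "L p (grad (u (h j))) \<le> K" for j
  proof -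
    have "L p (grad (u (h j))) powr p \<le> lam * M powr p * b (h j) powr p"
      using uC[of "h j"] C[of "h j"] by (smt (verit) powr_ge_zero)
    also have "\<dots> \<le> lam * M powr p * (c powr (- 1 / (p - q))) powr p"
      using bh[of j] b[of "h j"] lam q0 by (intro mult_left_mono powr_mono2) auto
    finally have "(L p (grad (u (h j))) powr p) powr (1 / p) \<le> K"
      unfolding K_def using q0 by (intro powr_mono2) auto
    then show ?thesis using q0 Lnorm_nonneg[of \<Omega> p "grad (u (h j))"] by (simp add: powr_powr)
  qed
  obtain k :: "nat \<Rightarrow> nat" and v where k: "strict_mono k" and v: "v \<in> W10 \<Omega> p" "nonneg_on \<Omega> v"
    and conv: "(\<lambda>j. W1_norm \<Omega> p (\<lambda>x. u (h (k j)) x - v x)) \<longlonglongrightarrow> 0"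
    and limp: "(\<lambda>j. L p (grad (u (h (k j))))) \<longlonglongrightarrow> L p (grad v)"
    and limq: "(\<lambda>j. L q (grad (u (h (k j))))) \<longlonglongrightarrow> L q (grad v)"
    and limr: "(\<lambda>j. L (r (h (k j))) (u (h (k j)))) \<longlonglongrightarrow> Lnorm \<Omega> \<infinity> v"
    and vmin: "\<And>w. w \<in> W10 \<Omega> p \<Longrightarrow> nonzero_on \<Omega> w \<Longrightarrow>
       functional 1 lam p q p kap \<infinity> v \<le> functional 1 lam p q p kap \<infinity> w"
  proof (rule minimizers_converge[of p q p 1 lam "\<lambda>j. u (h j)" K "\<lambda>j. \<kappa> (h j)" kap "\<lambda>j. r (h j)"])
    show "functional 1 lam p q p (\<kappa> (h n)) (ereal (r (h n))) (u (h n)) \<le> functional 1 lam p q p (\<kappa> (h n)) (ereal (r (h n))) w"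
      if "w \<in> W10 \<Omega> p" "nonzero_on \<Omega> w" for n w
      using ineq[OF _ that, of "h n"] by simp
  qed (use pD p q q0 lam uW u(1) K \<kappa>h rh less_imp_le[OF \<kappa>0] in auto)
  have hk: "strict_mono (\<lambda>j. h (k j))" using h k by (simp add: strict_mono_def)
  define \<beta> where "\<beta> = L q (grad v)"
  have limb: "(\<lambda>j. b (h (k j))) \<longlonglongrightarrow> \<beta>" using limq by (simp add: b_def \<beta>_def)
  have \<kappa>hk: "(\<lambda>j. \<kappa> (h (k j))) \<longlonglongrightarrow> kap"
    using LIMSEQ_subseq_LIMSEQ[OF \<kappa>h k] by (simp add: o_def)
  have kap0: "kap > 0" using kap c by simp
  \<comment> \<open>Passing to the limit in \<open>b\<kappa>\<close> shows that \<open>kap\<close>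
    is the coefficient belonging to \<open>v\<close> itself, and that the gradient of
    \<open>v\<close> does not vanish.\<close>
  have "(\<lambda>j. \<kappa> (h (k j)) powr (- 1 / (p - q))) \<longlonglongrightarrow> kap powr (- 1 / (p - q))"
    using kap0 by (intro tendsto_powr \<kappa>hk tendsto_const) auto
  then have \<beta>eq: "\<beta> = kap powr (- 1 / (p - q))"
    unfolding b\<kappa>[symmetric] by (rule LIMSEQ_unique[OF limb])
  then have \<beta>: "\<beta> > 0" using kap0 by simp
  have kap\<beta>: "kap = \<beta> powr (q - p)"
  proof -
    have "(- 1 / (p - q)) * (q - p) = 1" using q by (simp add: field_simps)
    then show ?thesis using kap0 unfolding \<beta>eq powr_powr by simp
  qed
  have vnz: "nonzero_on \<Omega> v"
    using functional_AE_zero(1)[OF pD v(1) _ q0(1)] \<beta> by (auto simp: \<beta>_def)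
  have lim_powr: "(\<lambda>j. f j powr t) \<longlonglongrightarrow> a powr t" if "f \<longlonglongrightarrow> a" "\<And>j. f j \<ge> 0" "t > 0" for f :: "nat \<Rightarrow> real" and a t
    using that by (intro tendsto_powr2 tendsto_const) auto
  have vC: "L p (grad v) powr p + \<beta> powr q = lam * Lnorm \<Omega> \<infinity> v powr p"
  proof (rule LIMSEQ_unique)
    show "(\<lambda>j. L p (grad (u (h (k j)))) powr p + L q (grad (u (h (k j)))) powr q) \<longlonglongrightarrow> L p (grad v) powr p + \<beta> powr q"
      unfolding \<beta>_def by (intro tendsto_add lim_powr limp limq Lnorm_nonneg q0)
    show "(\<lambda>j. L p (grad (u (h (k j)))) powr p + L q (grad (u (h (k j)))) powr q) \<longlonglongrightarrow> lam * Lnorm \<Omega> \<infinity> v powr p"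
      unfolding uC by (intro tendsto_mult tendsto_const lim_powr limr Lnorm_nonneg q0)
  qed
  have vN: "v \<in> nehari \<Omega> p q lam \<infinity>"
    using v vnz vC by (simp add: nehari_def X_space_def mx \<beta>_def)
  have "energy \<Omega> p q lam \<infinity> v \<le> energy \<Omega> p q lam \<infinity> w" if w: "w \<in> nehari \<Omega> p q lam \<infinity>" for w
  proof -
    have wW: "w \<in> W10 \<Omega> p" "nonzero_on \<Omega> w" using w by (auto simp: nehari_def X_space_def mx)
    have wC: "L p (grad w) powr p + L q (grad w) powr q = lam * Lnorm \<Omega> \<infinity> w powr p"
      using w by (simp add: nehari_def)
    define d where "d = L q (grad w)"
    have d: "d > 0" unfolding d_def by (rule Lnorm_grad_pos[OF q(1) less_imp_le[OF q(2)] wW])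
    \<comment> \<open>So the minimum is 0, and on the Nehari set \<open>vmin\<close> becomes an
      inequality between L^q norms of gradients.\<close>
    have "functional 1 lam p q p kap \<infinity> v = 0"
    proof -
      have "kap * \<beta> powr p = \<beta> powr q" by (simp add: kap\<beta> powr_add[symmetric])
      then show ?thesis using vC by (simp add: functional_def \<beta>_def)
    qed
    then have "0 \<le> functional 1 lam p q p kap \<infinity> w" using vmin[OF wW] by simp
    then have "d powr q \<le> kap * d powr p" using wC by (simp add: functional_def d_def)
    also have "d powr q = d powr (q - p) * d powr p" by (simp add: powr_add[symmetric])
    finally have "d powr (q - p) \<le> \<beta> powr (q - p)" using d by (simp add: kap\<beta>)
    \<comment> \<open>The exponent q - p is negative, which reverses the inequality.\<close>
    then have "\<beta> \<le> d"
      using powr_less_mono2_neg[of "q - p" d \<beta>] q d by (meson diff_less_0_iff_less not_less)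
    then have "\<beta> powr q \<le> d powr q" using \<beta> q0 by (intro powr_mono2) auto
    moreover have "1 / q - 1 / p \<ge> 0" using q q0 by (simp add: field_simps)
    ultimately show ?thesis
      unfolding energy_nehari[OF vN q0(3)] energy_nehari[OF w q0(3)]
      by (simp add: \<beta>_def d_def mult_left_mono)
  qed
  then have "least_energy_solution_infinity \<Omega> p q lam v"
    using vN npq by (auto simp: least_energy_solution_infinity_def is_arg_min_def not_less)
  with hk v(2) show ?thesis by (rule that) (use conv mx in simp)
qed

text \<open>A gradient norm is nonnegative, so the strict inequality for the competitor forces a
  positive \<open>lam\<close>.\<close>

lemma eigenvalue_bound_pos:
  fixes p :: real
  assumes "p > DIM('a)" "lam > sobolev_eigenvalue \<Omega> \<infinity> p"
  shows "lam > 0"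
proof -
  obtain v where v: "L p (grad v) powr p < lam * Lnorm \<Omega> \<infinity> v powr p"
    using eigenvalue_competitor[OF assms] by metis
  have "0 < lam * Lnorm \<Omega> \<infinity> v powr p" using v powr_ge_zero[of "L p (grad v)" p] by linarith
  then show ?thesis by (simp add: zero_less_mult_iff)
qed

end

section \<open>Both cases combined, along a tail of the sequence\<close>

theorem proposition3p6:
  fixes \<Omega> :: "(real ^ 'n) set"
    and p q lam :: real
    and r :: "nat \<Rightarrow> real"
    and u :: "nat \<Rightarrow> real ^ 'n \<Rightarrow> real"
  assumes "CARD('n) \<ge> 2"
    and "smooth_bounded_domain \<Omega>"
    and "p > real CARD('n)" and "q > real CARD('n)" and "p \<noteq> q"
    and "lam > sobolev_eigenvalue \<Omega> \<infinity> p"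
    and "\<forall>n. r n \<ge> 1"
    and "filterlim r at_top sequentially"
    and "\<forall>n. sobolev_eigenvalue \<Omega> (ereal (r n)) p < lam \<longrightarrow>
           nonneg_on \<Omega> (u n) \<and> least_energy_solution \<Omega> p q lam (r n) (u n)"
  shows "\<exists>k v. strict_mono k \<and>
           (\<forall>j. sobolev_eigenvalue \<Omega> (ereal (r (k j))) p < lam) \<and>
           nonneg_on \<Omega> v \<and> least_energy_solution_infinity \<Omega> p q lam v \<and>
           (\<lambda>j. W1_norm \<Omega> (max p q) (\<lambda>x. u (k j) x - v x)) \<longlonglongrightarrow> 0"
proof -
  interpret nonempty_bounded_open \<Omega>
    using assms(2) by unfold_locales (auto simp: smooth_bounded_domain_def)
  have D: "p > DIM(real ^ 'n)" "q > DIM(real ^ 'n)" using assms(3,4) by simp_all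
  \<comment> \<open>Clarkson's inequality is available for exponents at least 2, here guaranteed by
    p > N >= 2.\<close>
  have p2: "p \<ge> 2" using assms(1,3) by linarith
  have lam: "lam > 0" by (rule eigenvalue_bound_pos[OF D(1) assms(6)])
  obtain N where N: "\<And>n. n \<ge> N \<Longrightarrow> sobolev_eigenvalue \<Omega> (ereal (r n)) p < lam"
    using eventually_eigenvalue_less[OF D(1) assms(6,8)] by (auto simp: eventually_sequentially)
  \<comment> \<open>On this tail the eigenvalue condition holds for every index, so
    \<open>assms(9)\<close> applies to each member.\<close>
  define r' where "r' n = r (n + N)" for n
  define u' where "u' n = u (n + N)" for n
  have r': "\<And>n. r' n \<ge> 1" "filterlim r' at_top sequentially"
    using assms(7) filterlim_compose[OF assms(8) filterlim_add_const_nat_at_top[of N]]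
    by (auto simp: r'_def[abs_def])
  have u': "\<And>n. nonneg_on \<Omega> (u' n)" "\<And>n. least_energy_solution \<Omega> p q lam (r' n) (u' n)"
    using assms(9) N by (auto simp: u'_def r'_def)
  have "\<exists>k v. strict_mono k \<and> nonneg_on \<Omega> v \<and> least_energy_solution_infinity \<Omega> p q lam v \<and>
       (\<lambda>j. W1_norm \<Omega> (max p q) (\<lambda>x. u' (k j) x - v x)) \<longlonglongrightarrow> 0"
  proof (cases "p < q")
    case True
    show ?thesis
      by (rule least_energy_limit_less[OF D(1) p2 True less_imp_le[OF lam] r' u']) blast
  next
    case False
    then have "q < p" using assms(5) by simp
    show ?thesis
      by (rule least_energy_limit_greater[OF D(2) \<open>q < p\<close> p2 assms(6) less_imp_le[OF lam] r' u']) blast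
  qed
  then obtain k v where kv: "strict_mono k" "nonneg_on \<Omega> v" "least_energy_solution_infinity \<Omega> p q lam v"
    "(\<lambda>j. W1_norm \<Omega> (max p q) (\<lambda>x. u' (k j) x - v x)) \<longlonglongrightarrow> 0" by blast
  have "strict_mono (\<lambda>j. k j + N)" using kv(1) by (simp add: strict_mono_def)
  moreover have "\<forall>j. sobolev_eigenvalue \<Omega> (ereal (r (k j + N))) p < lam" using N by simp
  moreover have "(\<lambda>j. W1_norm \<Omega> (max p q) (\<lambda>x. u (k j + N) x - v x)) \<longlonglongrightarrow> 0"
    using kv(4) by (simp add: u'_def)
  ultimately show ?thesis using kv(2,3) by (intro exI[of _ "\<lambda>j. k j + N"] exI[of _ v]) simp
qed

end
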